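(* Let $\nu>0$, $u_0\in\mathcal{M}(\mathbb{R}^2)$, and let $u_1,u_2$ be two distributional solutions of $$u_t-\nu\Delta u+\operatorname{div}(uK(u))=0\ \text{in }(0,\infty)\times\mathbb{R}^2,\qquad u(0)=u_0,$$ such that for every $T>0$: $u_1,u_2\in L^4(0,T;L^4(\mathbb{R}^2)\cap L^{4/3}(\mathbb{R}^2))$; $u_1-u_2\in L^\infty(0,T;H^{-1}(\mathbb{R}^2))$; $u_1(t)-u_2(t)\in L^1(\mathbb{R}^2)$ for a.e. $t\in(0,T)$; and $$\lim_{t\downarrow0}\ \operatorname*{ess\,sup}_{s\in(0,t)}\int_{\mathbb{R}^2}(u_1(s,x)-u_2(s,x))\varphi(x)\,dx=0\quad\text{for all }\varphi\in C_0^\infty(\mathbb{R}^2).$$ Then $u_1\equiv u_2$.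
   Context: $\mathcal{M}(\mathbb{R}^2)$ is the space of finite Radon measures on $\mathbb{R}^2$; $H^{-1}(\mathbb{R}^2)$ is the dual of $H^1(\mathbb{R}^2)$. The Biot–Savart kernel is $k(x)=\frac{(-x_2,x_1)}{2\pi|x|^2}$, $x\ne0$, and $K(z)=k*z$. A function $u\in L^1_{\mathrm{loc}}(0,\infty;L^p(\mathbb{R}^2))$ for some $p\in(1,2)$ is a distributional solution with initial datum $u_0$ if $K(u)u\in L^1_{\mathrm{loc}}((0,\infty)\times\mathbb{R}^2)$ and $$\int_0^\infty\!\!\int_{\mathbb{R}^2}u(\varphi_t+\nu\Delta\varphi+K(u)\cdot\nabla\varphi)\,dx\,dt+\int_{\mathbb{R}^2}\varphi(0,x)\,u_0(dx)=0$$ for all $\varphi\in C_0^\infty([0,\infty)\times\mathbb{R}^2)$. *)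

theory Defs
  imports "HOL-Analysis.Analysis" "HOL-Probability.Essential_Supremum"
begin

coinductive smooth_fun :: "('a::euclidean_space \<Rightarrow> real) \<Rightarrow> bool" where
  "(\<forall>x. f differentiable (at x)) \<Longrightarrow>
   (\<forall>b\<in>Basis. smooth_fun (\<lambda>x. frechet_derivative f (at x) b)) \<Longrightarrow> smooth_fun f"

definition pd :: "('a::euclidean_space \<Rightarrow> real) \<Rightarrow> 'a \<Rightarrow> 'a \<Rightarrow> real" where
  "pd f e x = frechet_derivative f (at x) e"

definition test_fun :: "('a::euclidean_space \<Rightarrow> real) \<Rightarrow> bool" where
  "test_fun f \<longleftrightarrow> smooth_fun f \<and> compact (closure {x. f x \<noteq> 0})"

definition grad_x :: "(real \<times> (real \<times> real) \<Rightarrow> real) \<Rightarrow> real \<times> (real \<times> real) \<Rightarrow> real \<times> real" where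
  "grad_x f z = (pd f (0, (1, 0)) z, pd f (0, (0, 1)) z)"

definition lap_x :: "(real \<times> (real \<times> real) \<Rightarrow> real) \<Rightarrow> real \<times> (real \<times> real) \<Rightarrow> real" where
  "lap_x f z = pd (pd f (0, (1, 0))) (0, (1, 0)) z + pd (pd f (0, (0, 1))) (0, (0, 1)) z"

definition dt :: "(real \<times> (real \<times> real) \<Rightarrow> real) \<Rightarrow> real \<times> (real \<times> real) \<Rightarrow> real" where
  "dt f z = pd f (1, (0, 0)) z"

text \<open>Biot--Savart kernel k(x) = (-x2, x1)/(2 pi |x|^2), x \<noteq> 0 (value 0 at the origin,
  a null set), and K(z) = k * z.\<close>
definition bs_kernel :: "real \<times> real \<Rightarrow> real \<times> real" where
  "bs_kernel x = (if x = 0 then 0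
     else (1 / (2 * pi * (fst x ^ 2 + snd x ^ 2))) *\<^sub>R (- snd x, fst x))"

definition BS :: "(real \<times> real \<Rightarrow> real) \<Rightarrow> real \<times> real \<Rightarrow> real \<times> real" where
  "BS f x = (\<integral>y. f y *\<^sub>R bs_kernel (x - y) \<partial>lborel)"

definition Lp_pow :: "real \<Rightarrow> (real \<times> real \<Rightarrow> real) \<Rightarrow> ennreal" where
  "Lp_pow p f = (\<integral>\<^sup>+x. ennreal (\<bar>f x\<bar> powr p) \<partial>lborel)"

definition Lp_norm :: "real \<Rightarrow> (real \<times> real \<Rightarrow> real) \<Rightarrow> ennreal" where
  "Lp_norm p f = (if Lp_pow p f = \<infinity> then \<infinity> else ennreal (enn2real (Lp_pow p f) powr (1 / p)))"

definition st_meas :: "(real \<Rightarrow> real \<times> real \<Rightarrow> real) \<Rightarrow> bool" where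
  "st_meas u \<longleftrightarrow> (\<lambda>z. u (fst z) (snd z)) \<in> borel_measurable (lborel :: (real \<times> (real \<times> real)) measure)"

definition in_LqLp :: "nat \<Rightarrow> real \<Rightarrow> real \<Rightarrow> (real \<Rightarrow> real \<times> real \<Rightarrow> real) \<Rightarrow> bool" where
  "in_LqLp q p T u \<longleftrightarrow> st_meas u \<and>
     (\<integral>\<^sup>+t. indicator {0<..<T} t * Lp_norm p (u t) ^ q \<partial>lborel) < \<infinity>"

definition in_L1loc_Lp :: "real \<Rightarrow> (real \<Rightarrow> real \<times> real \<Rightarrow> real) \<Rightarrow> bool" where
  "in_L1loc_Lp p u \<longleftrightarrow> st_meas u \<and>
     (\<forall>a b. 0 < a \<longrightarrow> a \<le> b \<longrightarrow> (\<integral>\<^sup>+t. indicator {a..b} t * Lp_norm p (u t) \<partial>lborel) < \<infinity>)"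

definition H1_norm :: "(real \<times> real \<Rightarrow> real) \<Rightarrow> real" where
  "H1_norm f = sqrt (\<integral>x. (f x)\<^sup>2 + (pd f (1, 0) x)\<^sup>2 + (pd f (0, 1) x)\<^sup>2 \<partial>lborel)"

text \<open>w \<in> L^\<infinity>(0,T; H^{-1}(R^2)), the H^{-1} norm being the dual norm of H^1,
  tested on the dense subspace C_0^\<infinity>(R^2).\<close>
definition in_Linf_Hm1 :: "real \<Rightarrow> (real \<Rightarrow> real \<times> real \<Rightarrow> real) \<Rightarrow> bool" where
  "in_Linf_Hm1 T w \<longleftrightarrow> st_meas w \<and>
     (\<exists>C. AE t in lborel. t \<in> {0<..<T} \<longrightarrow>
        (\<forall>\<phi>. test_fun \<phi> \<longrightarrow> \<bar>\<integral>x. w t x * \<phi> x \<partial>lborel\<bar> \<le> C * H1_norm \<phi>))"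

text \<open>Finite (signed) Radon measure on R^2, given as a difference mp - mn of two finite
  Borel measures (Jordan decomposition).\<close>
definition finite_borel_meas :: "(real \<times> real) measure \<Rightarrow> bool" where
  "finite_borel_meas m \<longleftrightarrow> sets m = sets borel \<and> finite_measure m"

definition dist_solution :: "real \<Rightarrow> (real \<times> real) measure \<Rightarrow> (real \<times> real) measure
    \<Rightarrow> (real \<Rightarrow> real \<times> real \<Rightarrow> real) \<Rightarrow> bool" where
  "dist_solution \<nu> mp mn u \<longleftrightarrow>
     (\<exists>p. 1 < p \<and> p < 2 \<and> in_L1loc_Lp p u) \<and>
     (\<forall>C. compact C \<longrightarrow> C \<subseteq> {0<..} \<times> UNIV \<longrightarrow>
        set_integrable lborel C (\<lambda>z::real \<times> (real \<times> real). u (fst z) (snd z) *\<^sub>R BS (u (fst z)) (snd z))) \<and>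
     (\<forall>\<phi>::real \<times> (real \<times> real) \<Rightarrow> real. test_fun \<phi> \<longrightarrow>
        (LINT z : {0<..} \<times> UNIV | lborel.
            u (fst z) (snd z) * (dt \<phi> z + \<nu> * lap_x \<phi> z + BS (u (fst z)) (snd z) \<bullet> grad_x \<phi> z))
        + ((\<integral>x. \<phi> (0, x) \<partial>mp) - (\<integral>x. \<phi> (0, x) \<partial>mn)) = 0)"

end

theory Submission
  imports Defs "HOL-Probability.Probability"
begin

text \<open>
  Test the equation for \<open>W = u1 - u2\<close> against a cut-off heat kernel \<open>\<Gamma>\<close> centred at \<open>z0 = (t, x)\<close>, regularised
  by the factor \<open>exp (- \<delta> / r)\<close> in the elapsed time \<open>r\<close>. The heat operator turns it into an approximate
  identity plus an error no worse than \<open>\<nabla>\<Gamma>\<close>, so \<open>\<delta> \<rightarrow> 0\<close> gives the pointwise bound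
  \<open>|W| \<le> C k * (|W| + |F|)\<close> with \<open>F = u1 K(u1) - u2 K(u2)\<close>, where \<open>k\<close> has spatial mass at most
  \<open>C r\<^bsup>-1/2\<^esup>\<close> at elapsed time \<open>r\<close>.
  The norm that closes the argument is \<open>P(t) = sup\<^sub>x \<integral> |W(t,y)| / |x - y| dy\<close>: it does not grow under
  convolution with measures of mass one, it bounds \<open>K(W)\<close>, and by Hoelder it is controlled by the norms of
  \<open>L\<^sup>4\<close> and of \<open>L\<^bsup>4/3\<^esup>\<close>. Hence \<open>P(t) \<le> C \<integral> (t - s)\<^bsup>-1/2\<^esup> b(s) P(s) ds\<close> with \<open>b\<close> and \<open>P\<close> in \<open>L\<^sup>4\<close> in time,
  which forces \<open>P = 0\<close>.
\<close>

section \<open>Smooth functions\<close>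

text \<open>The weak formulation admits only smooth, compactly supported test functions, while the
  heat kernel is singular at r = 0. The factor exp(-\<delta>/r) is flat to all orders there and
  keeps the kernel zero for r \<le> 0, so times after t do not enter. Its price in the heat
  operator, \<delta> exp(-\<delta>/r)/r^2 times the heat kernel, is itself the approximate identity:
  parabolic scaling shows that its mass does not depend on \<delta>. The limit is W times that mass
  times the value e^(-1) of the cutoff at 0, so nothing has to be normalised. For every \<delta> the
  datum contributes the same term to both equations and drops out of the difference. Since W need
  not be continuous, \<delta> tends to 0 only after z0 has been integrated over a box, with the
  mollifier moved onto the indicator of the box. Exponents: F = W K(u1) + u2 K(W) has potential at
  most (P(u1) + P(u2)) P(W), an L^2 function of time, and r^(-1/2) on (0, h) has L^(4/3) norm of
  order h^(1/4). Young's inequality thus returns to L^4 with a small factor. Estimates are stated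
  for cubes and fourth powers so that \<open>ennreal\<close> needs no roots.\<close>

definition flatexp :: "nat \<Rightarrow> real \<Rightarrow> real \<Rightarrow> real" where
  "flatexp n q r = (if 0 < r then exp (- q / r) / r ^ n else 0)"

lemma power_le_fact_exp: "0 \<le> x \<Longrightarrow> x ^ m \<le> fact m * exp (x::real)"
proof -
  assume x: "0 \<le> x"
  have "(\<Sum>k\<in>{m}. x ^ k /\<^sub>R fact k) \<le> (\<Sum>k. x ^ k /\<^sub>R fact k)"
    by (rule sum_le_suminf) (use x summable_exp_generic[of x] in auto)
  then have "x ^ m / fact m \<le> exp x" by (simp add: exp_def divide_inverse mult.commute)
  then show ?thesis by (simp add: field_simps)
qed

text \<open>Taking m = n+2 in x^m \<le> m! exp x at x = q0/r absorbs the pole r^(-n) and leaves two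
  spare powers of r. The bound is uniform in q \<ge> q0, because q varies as well when the pair (q,
  r) is differentiated at r = 0.\<close>

lemma flatexp_quadratic_bound:
  assumes "0 < q0" "q0 \<le> q"
  shows "\<bar>flatexp n q r\<bar> \<le> (fact (n+2) / q0 ^ (n+2)) * r\<^sup>2"
proof (cases "0 < r")
  case True
  have "(q0 / r) ^ (n+2) \<le> fact (n+2) * exp (q0 / r)"
    by (rule power_le_fact_exp) (use assms True in auto)
  also have "\<dots> \<le> fact (n+2) * exp (q / r)"
    using assms True by (intro mult_left_mono) (auto simp: divide_right_mono)
  finally have "q0 ^ (n+2) * exp (- (q / r)) \<le> fact (n+2) * r ^ (n+2)"
    using True by (simp add: power_divide exp_minus field_simps)
  then show ?thesis using True assms
    by (simp add: flatexp_def field_simps power_add power2_eq_square)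
next
  case False then show ?thesis using assms by (simp add: flatexp_def)
qed

lemma has_derivative_zero_quadratic:
  fixes f :: "'a::real_normed_vector \<Rightarrow> real"
  assumes "eventually (\<lambda>y. \<bar>f y\<bar> \<le> C * (norm (y - x))\<^sup>2) (nhds x)"
  shows "(f has_derivative (\<lambda>_. 0)) (at x)"
proof -
  have f0: "f x = 0" using eventually_nhds_x_imp_x[OF assms] by simp
  have ev: "eventually (\<lambda>y. norm (f y / norm (y - x)) \<le> C * norm (y - x)) (at x)"
    using assms unfolding eventually_at_filter
    by eventually_elim (auto simp: abs_divide divide_simps power2_eq_square)
  have "((\<lambda>y. f y / norm (y - x)) \<longlongrightarrow> 0) (at x)"
    by (rule Lim_null_comparison[OF ev]) (auto intro!: tendsto_eq_intros)
  then have "((\<lambda>y. \<bar>f y\<bar> / norm (y - x)) \<longlongrightarrow> 0) (at x)"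
    by (auto dest: tendsto_rabs_zero simp: abs_divide)
  then show ?thesis by (simp add: has_derivative_iff_norm f0)
qed

text \<open>Derivatives of a member of the family are combinations of members with index n+1 and
  n+2, which is what makes the family usable in a differentiation-closed algebra. At r = 0 both the
  function and the claimed derivative vanish, and the quadratic bound gives
  differentiability.\<close>

lemma flatexp_has_derivative:
  assumes "0 < q"
  shows "((\<lambda>p. flatexp n (fst p) (snd p)) has_derivative
     (\<lambda>d. (q * flatexp (n+2) q r - of_nat n * flatexp (n+1) q r) * snd d - flatexp (n+1) q r * fst d)) (at (q, r))"
proof -
  consider "0 < r" | "r < 0" | "r = 0" by linarith
  then show ?thesis
  proof cases
    case 1
    have "((\<lambda>p. exp (- fst p / snd p) * inverse (snd p ^ n)) has_derivative
     (\<lambda>d. (q * flatexp (n+2) q r - of_nat n * flatexp (n+1) q r) * snd d - flatexp (n+1) q r * fst d)) (at (q, r))"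
    proof -
      \<comment> \<open>The case split covers n = 0, where n - 1 is truncated to 0.\<close>
      have n: "real n * r ^ (n - 1) * r = real n * r ^ n" by (cases n) auto
      have "((\<lambda>p. exp (- fst p / snd p) * inverse (snd p ^ n)) has_derivative
        (\<lambda>d. exp (- q / r) * - (inverse (r ^ n) * (real n * (snd d * r ^ (n - 1))) * inverse (r ^ n))
            + exp (- q / r) * ((- fst d * r - - q * snd d) / (r * r)) * inverse (r ^ n))) (at (q, r))"
        using 1 by (auto intro!: derivative_eq_intros ext simp: algebra_simps diff_divide_distrib)
      then show ?thesis
      proof (rule has_derivative_eq_rhs, intro ext)
        fix d :: "real \<times> real"
        have "real n * (snd d * r ^ (n - 1)) = snd d * (real n * r ^ n / r)"
          using 1 n by (auto simp: field_simps)
        then show "exp (- q / r) * - (inverse (r ^ n) * (real n * (snd d * r ^ (n - 1))) * inverse (r ^ n))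
            + exp (- q / r) * ((- fst d * r - - q * snd d) / (r * r)) * inverse (r ^ n)
          = (q * flatexp (n+2) q r - of_nat n * flatexp (n+1) q r) * snd d - flatexp (n+1) q r * fst d"
          using 1 by (simp only:) (simp add: flatexp_def field_simps power_add power2_eq_square)
      qed
    qed
    then show ?thesis
      by (rule has_derivative_transform_within_open[where s = "{p. 0 < snd p}"])
         (use 1 in \<open>auto intro!: open_Collect_less continuous_intros simp: flatexp_def field_simps\<close>)
  next
    case 2
    have "((\<lambda>p. 0) has_derivative
     (\<lambda>d. (q * flatexp (n+2) q r - of_nat n * flatexp (n+1) q r) * snd d - flatexp (n+1) q r * fst d)) (at (q, r))"
      using 2 by (simp add: flatexp_def)
    then show ?thesis
      by (rule has_derivative_transform_within_open[where s = "{p. 0 > snd p}"])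
         (use 2 in \<open>auto intro!: open_Collect_less continuous_intros simp: flatexp_def field_simps\<close>)
  next
    case 3
    \<comment> \<open>Near the point, q stays above half its value, so one constant serves a whole
      neighbourhood.\<close>
    have "eventually (\<lambda>p::real\<times>real. q/2 < fst p) (nhds (q,r))"
      using order_tendstoD(1)[OF tendsto_fst[OF filterlim_ident[of "nhds (q, r)"]], of "q/2"] assms by simp
    then have "eventually (\<lambda>p. \<bar>flatexp n (fst p) (snd p)\<bar> \<le> (fact (n+2) / (q/2) ^ (n+2)) * (norm (p - (q,r)))\<^sup>2) (nhds (q,r))"
    proof eventually_elim
      case (elim p)
      have "(snd p)\<^sup>2 \<le> (norm (p - (q,r)))\<^sup>2"
        using 3 norm_snd_le[of "snd p" "fst p - q"] by (cases p) (simp add: power2_le_iff_abs_le)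
      moreover have "\<bar>flatexp n (fst p) (snd p)\<bar> \<le> (fact (n+2) / (q/2) ^ (n+2)) * (snd p)\<^sup>2"
        by (rule flatexp_quadratic_bound) (use assms elim in auto)
      ultimately show ?case
        using assms by (meson mult_left_mono order_trans divide_nonneg_nonneg fact_ge_zero zero_le_power less_imp_le half_gt_zero)
    qed
    from has_derivative_zero_quadratic[OF this] show ?thesis using 3 by (simp add: flatexp_def)
  qed
qed

lemma flatexp_comp_has_derivative:
  assumes "(q has_derivative q') (at x)" "(r has_derivative r') (at x)" "0 < q x"
  shows "((\<lambda>y. flatexp n (q y) (r y)) has_derivative
     (\<lambda>d. (q x * flatexp (n+2) (q x) (r x) - of_nat n * flatexp (n+1) (q x) (r x)) * r' d - flatexp (n+1) (q x) (r x) * q' d)) (at x)"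
  using has_derivative_compose[OF has_derivative_Pair[OF assms(1,2)] flatexp_has_derivative[OF assms(3), of n "r x"]]
  by simp

text \<open>Closure under the operations that differentiation produces; differentiating an element gives
  an element again, so coinduction shows that all elements are smooth.\<close>

inductive smooth_alg :: "('a::euclidean_space \<Rightarrow> real) \<Rightarrow> bool" where
  smooth: "smooth_fun f \<Longrightarrow> smooth_alg f"
| const: "smooth_alg (\<lambda>x. c)"
| linear: "bounded_linear f \<Longrightarrow> smooth_alg f"
| add: "smooth_alg f \<Longrightarrow> smooth_alg g \<Longrightarrow> smooth_alg (\<lambda>x. f x + g x)"
| mult: "smooth_alg f \<Longrightarrow> smooth_alg g \<Longrightarrow> smooth_alg (\<lambda>x. f x * g x)"
| flatexp: "smooth_alg q \<Longrightarrow> smooth_alg r \<Longrightarrow> (\<And>x. 0 < q x) \<Longrightarrow> smooth_alg (\<lambda>x. flatexp n (q x) (r x))"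

lemma smooth_alg_derivative:
  "smooth_alg f \<Longrightarrow> (\<forall>x. f differentiable at x) \<and> (\<forall>b\<in>Basis. smooth_alg (\<lambda>x. frechet_derivative f (at x) b))"
proof (induction rule: smooth_alg.induct)
  case (smooth f)
  then show ?case by (auto elim: smooth_fun.cases intro: smooth_alg.smooth)
next
  case (const c)
  then show ?case by (auto intro: smooth_alg.const)
next
  case (linear f)
  have "frechet_derivative f (at x) = f" for x
    using bounded_linear_imp_has_derivative[OF linear] frechet_derivative_at by metis
  then show ?case
    using bounded_linear_imp_differentiable[OF linear] by (auto intro: smooth_alg.const)
next
  case (add f g)
  have "frechet_derivative (\<lambda>x. f x + g x) (at x) = (\<lambda>b. frechet_derivative f (at x) b + frechet_derivative g (at x) b)" for x
    by (rule sym, rule frechet_derivative_at, rule has_derivative_add)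
       (use add in \<open>auto simp: frechet_derivative_works[symmetric]\<close>)
  then show ?case using add by (auto intro: smooth_alg.add)
next
  case (mult f g)
  have "frechet_derivative (\<lambda>x. f x * g x) (at x) = (\<lambda>b. f x * frechet_derivative g (at x) b + frechet_derivative f (at x) b * g x)" for x
    by (rule sym, rule frechet_derivative_at, rule has_derivative_mult)
       (use mult in \<open>auto simp: frechet_derivative_works[symmetric]\<close>)
  then show ?case using mult by (auto intro!: smooth_alg.add smooth_alg.mult)
next
  case (flatexp q r n)
  \<comment> \<open>Differences are written as sums with factors -1 to match the closure rules of
    \<open>smooth_alg\<close>.\<close>
  have D: "((\<lambda>y. flatexp n (q y) (r y)) has_derivative
     (\<lambda>d. (q x * flatexp (n+2) (q x) (r x) + (- of_nat n) * flatexp (n+1) (q x) (r x)) * frechet_derivative r (at x) d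
        + (-1) * (flatexp (n+1) (q x) (r x) * frechet_derivative q (at x) d))) (at x)" for x
    by (rule has_derivative_eq_rhs[OF flatexp_comp_has_derivative[of q "frechet_derivative q (at x)" x r "frechet_derivative r (at x)"]])
       (use flatexp in \<open>auto simp: frechet_derivative_works[symmetric]\<close>)
  have *: "smooth_alg (\<lambda>x. (q x * flatexp (n+2) (q x) (r x) + (- of_nat n) * flatexp (n+1) (q x) (r x)) * frechet_derivative r (at x) b
        + (-1) * (flatexp (n+1) (q x) (r x) * frechet_derivative q (at x) b))" if "b \<in> Basis" for b
    by (intro smooth_alg.add smooth_alg.mult smooth_alg.const smooth_alg.flatexp)
       (use flatexp that in auto)
  show ?case
    using D * unfolding frechet_derivative_at[OF D, symmetric] by (auto simp: differentiable_def)
qed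

lemma smooth_alg_imp_smooth: "smooth_alg f \<Longrightarrow> smooth_fun f"
  by (coinduction arbitrary: f) (use smooth_alg_derivative in blast)

section \<open>Directional derivatives and reflection\<close>

lemma smooth_funD:
  assumes "smooth_fun f"
  shows "f differentiable at x" "b \<in> Basis \<Longrightarrow> smooth_fun (pd f b)" "continuous_on S f"
proof -
  show d: "f differentiable at x" for x using assms by (auto elim: smooth_fun.cases)
  show "b \<in> Basis \<Longrightarrow> smooth_fun (pd f b)"
    using assms unfolding pd_def[abs_def] by (auto elim: smooth_fun.cases)
  show "continuous_on S f" using d by (meson continuous_at_imp_continuous_on differentiable_imp_continuous_within)
qed

lemma pd_eq: "(f has_derivative f') (at x) \<Longrightarrow> pd f b x = f' b"
  unfolding pd_def using frechet_derivative_at by metis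

lemma pd_has_derivative: "f differentiable at x \<Longrightarrow> (f has_derivative (\<lambda>b. pd f b x)) (at x)"
  unfolding pd_def by (simp add: frechet_derivative_works)

lemma reflect_has_derivative:
  "f differentiable at (a - z) \<Longrightarrow> ((\<lambda>z. f (a - z)) has_derivative (\<lambda>b. - pd f b (a - z))) (at z)"
proof -
  assume f: "f differentiable at (a - z)"
  have "linear (\<lambda>b. pd f b (a - z))"
    using pd_has_derivative[OF f] has_derivative_linear by blast
  note minus = linear_neg[OF this]
  have "((\<lambda>z. a - z) has_derivative (\<lambda>b. - b)) (at z)" by (auto intro!: derivative_eq_intros)
  from has_derivative_compose[OF this pd_has_derivative[OF f]] show ?thesis
    by (simp add: minus)
qed

text \<open>Each derivative of a reflected function brings out a factor -1, so the coinductive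
  invariant must admit constant multiples.\<close>

lemma smooth_fun_reflect:
  assumes "smooth_fun f"
  shows "smooth_fun (\<lambda>z. f (a - z))"
proof -
  have "\<exists>c g. smooth_fun g \<and> h = (\<lambda>z. c * g (a - z)) \<Longrightarrow> smooth_fun h" for h
  proof (coinduction arbitrary: h)
    case (smooth_fun h)
    then obtain c g where g: "smooth_fun g" and h: "h = (\<lambda>z. c * g (a - z))" by auto
    have D: "(h has_derivative (\<lambda>b. c * - pd g b (a - z))) (at z)" for z
      unfolding h by (intro has_derivative_mult_right reflect_has_derivative smooth_funD[OF g])
    have "\<exists>c g'. smooth_fun g' \<and> (\<lambda>z. frechet_derivative h (at z) b) = (\<lambda>z. c * g' (a - z))"
      if b: "b \<in> Basis" for b
    proof (intro exI[of _ "-c"] exI[of _ "pd g b"] conjI ext)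
      show "smooth_fun (pd g b)" by (rule smooth_funD[OF g]) fact
      show "frechet_derivative h (at z) b = - c * pd g b (a - z)" for z
        using frechet_derivative_at[OF D, symmetric] by simp
    qed
    moreover have "h differentiable at z" for z using D[of z] by (auto simp: differentiable_def)
    ultimately show ?case by blast
  qed
  moreover have "(\<lambda>z. f (a - z)) = (\<lambda>z. 1 * f (a - z))" by simp
  ultimately show ?thesis using assms by blast
qed

lemma pd_reflect: "smooth_fun f \<Longrightarrow> pd (\<lambda>z. f (a - z)) b z = - pd f b (a - z)"
  by (rule pd_eq[OF reflect_has_derivative[OF smooth_funD(1)]])

section \<open>The regularised heat kernel\<close>

type_synonym spt = "real \<times> real \<times> real"

definition phase :: "real \<Rightarrow> real \<Rightarrow> spt \<Rightarrow> real" where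
  "phase \<nu> \<delta> z = (1 / (4 * \<nu>)) * (fst (snd z) * fst (snd z) + snd (snd z) * snd (snd z)) + \<delta>"

text \<open>Up to the factor \<open>1 / (4 \<pi> \<nu>)\<close>, \<open>heatker \<nu> 0\<close> is the heat kernel; the factor \<open>exp (- \<delta> / r)\<close>
  makes it smooth across \<open>r = 0\<close> and contributes \<open>\<delta> / r\<^sup>2\<close> times the kernel to the heat operator.\<close>

definition heatker :: "real \<Rightarrow> real \<Rightarrow> spt \<Rightarrow> real" where
  "heatker \<nu> \<delta> z = flatexp 1 (phase \<nu> \<delta> z) (fst z)"

text \<open>The standard bump exp(-1/(1 - |z|^2)) on the unit ball, written with the constructors of
  \<open>smooth_alg\<close>.\<close>

definition cut :: "spt \<Rightarrow> real" where
  "cut z = flatexp 0 1 (1 + (- 1) * (fst z * fst z + (fst (snd z) * fst (snd z) + snd (snd z) * snd (snd z))))"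

lemma phase_pos: "0 < \<nu> \<Longrightarrow> 0 < \<delta> \<Longrightarrow> 0 < phase \<nu> \<delta> z"
  by (auto simp: phase_def intro!: add_nonneg_pos)

lemma smooth_alg_proj: "smooth_alg (\<lambda>z::spt. fst z)" "smooth_alg (\<lambda>z::spt. fst (snd z))" "smooth_alg (\<lambda>z::spt. snd (snd z))"
  by (auto intro!: smooth_alg.linear bounded_linear_intros)

lemmas smooth_alg_rules = smooth_alg.add smooth_alg.mult smooth_alg.const smooth_alg.flatexp smooth_alg_proj

lemma smooth_phase: "smooth_alg (phase \<nu> \<delta>)"
  unfolding phase_def[abs_def] by (intro smooth_alg_rules)

lemma smooth_cut: "smooth_fun cut"
  unfolding cut_def[abs_def] by (intro smooth_alg_imp_smooth smooth_alg_rules) simp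

lemma smooth_heatker: "0 < \<nu> \<Longrightarrow> 0 < \<delta> \<Longrightarrow> smooth_fun (heatker \<nu> \<delta>)"
  unfolding heatker_def[abs_def] by (intro smooth_alg_imp_smooth smooth_alg_rules smooth_phase phase_pos)

definition parametrix :: "real \<Rightarrow> real \<Rightarrow> spt \<Rightarrow> real" where
  "parametrix \<nu> \<delta> z = cut z * heatker \<nu> \<delta> z"

lemma smooth_parametrix: "0 < \<nu> \<Longrightarrow> 0 < \<delta> \<Longrightarrow> smooth_fun (parametrix \<nu> \<delta>)"
  unfolding parametrix_def[abs_def]
  using smooth_alg.mult[OF smooth_alg.smooth[OF smooth_cut] smooth_alg.smooth[OF smooth_heatker]]
  by (auto intro: smooth_alg_imp_smooth)

lemma norm_spt: "(norm (z::spt))\<^sup>2 = fst z * fst z + (fst (snd z) * fst (snd z) + snd (snd z) * snd (snd z))"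
  by (cases z) (simp add: norm_Pair power2_eq_square)

lemma cut_eq_0: "1 \<le> norm z \<Longrightarrow> cut z = 0"
proof -
  assume "1 \<le> norm z"
  then have "1 \<le> (norm z)\<^sup>2" by simp
  then show ?thesis unfolding cut_def norm_spt[symmetric] by (simp add: flatexp_def)
qed

lemma cut_0: "cut 0 = exp (- 1)"
  by (simp add: cut_def flatexp_def)

lemma test_fun_parametrix:
  assumes "0 < \<nu>" "0 < \<delta>"
  shows "test_fun (\<lambda>z. parametrix \<nu> \<delta> (a - z))"
proof -
  have "{z. parametrix \<nu> \<delta> (a - z) \<noteq> 0} \<subseteq> cball a 1"
  proof (intro subsetI)
    fix z assume "z \<in> {z. parametrix \<nu> \<delta> (a - z) \<noteq> 0}"
    then have "\<not> 1 \<le> norm (a - z)" using cut_eq_0[of "a - z"] by (simp add: parametrix_def) blast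
    then show "z \<in> cball a 1" by (simp add: dist_norm)
  qed
  then have "closure {z. parametrix \<nu> \<delta> (a - z) \<noteq> 0} \<subseteq> cball a 1"
    by (simp add: closure_minimal)
  then have "compact (closure {z. parametrix \<nu> \<delta> (a - z) \<noteq> 0})"
    using bounded_subset[OF bounded_cball] compact_eq_bounded_closed closed_closure by blast
  then show ?thesis unfolding test_fun_def
    using smooth_fun_reflect[OF smooth_parametrix[OF assms]] by simp
qed

lemma spt_Basis: "(1, 0, 0) \<in> (Basis :: spt set)" "(0, 1, 0) \<in> (Basis :: spt set)" "(0, 0, 1) \<in> (Basis :: spt set)"
  by (auto simp: Basis_prod_def zero_prod_def)

lemma phase_has_derivative:
  "(phase \<nu> \<delta> has_derivative (\<lambda>d. (fst (snd z) * fst (snd d) + snd (snd z) * snd (snd d)) * (1 / (2 * \<nu>)))) (at z)"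
proof -
  have "(phase \<nu> \<delta> has_derivative (\<lambda>d. (1 / (4 * \<nu>)) * ((fst (snd z) * fst (snd d) + fst (snd d) * fst (snd z))
     + (snd (snd z) * snd (snd d) + snd (snd d) * snd (snd z))) + 0)) (at z)"
    unfolding phase_def[abs_def]
    by (intro has_derivative_add has_derivative_mult has_derivative_mult_right has_derivative_const
      has_derivative_fst has_derivative_snd has_derivative_ident)
  then show ?thesis by (rule has_derivative_eq_rhs) (simp add: algebra_simps add_divide_distrib)
qed

lemma flatexp_phase_has_derivative:
  assumes "0 < \<nu>" "0 < \<delta>"
  shows "((\<lambda>z. flatexp n (phase \<nu> \<delta> z) (fst z)) has_derivative
    (\<lambda>d. (phase \<nu> \<delta> z * flatexp (n+2) (phase \<nu> \<delta> z) (fst z) - of_nat n * flatexp (n+1) (phase \<nu> \<delta> z) (fst z)) * fst d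
      - flatexp (n+1) (phase \<nu> \<delta> z) (fst z) * ((fst (snd z) * fst (snd d) + snd (snd z) * snd (snd d)) * (1 / (2 * \<nu>))))) (at z)"
  by (rule flatexp_comp_has_derivative[OF phase_has_derivative])
     (auto intro!: derivative_eq_intros phase_pos assms)

text \<open>Write E n for \<open>flatexp n\<close> evaluated at the phase and the time. The time
  derivative of E 1 is phase E 3 - E 2, and \<nu> times its Laplacian is |x|^2/(4\<nu>) E 3 - E 2.
  As phase - |x|^2/(4\<nu>) = \<delta>, only \<delta> E 3 survives. The terms where the cutoff is
  differentiated are lower order; the cross term -2\<nu> grad cut . grad E 1 equals (grad cut . x) E
  2.\<close>

lemma parametrix_derivatives:
  assumes \<nu>: "0 < \<nu>" and \<delta>: "0 < \<delta>"
  shows "grad_x (parametrix \<nu> \<delta>) z =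
      heatker \<nu> \<delta> z *\<^sub>R grad_x cut z - (cut z * flatexp 2 (phase \<nu> \<delta> z) (fst z) / (2 * \<nu>)) *\<^sub>R snd z" (is ?g)
    and "dt (parametrix \<nu> \<delta>) z - \<nu> * lap_x (parametrix \<nu> \<delta>) z =
      \<delta> * cut z * flatexp 3 (phase \<nu> \<delta> z) (fst z) + heatker \<nu> \<delta> z * (dt cut z - \<nu> * lap_x cut z)
      + (grad_x cut z \<bullet> snd z) * flatexp 2 (phase \<nu> \<delta> z) (fst z)" (is ?h)
proof -
  note phase_pos[OF \<nu> \<delta>, simp]
  define E where "E n z = flatexp n (phase \<nu> \<delta> z) (fst z)" for n z
  define c where "c = 1 / (2 * \<nu>)"
  have c: "2 * \<nu> * c = 1" using \<nu> by (simp add: c_def)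
  note dE = flatexp_phase_has_derivative[OF \<nu> \<delta>, folded E_def c_def]
  have dE1: "(E 1 has_derivative (\<lambda>d. (phase \<nu> \<delta> z * E 3 z - E 2 z) * fst d
      - E 2 z * ((fst (snd z) * fst (snd d) + snd (snd z) * snd (snd d)) * c))) (at z)" for z
    using dE[of 1 z] by (simp add: numeral_eq_Suc)
  have dE2: "(E 2 has_derivative (\<lambda>d. (phase \<nu> \<delta> z * E 4 z - 2 * E 3 z) * fst d
      - E 3 z * ((fst (snd z) * fst (snd d) + snd (snd z) * snd (snd d)) * c))) (at z)" for z
    using dE[of 2 z] by (simp add: numeral_eq_Suc)
  have heatker: "heatker \<nu> \<delta> = E 1" by (auto simp: heatker_def E_def)
  have dc: "(cut has_derivative (\<lambda>b. pd cut b z)) (at z)" for z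
    by (intro pd_has_derivative smooth_funD smooth_cut)
  have dcc: "(pd cut b has_derivative (\<lambda>c. pd (pd cut b) c z)) (at z)" if "b \<in> Basis" for b z
    by (intro pd_has_derivative smooth_funD smooth_cut that)
  have d1: "pd (parametrix \<nu> \<delta>) b z = cut z * ((phase \<nu> \<delta> z * E 3 z - E 2 z) * fst b
      - E 2 z * ((fst (snd z) * fst (snd b) + snd (snd z) * snd (snd b)) * c)) + pd cut b z * E 1 z" for b z
    unfolding parametrix_def[abs_def] heatker
    by (rule pd_eq[OF has_derivative_mult[OF dc dE1]])
  show ?g
    unfolding grad_x_def d1 by (simp add: prod_eq_iff heatker E_def c_def)
  have d21: "pd (pd (parametrix \<nu> \<delta>) (0,1,0)) (0,1,0) z =
       pd (pd cut (0,1,0)) (0,1,0) z * E 1 z - 2 * pd cut (0,1,0) z * fst (snd z) * c * E 2 z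
       - cut z * E 2 z * c + cut z * (fst (snd z) * fst (snd z)) * (c * c) * E 3 z"
  proof -
    have 1: "pd (parametrix \<nu> \<delta>) (0,1,0) = (\<lambda>z. pd cut (0,1,0) z * E 1 z - cut z * (E 2 z * (fst (snd z) * c)))"
      by (auto simp: d1)
    have 2: "((\<lambda>z::spt. fst (snd z) * c) has_derivative (\<lambda>d. fst (snd d) * c)) (at z)"
      by (auto intro!: derivative_eq_intros)
    have 3: "(pd (parametrix \<nu> \<delta>) (0,1,0) has_derivative (\<lambda>d. pd cut (0,1,0) z * ((phase \<nu> \<delta> z * E 3 z - E 2 z) * fst d
        - E 2 z * ((fst (snd z) * fst (snd d) + snd (snd z) * snd (snd d)) * c)) + pd (pd cut (0,1,0)) d z * E 1 z
      - (cut z * (E 2 z * (fst (snd d) * c) + ((phase \<nu> \<delta> z * E 4 z - 2 * E 3 z) * fst d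
        - E 3 z * ((fst (snd z) * fst (snd d) + snd (snd z) * snd (snd d)) * c)) * (fst (snd z) * c))
        + pd cut d z * (E 2 z * (fst (snd z) * c))))) (at z)"
      unfolding 1 by (intro has_derivative_diff has_derivative_mult dcc dE1 dc dE2 2 spt_Basis)
    show ?thesis
      unfolding pd_eq[OF 3] by (simp add: algebra_simps)
  qed
  have d22: "pd (pd (parametrix \<nu> \<delta>) (0,0,1)) (0,0,1) z =
       pd (pd cut (0,0,1)) (0,0,1) z * E 1 z - 2 * pd cut (0,0,1) z * snd (snd z) * c * E 2 z
       - cut z * E 2 z * c + cut z * (snd (snd z) * snd (snd z)) * (c * c) * E 3 z"
  proof -
    have 1: "pd (parametrix \<nu> \<delta>) (0,0,1) = (\<lambda>z. pd cut (0,0,1) z * E 1 z - cut z * (E 2 z * (snd (snd z) * c)))"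
      by (auto simp: d1)
    have 2: "((\<lambda>z::spt. snd (snd z) * c) has_derivative (\<lambda>d. snd (snd d) * c)) (at z)"
      by (auto intro!: derivative_eq_intros)
    have 3: "(pd (parametrix \<nu> \<delta>) (0,0,1) has_derivative (\<lambda>d. pd cut (0,0,1) z * ((phase \<nu> \<delta> z * E 3 z - E 2 z) * fst d
        - E 2 z * ((fst (snd z) * fst (snd d) + snd (snd z) * snd (snd d)) * c)) + pd (pd cut (0,0,1)) d z * E 1 z
      - (cut z * (E 2 z * (snd (snd d) * c) + ((phase \<nu> \<delta> z * E 4 z - 2 * E 3 z) * fst d
        - E 3 z * ((fst (snd z) * fst (snd d) + snd (snd z) * snd (snd d)) * c)) * (snd (snd z) * c))
        + pd cut d z * (E 2 z * (snd (snd z) * c))))) (at z)"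
      unfolding 1 by (intro has_derivative_diff has_derivative_mult dcc dE1 dc dE2 2 spt_Basis)
    show ?thesis
      unfolding pd_eq[OF 3] by (simp add: algebra_simps)
  qed
  \<comment> \<open>Here c c \<nu> = 1/(4\<nu>), which puts the phase in the same polynomial form as
    the second derivatives.\<close>
  have q: "phase \<nu> \<delta> z = (fst (snd z) * fst (snd z) + snd (snd z) * snd (snd z)) * c * c * \<nu> + \<delta>"
    using \<nu> by (simp add: phase_def c_def)
  \<comment> \<open>Showing the defect as a multiple of 2\<nu>c - 1 makes the identity purely
    polynomial; the relation 2\<nu>c = 1 enters only afterwards.\<close>
  have "(dt (parametrix \<nu> \<delta>) z - \<nu> * lap_x (parametrix \<nu> \<delta>) z) -
    (\<delta> * cut z * E 3 z + E 1 z * (dt cut z - \<nu> * lap_x cut z) + (grad_x cut z \<bullet> snd z) * E 2 z)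
    = (2 * \<nu> * c - 1) * ((grad_x cut z \<bullet> snd z) * E 2 z + cut z * E 2 z)"
    unfolding dt_def lap_x_def d21 d22 d1 q grad_x_def inner_prod_def
    unfolding fst_conv snd_conv inner_real_def by (simp add: algebra_simps)
  then show ?h using c by (simp add: heatker E_def)
qed

text \<open>First derivatives change sign under reflection and second ones do not. The backward
  operator dt + \<nu> lap of the weak formulation therefore becomes minus the forward heat operator,
  for which the parametrix is built.\<close>

lemma spacetime_derivs_reflect:
  assumes "smooth_fun (f :: spt \<Rightarrow> real)"
  shows "dt (\<lambda>z. f (a - z)) z = - dt f (a - z)"
    "grad_x (\<lambda>z. f (a - z)) z = - grad_x f (a - z)"
    "lap_x (\<lambda>z. f (a - z)) z = lap_x f (a - z)"
proof -
  have "pd (pd (\<lambda>z. f (a - z)) b) b z = pd (pd f b) b (a - z)" if "b \<in> Basis" for b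
  proof -
    have "pd (\<lambda>z. f (a - z)) b = (\<lambda>z. - pd f b (a - z))"
      by (intro ext pd_reflect assms)
    moreover have "((\<lambda>z. - pd f b (a - z)) has_derivative (\<lambda>c. - (- pd (pd f b) c (a - z)))) (at z)"
      by (intro has_derivative_minus reflect_has_derivative smooth_funD[OF smooth_funD(2)[OF assms]] that)
    ultimately show ?thesis by (simp add: pd_eq)
  qed
  then show "lap_x (\<lambda>z. f (a - z)) z = lap_x f (a - z)"
    by (simp add: lap_x_def spt_Basis)
  show "dt (\<lambda>z. f (a - z)) z = - dt f (a - z)"
    "grad_x (\<lambda>z. f (a - z)) z = - grad_x f (a - z)"
    by (simp_all add: dt_def grad_x_def pd_reflect[OF assms])
qed

section \<open>Integral inequalities and kernel bounds\<close>

text \<open>Hoelder with exponents 4/3 and 4, from two applications of Cauchy-Schwarz. Writing the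
  first factor as l^3 makes its 4/3 power the integer power l^4.\<close>

lemma nn_integral_holder4:
  assumes [measurable]: "l \<in> borel_measurable M" "g \<in> borel_measurable M"
  shows "(\<integral>\<^sup>+x. l x ^ 3 * g x \<partial>M) ^ 4 \<le> (\<integral>\<^sup>+x. l x ^ 4 \<partial>M) ^ 3 * (\<integral>\<^sup>+x. g x ^ 4 \<partial>M)"
proof -
  define L G H where "L = (\<integral>\<^sup>+x. l x ^ 4 \<partial>M)" "G = (\<integral>\<^sup>+x. g x ^ 4 \<partial>M)" "H = (\<integral>\<^sup>+x. l x ^ 2 * g x ^ 2 \<partial>M)"
  have 1: "(\<integral>\<^sup>+x. l x ^ 3 * g x \<partial>M)\<^sup>2 \<le> L * H"
    using Cauchy_Schwarz_nn_integral[of "\<lambda>x. l x ^ 2" M "\<lambda>x. l x * g x"]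
    by (simp add: L_G_H_def power_mult_distrib mult.assoc[symmetric] flip: power_mult power_Suc2)
  have 2: "H\<^sup>2 \<le> L * G"
    using Cauchy_Schwarz_nn_integral[of "\<lambda>x. l x ^ 2" M "\<lambda>x. g x ^ 2"]
    by (simp add: L_G_H_def power_mult_distrib flip: power_mult)
  have "(\<integral>\<^sup>+x. l x ^ 3 * g x \<partial>M) ^ 4 = ((\<integral>\<^sup>+x. l x ^ 3 * g x \<partial>M)\<^sup>2)\<^sup>2" by (simp flip: power_mult)
  also have "\<dots> \<le> (L * H)\<^sup>2" by (intro power_mono 1) simp
  also have "\<dots> = L\<^sup>2 * H\<^sup>2" by (simp add: power_mult_distrib)
  also have "\<dots> \<le> L\<^sup>2 * (L * G)" by (intro mult_left_mono 2) simp
  also have "\<dots> = L ^ 3 * G" by (simp add: power2_eq_square power3_eq_cube mult.assoc)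
  finally show ?thesis by (simp add: L_G_H_def)
qed

section \<open>Changes of variables and product integrals\<close>

lemma nn_integral_lborel_reflect:
  fixes f :: "'a::euclidean_space \<Rightarrow> ennreal"
  assumes [measurable]: "f \<in> borel_measurable borel"
  shows "(\<integral>\<^sup>+x. f (a - x) \<partial>lborel) = (\<integral>\<^sup>+x. f x \<partial>lborel)"
  by (subst (2) lborel_affine[of "- 1" a]) (auto simp: nn_integral_density nn_integral_distr)

lemma nn_integral_lborel_translate:
  fixes f :: "'a::euclidean_space \<Rightarrow> ennreal"
  assumes [measurable]: "f \<in> borel_measurable borel"
  shows "(\<integral>\<^sup>+x. f (x - a) \<partial>lborel) = (\<integral>\<^sup>+x. f x \<partial>lborel)"
  by (subst (2) lborel_affine[of 1 "- a"]) (auto simp: nn_integral_density nn_integral_distr)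

lemma nn_integral_lborel_scale:
  fixes f :: "'a::euclidean_space \<Rightarrow> ennreal"
  assumes [measurable]: "f \<in> borel_measurable borel" and c: "0 < c"
  shows "(\<integral>\<^sup>+x. f x \<partial>lborel) = ennreal (c ^ DIM('a)) * (\<integral>\<^sup>+x. f (c *\<^sub>R x) \<partial>lborel)"
  by (subst lborel_affine[of c 0]) (use c in \<open>auto simp: nn_integral_density nn_integral_distr nn_integral_cmult\<close>)

lemma nn_integral_lborel_pair:
  assumes [measurable]: "f \<in> borel_measurable borel"
  shows "(\<integral>\<^sup>+z. f z \<partial>lborel) = (\<integral>\<^sup>+x. \<integral>\<^sup>+y. f (x :: 'a :: euclidean_space, y :: 'b :: euclidean_space) \<partial>lborel \<partial>lborel)"
proof -
  have "f \<in> borel_measurable (lborel \<Otimes>\<^sub>M lborel)" unfolding lborel_prod by simp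
  from lborel.nn_integral_fst[OF this] show ?thesis by (simp add: lborel_prod)
qed

lemma measurable_fst_borel [measurable (raw)]:
  fixes f :: "'c \<Rightarrow> 'a::second_countable_topology \<times> 'b::second_countable_topology"
  assumes "f \<in> borel_measurable M"
  shows "(\<lambda>x. fst (f x)) \<in> borel_measurable M"
  by (rule measurable_compose[OF assms borel_measurable_continuous_onI]) (intro continuous_intros)

lemma measurable_snd_borel [measurable (raw)]:
  fixes f :: "'c \<Rightarrow> 'a::second_countable_topology \<times> 'b::second_countable_topology"
  assumes "f \<in> borel_measurable M"
  shows "(\<lambda>x. snd (f x)) \<in> borel_measurable M"
  by (rule measurable_compose[OF assms borel_measurable_continuous_onI]) (intro continuous_intros)

lemma nn_integral_product_form:
  fixes f g :: "real \<Rightarrow> ennreal"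
  assumes [measurable]: "f \<in> borel_measurable borel" "g \<in> borel_measurable borel"
  shows "(\<integral>\<^sup>+y. f (fst y) * g (snd y) \<partial>lborel) = (\<integral>\<^sup>+x. f x \<partial>lborel) * (\<integral>\<^sup>+x. g x \<partial>lborel)"
proof -
  have "(\<lambda>y. f (fst y) * g (snd y)) \<in> borel_measurable (borel \<Otimes>\<^sub>M borel)" by measurable
  then have "(\<lambda>y. f (fst y) * g (snd y)) \<in> borel_measurable borel" by (simp add: borel_prod)
  from nn_integral_lborel_pair[OF this] show ?thesis
    by (simp add: nn_integral_cmult nn_integral_multc)
qed

section \<open>Model integrals on the line and in the plane\<close>

lemma nn_integral_cauchy_density_finite: "(\<integral>\<^sup>+x. ennreal (1 / (1 + x\<^sup>2)) \<partial>lborel) < \<infinity>"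
proof -
  let ?f = "\<lambda>x::real. ennreal (1 / (1 + x\<^sup>2)) * indicator {0..} x"
  have I: "(\<integral>\<^sup>+x. ?f x \<partial>lborel) = ennreal (pi / 2 - arctan 0)"
  proof (rule nn_integral_FTC_atLeast)
    show "DERIV arctan x :> 1 / (1 + x\<^sup>2)" for x :: real
      using DERIV_arctan[of x] by (simp add: divide_inverse)
    show "(arctan \<longlongrightarrow> pi / 2) at_top" by (rule tendsto_arctan_at_top)
  qed (auto simp: add_nonneg_nonneg)
  have "(\<integral>\<^sup>+x. ennreal (1 / (1 + x\<^sup>2)) \<partial>lborel) \<le> (\<integral>\<^sup>+x. ?f x + ?f (0 - x) \<partial>lborel)"
    by (intro nn_integral_mono) (auto split: split_indicator)
  also have "\<dots> = (\<integral>\<^sup>+x. ?f x \<partial>lborel) + (\<integral>\<^sup>+x. ?f (0 - x) \<partial>lborel)"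
    by (rule nn_integral_add) auto
  also have "(\<integral>\<^sup>+x. ?f (0 - x) \<partial>lborel) = (\<integral>\<^sup>+x. ?f x \<partial>lborel)"
    by (rule nn_integral_lborel_reflect) simp
  finally show ?thesis unfolding I by (auto simp: less_top[symmetric] top_unique)
qed

lemma powr_power_pos: "0 < n \<Longrightarrow> (x powr a) ^ n = (x::real) powr (a * real n)"
  by (cases "x = 0") (auto simp: powr_power mult.commute)

lemma nn_integral_powr_near_0:
  assumes "0 \<le> h"
  shows "(\<integral>\<^sup>+r. ennreal (r powr (- (2/3))) * indicator {0..h} r \<partial>lborel) = ennreal (3 * h powr (1/3))"
  using nn_integral_has_integral_lebesgue'[OF _ has_integral_powr_from_0[of "- (2/3)" h]] assms by (simp add: mult.commute)

text \<open>A product density replaces polar coordinates: its integral factors into two arctan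
  integrals, and up to constants it dominates both Gaussians and |y|^(-4) away from the
  origin.\<close>

definition cauchy2 :: "real \<times> real \<Rightarrow> real" where
  "cauchy2 y = 1 / (1 + (fst y)\<^sup>2) * (1 / (1 + (snd y)\<^sup>2))"

lemma cauchy2_nonneg [simp]: "0 \<le> cauchy2 y"
  by (auto simp: cauchy2_def intro!: divide_nonneg_nonneg add_nonneg_nonneg)

lemma measurable_cauchy2 [measurable]: "cauchy2 \<in> borel_measurable borel"
  unfolding cauchy2_def[abs_def] borel_prod[symmetric] by measurable

lemma nn_integral_cauchy2_finite: "(\<integral>\<^sup>+y. ennreal (cauchy2 y) \<partial>lborel) < \<infinity>"
proof -
  have "(\<integral>\<^sup>+y. ennreal (cauchy2 y) \<partial>lborel) =
     (\<integral>\<^sup>+x. ennreal (1 / (1 + x\<^sup>2)) \<partial>lborel) * (\<integral>\<^sup>+x. ennreal (1 / (1 + x\<^sup>2)) \<partial>lborel)"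
    unfolding cauchy2_def
    by (subst nn_integral_product_form[symmetric]) (auto simp: ennreal_mult[symmetric] add_nonneg_nonneg)
  then show ?thesis using nn_integral_cauchy_density_finite by (simp add: ennreal_mult_less_top)
qed

lemma norm_R2: "(norm (y::real\<times>real))\<^sup>2 = (fst y)\<^sup>2 + (snd y)\<^sup>2"
  by (cases y) (simp add: norm_Pair)

text \<open>With R = |y|^2, the reciprocal of \<open>cauchy2 y\<close> is 1 + R + a b, where a and b
  are the squared coordinates. It is at most (1 + R)^2, and for R \<ge> 1 each of its three terms is
  at most R^2, whence the factor 3.\<close>

lemma cauchy2_bounds: "1 \<le> cauchy2 y * (1 + (norm y)\<^sup>2)\<^sup>2" "1 \<le> norm y \<Longrightarrow> 1 / norm y ^ 4 \<le> 3 * cauchy2 y"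
proof -
  let ?a = "(fst y)\<^sup>2" and ?b = "(snd y)\<^sup>2"
  have pos: "0 < (1 + ?a) * (1 + ?b)" by (auto intro!: mult_pos_pos add_pos_nonneg)
  have c: "cauchy2 y = 1 / ((1 + ?a) * (1 + ?b))" by (simp add: cauchy2_def)
  have "(1 + ?a) * (1 + ?b) \<le> (1 + (?a + ?b)) * (1 + (?a + ?b))" by (intro mult_mono) auto
  then show "1 \<le> cauchy2 y * (1 + (norm y)\<^sup>2)\<^sup>2"
    using pos by (simp add: c norm_R2 power2_eq_square[of "1 + _"])
  assume 1: "1 \<le> norm y"
  then have R: "1 \<le> ?a + ?b" unfolding norm_R2[symmetric] by simp
  have "?a * ?b \<le> (?a + ?b) * (?a + ?b)" by (intro mult_mono) auto
  moreover have "?a + ?b \<le> (?a + ?b) * (?a + ?b)" "1 \<le> (?a + ?b) * (?a + ?b)"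
    using R mult_mono[OF R R] mult_right_mono[OF R, of "?a + ?b"] by auto
  moreover have "(1 + ?a) * (1 + ?b) = 1 + (?a + ?b) + ?a * ?b" by (simp add: algebra_simps)
  ultimately have "(1 + ?a) * (1 + ?b) \<le> 3 * ((?a + ?b) * (?a + ?b))" by linarith
  also have "(?a + ?b) * (?a + ?b) = norm y ^ 4"
    unfolding norm_R2[symmetric] by (simp flip: power_add)
  finally show "1 / norm y ^ 4 \<le> 3 * cauchy2 y"
    using pos 1 unfolding c by (simp add: divide_simps mult.commute split: if_splits)
qed

text \<open>Since |y|^2 \<ge> |y1| |y2|, the singularity is dominated by the product of |y1|^(-2/3)
  and |y2|^(-2/3), each integrable near 0 on the line. The exponent 4/3 is the one conjugate to
  4.\<close>

lemma nn_integral_norm_powr_near_finite: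
  "(\<integral>\<^sup>+(y::real\<times>real). ennreal (norm y powr (- (4/3))) * indicator (ball 0 1) y \<partial>lborel) < \<infinity>"
proof -
  let ?f = "\<lambda>x::real. ennreal (x powr (- (2/3))) * indicator {0..1} x"
  let ?g = "\<lambda>x::real. ?f x + ?f (0 - x)"
  have f: "(\<integral>\<^sup>+x. ?f x \<partial>lborel) = 3" using nn_integral_powr_near_0[of 1] by simp
  have "(\<integral>\<^sup>+x. ?f (0 - x) \<partial>lborel) = 3"
    unfolding f[symmetric] by (rule nn_integral_lborel_reflect) simp
  then have g: "(\<integral>\<^sup>+x. ?g x \<partial>lborel) = 3 + 3"
    using f by (subst nn_integral_add) auto
  \<comment> \<open>The axes are excluded because \<open>0 powr a\<close> is 0, so the product bound
    would fail on them; they form a null set.\<close>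
  have "ennreal (norm y powr (- (4/3))) * indicator (ball 0 1) y \<le> ?g (fst y) * ?g (snd y)"
    if "fst y \<noteq> 0" "snd y \<noteq> 0" for y :: "real \<times> real"
  proof (cases "norm y < 1")
    case True
    have le: "\<bar>fst y\<bar> < 1" "\<bar>snd y\<bar> < 1" using True norm_fst_le[of "fst y" "snd y"] norm_snd_le[of "snd y" "fst y"] by auto
    have *: "\<bar>x\<bar> < 1 \<Longrightarrow> x \<noteq> 0 \<Longrightarrow> ennreal (\<bar>x\<bar> powr (- (2/3))) \<le> ?g x" for x :: real
      by (cases "0 \<le> x") (auto split: split_indicator)
    have "norm y powr (- (4/3)) = (norm y powr 2) powr (- (2/3))" by (simp only: powr_powr) simp
    also have "norm y powr 2 = (norm y)\<^sup>2" using that by (subst powr_numeral) auto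
    also have "((norm y)\<^sup>2) powr (- (2/3)) \<le> (\<bar>fst y\<bar> * \<bar>snd y\<bar>) powr (- (2/3))"
    proof (rule powr_mono2')
      have "2 * (\<bar>fst y\<bar> * \<bar>snd y\<bar>) \<le> (norm y)\<^sup>2"
        using sum_squares_bound[of "\<bar>fst y\<bar>" "\<bar>snd y\<bar>"] by (simp add: norm_R2)
      moreover have "0 \<le> \<bar>fst y\<bar> * \<bar>snd y\<bar>" by simp
      ultimately show "\<bar>fst y\<bar> * \<bar>snd y\<bar> \<le> (norm y)\<^sup>2" by linarith
    qed (use that in auto)
    also have "\<dots> = \<bar>fst y\<bar> powr (- (2/3)) * \<bar>snd y\<bar> powr (- (2/3))" by (simp add: powr_mult)
    finally have "ennreal (norm y powr (- (4/3))) \<le> ennreal (\<bar>fst y\<bar> powr (- (2/3))) * ennreal (\<bar>snd y\<bar> powr (- (2/3)))"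
      by (simp add: ennreal_mult[symmetric] ennreal_leI)
    also have "\<dots> \<le> ?g (fst y) * ?g (snd y)" by (intro mult_mono * le that) auto
    finally show ?thesis using True by (simp add: indicator_def)
  qed (simp add: indicator_def)
  moreover have "AE y in lborel :: (real \<times> real) measure. fst y \<noteq> 0 \<and> snd y \<noteq> 0"
  proof -
    have "AE y in (lborel \<Otimes>\<^sub>M lborel) :: (real \<times> real) measure. fst y \<noteq> 0 \<and> snd y \<noteq> 0"
    proof (rule lborel_pair.AE_pair_measure)
      show "{y \<in> space (lborel \<Otimes>\<^sub>M lborel). fst y \<noteq> 0 \<and> snd y \<noteq> 0} \<in> sets (lborel \<Otimes>\<^sub>M lborel :: (real \<times> real) measure)"
        by measurable
      show "AE x in lborel. AE y in lborel. fst (x, y) \<noteq> (0::real) \<and> snd (x, y) \<noteq> (0::real)"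
        using AE_lborel_singleton[of "0::real"] by eventually_elim (simp add: AE_lborel_singleton)
    qed
    then show ?thesis unfolding lborel_prod .
  qed
  ultimately have "(\<integral>\<^sup>+(y::real\<times>real). ennreal (norm y powr (- (4/3))) * indicator (ball 0 1) y \<partial>lborel)
     \<le> (\<integral>\<^sup>+y. ?g (fst y) * ?g (snd y) \<partial>lborel)"
    by (intro nn_integral_mono_AE) auto
  also have "\<dots> = (3 + 3) * (3 + 3)" unfolding g[symmetric] by (rule nn_integral_product_form) measurable
  also have "\<dots> < \<infinity>" by (simp add: ennreal_mult_less_top)
  finally show ?thesis .
qed

text \<open>With R = |y|^2, one power of 1 + R pays for 1 + |y| \<le> 2(1 + R) and two pay for
  \<open>cauchy2\<close>. The cube is absorbed by the exponential of (1 + R)/(4\<nu>): 12 is 2 times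
  3!, and exp(1/(4\<nu>)) compensates the extra 1 in 1 + R.\<close>

lemma gaussian_le_cauchy2:
  assumes "0 < \<nu>"
  shows "(1 + norm y) * exp (- (norm y)\<^sup>2 / (4 * \<nu>)) \<le> 12 * (4 * \<nu>) ^ 3 * exp (1 / (4 * \<nu>)) * cauchy2 y"
proof -
  define R where "R = (norm y)\<^sup>2"
  have R: "0 \<le> R" by (simp add: R_def)
  have "0 \<le> (1 - norm y)\<^sup>2" by simp
  then have "1 + norm y \<le> 2 * (1 + R)" unfolding R_def by (simp add: power2_diff) (smt (verit) norm_ge_zero zero_le_power2)
  then have "1 + norm y \<le> 2 * (1 + R) * (cauchy2 y * (1 + R)\<^sup>2)"
    using cauchy2_bounds(1)[of y] R mult_left_mono[of 1 "cauchy2 y * (1 + R)\<^sup>2" "2 * (1 + R)"]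
    by (simp add: R_def)
  also have "\<dots> = 2 * (1 + R) ^ 3 * cauchy2 y" by (simp add: power2_eq_square power3_eq_cube)
  finally have 1: "1 + norm y \<le> 2 * (1 + R) ^ 3 * cauchy2 y" .
  have "((1 + R) / (4 * \<nu>)) ^ 3 \<le> fact 3 * exp ((1 + R) / (4 * \<nu>))"
    by (rule power_le_fact_exp) (use assms R in auto)
  then have "(1 + R) ^ 3 \<le> 6 * (4 * \<nu>) ^ 3 * (exp (1 / (4 * \<nu>)) * exp (R / (4 * \<nu>)))"
  proof -
    assume "((1 + R) / (4 * \<nu>)) ^ 3 \<le> fact 3 * exp ((1 + R) / (4 * \<nu>))"
    then have "(1 + R) ^ 3 / (4 * \<nu>) ^ 3 \<le> 6 * (exp (1 / (4 * \<nu>)) * exp (R / (4 * \<nu>)))"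
      unfolding power_divide exp_add[symmetric] add_divide_distrib[symmetric] by (simp add: fact_numeral)
    then have "(1 + R) ^ 3 \<le> 6 * (exp (1 / (4 * \<nu>)) * exp (R / (4 * \<nu>))) * (4 * \<nu>) ^ 3"
      using assms by (subst (asm) pos_divide_le_eq) auto
    then show ?thesis by (simp only: mult_ac)
  qed
  then have "2 * (1 + R) ^ 3 * cauchy2 y \<le> 2 * (6 * (4 * \<nu>) ^ 3 * (exp (1 / (4 * \<nu>)) * exp (R / (4 * \<nu>)))) * cauchy2 y"
    by (intro mult_right_mono mult_left_mono) auto
  with 1 have "1 + norm y \<le> (12 * (4 * \<nu>) ^ 3 * exp (1 / (4 * \<nu>)) * cauchy2 y) * exp (R / (4 * \<nu>))"
    by (simp add: mult_ac)
  then have "(1 + norm y) * exp (- (R / (4 * \<nu>))) \<le> (12 * (4 * \<nu>) ^ 3 * exp (1 / (4 * \<nu>)) * cauchy2 y) * exp (R / (4 * \<nu>)) * exp (- (R / (4 * \<nu>)))"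
    by (rule mult_right_mono) simp
  also have "\<dots> = 12 * (4 * \<nu>) ^ 3 * exp (1 / (4 * \<nu>)) * cauchy2 y"
    by (simp add: mult.assoc exp_add[symmetric])
  finally show ?thesis by (simp add: R_def)
qed

text \<open>The weight 1 + |y| covers the Gaussian and its gradient at once, after lengths have been
  rescaled by the square root of the time.\<close>

definition gauss_mass :: "real \<Rightarrow> ennreal" where
  "gauss_mass \<nu> = (\<integral>\<^sup>+(y::real\<times>real). ennreal ((1 + norm y) * exp (- (norm y)\<^sup>2 / (4 * \<nu>))) \<partial>lborel)"

lemma gauss_mass_finite: "0 < \<nu> \<Longrightarrow> gauss_mass \<nu> < \<infinity>"
proof -
  assume \<nu>: "0 < \<nu>"
  let ?C = "12 * (4 * \<nu>) ^ 3 * exp (1 / (4 * \<nu>))"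
  have "gauss_mass \<nu> \<le> (\<integral>\<^sup>+y. ennreal ?C * ennreal (cauchy2 y) \<partial>lborel)"
    unfolding gauss_mass_def using gaussian_le_cauchy2[OF \<nu>] \<nu>
    by (intro nn_integral_mono) (auto simp: ennreal_mult[symmetric] intro!: ennreal_leI)
  also have "\<dots> = ennreal ?C * (\<integral>\<^sup>+y. ennreal (cauchy2 y) \<partial>lborel)" by (rule nn_integral_cmult) simp
  also have "\<dots> < \<infinity>" using nn_integral_cauchy2_finite by (simp add: ennreal_mult_less_top)
  finally show ?thesis .
qed

text \<open>Dominates the heat kernel and its gradient, up to constants, on the support of the cutoff.\<close>

definition hkbound :: "real \<Rightarrow> real \<Rightarrow> real \<times> real \<Rightarrow> real" where
  "hkbound \<nu> r y = (if 0 < r \<and> r \<le> 1 \<and> norm y \<le> 1 then (1 / r + norm y / r\<^sup>2) * exp (- (norm y)\<^sup>2 / (4 * \<nu> * r)) else 0)"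

lemma hkbound_nonneg [simp]: "0 \<le> hkbound \<nu> r y"
  by (auto simp: hkbound_def)

lemma measurable_hkbound [measurable]: "(\<lambda>z. hkbound \<nu> (fst z) (snd z)) \<in> borel_measurable borel"
  unfolding hkbound_def by measurable

text \<open>Substitute y = s y' with s = sqrt r. The Jacobian s^2 turns the kernel into (1 + |y'|/s)
  times a fixed Gaussian, and s \<le> 1 allows 1/s to be taken out. The factor r^(-1/2) is written
  as the cube of r^(-1/6), the form required by the fourth-power inequalities; the fourth power
  r^(-2/3) is still integrable at 0.\<close>

lemma nn_integral_hkbound_le:
  assumes \<nu>: "0 < \<nu>"
  shows "(\<integral>\<^sup>+y. ennreal (hkbound \<nu> r y) \<partial>lborel) \<le> gauss_mass \<nu> * (ennreal (r powr (- (1/6))) * indicator {0..1} r) ^ 3"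
proof (cases "0 < r \<and> r \<le> 1")
  case True
  define s where "s = sqrt r"
  have s: "0 < s" "s \<le> 1" "r = s\<^sup>2" using True by (auto simp: s_def)
  have [measurable]: "hkbound \<nu> r \<in> borel_measurable borel" using True by (simp add: hkbound_def[abs_def])
  have p: "(ennreal (r powr (- (1/6))) * indicator {0..1} r) ^ 3 = ennreal (1 / s)"
  proof -
    have "(r powr (- (1/6))) ^ 3 = r powr (- (1/6) * real 3)" by (subst powr_power_pos) auto
    also have "- (1/6) * real 3 = - (1/2)" by simp
    also have "r powr (- (1/2)) = 1 / s"
      unfolding powr_minus using powr_half_sqrt[of r] True by (simp add: s_def inverse_eq_divide)
    finally show ?thesis using True by (simp add: ennreal_power)
  qed
  have "(\<integral>\<^sup>+y. ennreal (hkbound \<nu> r y) \<partial>lborel) = ennreal (s\<^sup>2) * (\<integral>\<^sup>+y. ennreal (hkbound \<nu> r (s *\<^sub>R y)) \<partial>lborel)"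
    using nn_integral_lborel_scale[of "\<lambda>y. ennreal (hkbound \<nu> r y)" s] s(1) by (simp add: power2_eq_square)
  also have "\<dots> = (\<integral>\<^sup>+y. ennreal (s\<^sup>2) * ennreal (hkbound \<nu> r (s *\<^sub>R y)) \<partial>lborel)"
    by (rule nn_integral_cmult[symmetric]) simp
  also have "\<dots> \<le> (\<integral>\<^sup>+(y::real\<times>real). ennreal ((1 + norm y) * exp (- (norm y)\<^sup>2 / (4 * \<nu>))) * ennreal (1 / s) \<partial>lborel)"
  proof (intro nn_integral_mono)
    fix y :: "real \<times> real"
    have e: "exp (- (s * norm y)\<^sup>2 / (4 * \<nu> * s\<^sup>2)) = exp (- (norm y)\<^sup>2 / (4 * \<nu>))"
      using s \<nu> by (simp add: power_mult_distrib)
    have "hkbound \<nu> r (s *\<^sub>R y) \<le> (1 / s\<^sup>2 + s * norm y / (s\<^sup>2)\<^sup>2) * exp (- (norm y)\<^sup>2 / (4 * \<nu>))"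
    proof -
      have "hkbound \<nu> r x \<le> (1 / r + norm x / r\<^sup>2) * exp (- (norm x)\<^sup>2 / (4 * \<nu> * r))" for x
        using True by (auto simp: hkbound_def)
      from this[of "s *\<^sub>R y"] show ?thesis using s(1) by (simp only: norm_scaleR abs_of_pos e s(3))
    qed
    then have "s\<^sup>2 * hkbound \<nu> r (s *\<^sub>R y) \<le> s\<^sup>2 * ((1 / s\<^sup>2 + s * norm y / (s\<^sup>2)\<^sup>2) * exp (- (norm y)\<^sup>2 / (4 * \<nu>)))"
      by (rule mult_left_mono) simp
    also have "s\<^sup>2 * ((1 / s\<^sup>2 + s * norm y / (s\<^sup>2)\<^sup>2) * exp (- (norm y)\<^sup>2 / (4 * \<nu>))) = (1 + norm y / s) * exp (- (norm y)\<^sup>2 / (4 * \<nu>))"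
    proof -
      have "s\<^sup>2 * (1 / s\<^sup>2 + s * norm y / (s\<^sup>2)\<^sup>2) = 1 + norm y / s"
        using s(1) by (simp add: divide_simps power2_eq_square)
      then show ?thesis by (simp add: mult.assoc[symmetric])
    qed
    also have "\<dots> \<le> ((1 + norm y) * (1 / s)) * exp (- (norm y)\<^sup>2 / (4 * \<nu>))"
      using s by (intro mult_right_mono) (auto simp: field_simps)
    finally have "s\<^sup>2 * hkbound \<nu> r (s *\<^sub>R y) \<le> (1 + norm y) * exp (- (norm y)\<^sup>2 / (4 * \<nu>)) * (1 / s)"
      by (simp add: mult_ac)
    then show "ennreal (s\<^sup>2) * ennreal (hkbound \<nu> r (s *\<^sub>R y)) \<le> ennreal ((1 + norm y) * exp (- (norm y)\<^sup>2 / (4 * \<nu>))) * ennreal (1 / s)"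
      using s by (simp add: ennreal_mult[symmetric] ennreal_leI)
  qed
  also have "\<dots> = gauss_mass \<nu> * ennreal (1 / s)" unfolding gauss_mass_def by (rule nn_integral_multc) simp
  finally show ?thesis by (simp add: p)
qed (auto simp: hkbound_def)

lemma nn_integral_hkbound_finite:
  assumes "0 < \<nu>"
  shows "(\<integral>\<^sup>+z. ennreal (hkbound \<nu> (fst z) (snd z)) \<partial>lborel) < \<infinity>"
proof -
  have "(\<integral>\<^sup>+z. ennreal (hkbound \<nu> (fst z) (snd z)) \<partial>lborel) = (\<integral>\<^sup>+r. \<integral>\<^sup>+y. ennreal (hkbound \<nu> r y) \<partial>lborel \<partial>lborel)"
    by (subst nn_integral_lborel_pair) auto
  also have "\<dots> \<le> (\<integral>\<^sup>+r. gauss_mass \<nu> * (ennreal (r powr (- (1/2))) * indicator {0..1} r) \<partial>lborel)"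
  proof (intro nn_integral_mono)
    fix r :: real
    have "(ennreal (r powr (- (1/6))) * indicator {0..1} r) ^ 3 = ennreal (r powr (- (1/2))) * indicator {0..1} r"
      by (auto simp: ennreal_power powr_power_pos split: split_indicator)
    then show "(\<integral>\<^sup>+y. ennreal (hkbound \<nu> r y) \<partial>lborel) \<le> gauss_mass \<nu> * (ennreal (r powr (- (1/2))) * indicator {0..1} r)"
      using nn_integral_hkbound_le[OF assms, of r] by simp
  qed
  also have "\<dots> = gauss_mass \<nu> * (\<integral>\<^sup>+r. ennreal (r powr (- (1/2))) * indicator {0..1} r \<partial>lborel)"
    by (rule nn_integral_cmult) simp
  also have "(\<integral>\<^sup>+r. ennreal (r powr (- (1/2))) * indicator {0..1} r \<partial>lborel) = ennreal 2"
    using nn_integral_has_integral_lebesgue'[OF _ has_integral_powr_from_0[of "- (1/2)" 1]] by simp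
  also have "gauss_mass \<nu> * ennreal 2 < \<infinity>" using gauss_mass_finite[OF assms] by (simp add: ennreal_mult_less_top)
  finally show ?thesis .
qed

section \<open>Mass of the regularising source and parabolic scaling\<close>

definition mass :: "real \<Rightarrow> ennreal" where
  "mass \<nu> = (\<integral>\<^sup>+z. ennreal (flatexp 3 (phase \<nu> 1 z) (fst z)) \<partial>lborel)"

lemma flatexp_nonneg [simp]: "0 \<le> flatexp n q r"
  by (simp add: flatexp_def)

lemma measurable_phase [measurable]: "phase \<nu> \<delta> \<in> borel_measurable borel"
  unfolding phase_def[abs_def] by measurable

lemma measurable_flatexp [measurable (raw)]:
  assumes [measurable]: "q \<in> borel_measurable M" "r \<in> borel_measurable M"
  shows "(\<lambda>x. flatexp n (q x) (r x)) \<in> borel_measurable M"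
  unfolding flatexp_def by measurable

lemma phase_norm: "phase \<nu> \<delta> z = (norm (snd z))\<^sup>2 / (4 * \<nu>) + \<delta>"
  unfolding phase_def norm_R2 by (simp add: power2_eq_square)

text \<open>Integrating in space by the scaling y = sqrt r y' leaves exp(-1/r)/r^2 in time. The
  bounds exp(-1/r) \<le> 2 r^2 and exp(-1/r) \<le> 1 control it for small and large r, and together
  they give 3/(1 + r^2).\<close>

lemma mass_finite:
  assumes \<nu>: "0 < \<nu>"
  shows "mass \<nu> < \<infinity>"
proof -
  have "mass \<nu> = (\<integral>\<^sup>+r. \<integral>\<^sup>+y. ennreal (flatexp 3 (phase \<nu> 1 (r, y)) r) \<partial>lborel \<partial>lborel)"
    unfolding mass_def by (subst nn_integral_lborel_pair) auto
  also have "\<dots> \<le> (\<integral>\<^sup>+r. gauss_mass \<nu> * (3 * ennreal (1 / (1 + r\<^sup>2))) \<partial>lborel)"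
  proof (intro nn_integral_mono)
    fix r :: real
    show "(\<integral>\<^sup>+y. ennreal (flatexp 3 (phase \<nu> 1 (r, y)) r) \<partial>lborel) \<le> gauss_mass \<nu> * (3 * ennreal (1 / (1 + r\<^sup>2)))"
    proof (cases "0 < r")
      case True
      define s where "s = sqrt r"
      have s: "0 < s" "r = s\<^sup>2" using True by (auto simp: s_def)
      have [measurable]: "(\<lambda>y. flatexp 3 (phase \<nu> 1 (r, y)) r) \<in> borel_measurable borel"
        by (intro measurable_flatexp measurable_compose[OF _ measurable_phase]) measurable
      have "(\<integral>\<^sup>+y. ennreal (flatexp 3 (phase \<nu> 1 (r, y)) r) \<partial>lborel) = ennreal (s\<^sup>2) * (\<integral>\<^sup>+y. ennreal (flatexp 3 (phase \<nu> 1 (r, s *\<^sub>R y)) r) \<partial>lborel)"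
        using nn_integral_lborel_scale[of "\<lambda>y. ennreal (flatexp 3 (phase \<nu> 1 (r, y)) r)" s] s(1) by (simp add: power2_eq_square)
      also have "\<dots> = (\<integral>\<^sup>+y. ennreal (s\<^sup>2) * ennreal (flatexp 3 (phase \<nu> 1 (r, s *\<^sub>R y)) r) \<partial>lborel)"
        by (rule nn_integral_cmult[symmetric]) simp
      also have "\<dots> \<le> (\<integral>\<^sup>+(y::real\<times>real). ennreal ((1 + norm y) * exp (- (norm y)\<^sup>2 / (4 * \<nu>))) * ennreal (3 / (1 + r\<^sup>2)) \<partial>lborel)"
      proof (intro nn_integral_mono)
        fix y :: "real \<times> real"
        have "- phase \<nu> 1 (r, s *\<^sub>R y) / r = - (norm y)\<^sup>2 / (4 * \<nu>) + - 1 / r"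
          using s \<nu> by (simp add: phase_norm power_mult_distrib add_divide_distrib diff_divide_distrib)
        then have "exp (- phase \<nu> 1 (r, s *\<^sub>R y) / r) = exp (- (norm y)\<^sup>2 / (4 * \<nu>)) * exp (- 1 / r)"
          by (simp only: exp_add)
        moreover have "flatexp 3 (phase \<nu> 1 (r, s *\<^sub>R y)) r = exp (- phase \<nu> 1 (r, s *\<^sub>R y) / r) / r ^ 3"
          using True by (simp add: flatexp_def)
        ultimately have "r * flatexp 3 (phase \<nu> 1 (r, s *\<^sub>R y)) r = exp (- (norm y)\<^sup>2 / (4 * \<nu>)) * (exp (- 1 / r) / r\<^sup>2)"
          using True by (simp add: power3_eq_cube power2_eq_square)
        also have "\<dots> \<le> ((1 + norm y) * exp (- (norm y)\<^sup>2 / (4 * \<nu>))) * (3 / (1 + r\<^sup>2))"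
        proof (intro mult_mono)
          have "\<bar>flatexp 0 1 r\<bar> \<le> (fact (0 + 2) / 1 ^ (0 + 2)) * r\<^sup>2" by (rule flatexp_quadratic_bound) auto
          then have "exp (- 1 / r) \<le> 2 * r\<^sup>2" using True by (simp add: flatexp_def fact_numeral)
          moreover have "exp (- 1 / r) \<le> 1" using True by simp
          then have "exp (- 1 / r) * r\<^sup>2 \<le> 1 * r\<^sup>2" by (intro mult_right_mono) auto
          ultimately have "exp (- 1 / r) * (1 + r\<^sup>2) \<le> 3 * r\<^sup>2" by (simp add: distrib_left)
          moreover have "0 < 1 + r\<^sup>2" by (simp add: add_pos_nonneg)
          ultimately show "exp (- 1 / r) / r\<^sup>2 \<le> 3 / (1 + r\<^sup>2)" using True
            by (subst divide_le_eq) (auto simp: le_divide_eq mult.commute)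
        qed (auto simp: mult_le_cancel_right1)
        finally show "ennreal (s\<^sup>2) * ennreal (flatexp 3 (phase \<nu> 1 (r, s *\<^sub>R y)) r)
          \<le> ennreal ((1 + norm y) * exp (- (norm y)\<^sup>2 / (4 * \<nu>))) * ennreal (3 / (1 + r\<^sup>2))"
          using s(2) by (simp add: ennreal_mult[symmetric] ennreal_leI)
      qed
      also have "\<dots> = gauss_mass \<nu> * ennreal (3 / (1 + r\<^sup>2))" unfolding gauss_mass_def by (rule nn_integral_multc) simp
      also have "ennreal (3 / (1 + r\<^sup>2)) = 3 * ennreal (1 / (1 + r\<^sup>2))"
        by (subst ennreal_numeral[symmetric], subst ennreal_mult[symmetric]) (auto simp: add_nonneg_nonneg)
      finally show ?thesis .
    qed (simp add: flatexp_def)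
  qed
  also have "\<dots> = gauss_mass \<nu> * (3 * (\<integral>\<^sup>+r. ennreal (1 / (1 + r\<^sup>2)) \<partial>lborel))"
    by (simp add: nn_integral_cmult)
  also have "\<dots> < \<infinity>" using gauss_mass_finite[OF \<nu>] nn_integral_cauchy_density_finite by (simp add: ennreal_mult_less_top)
  finally show ?thesis .
qed

lemma mass_pos: "mass \<nu> \<noteq> 0"
proof
  assume "mass \<nu> = 0"
  then have "AE z in lborel. ennreal (flatexp 3 (phase \<nu> 1 z) (fst z)) = 0"
    unfolding mass_def by (subst (asm) nn_integral_0_iff_AE) auto
  then have "AE z in lborel :: spt measure. z \<notin> box 0 (1, 1, 1)"
    by eventually_elim (auto simp: flatexp_def mem_box Basis_prod_def)
  then have "emeasure lborel (box 0 (1, 1, 1) :: spt set) = 0"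
    by (subst (asm) AE_iff_measurable[OF _ refl]) auto
  then show False by (subst (asm) emeasure_lborel_box_eq) (auto simp: Basis_prod_def)
qed

definition parabolic :: "real \<Rightarrow> spt \<Rightarrow> spt" where
  "parabolic e z = (e\<^sup>2 * fst z, e *\<^sub>R snd z)"

lemma measurable_parabolic [measurable]: "parabolic e \<in> borel_measurable borel"
  unfolding parabolic_def[abs_def] by measurable

lemma lborel_parabolic:
  assumes "0 < e"
  shows "lborel = density (distr lborel borel (parabolic e)) (\<lambda>_. ennreal (e ^ 4))"
proof -
  define c :: "spt \<Rightarrow> real" where "c j = (if j = (1,0,0) then e\<^sup>2 else e)" for j
  have B: "(Basis :: spt set) = {(1,0,0), (0,1,0), (0,0,1)}"
    by (auto simp: Basis_prod_def zero_prod_def)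
  have "parabolic e = (\<lambda>x. 0 + (\<Sum>j\<in>Basis. (c j * (x \<bullet> j)) *\<^sub>R j))"
    unfolding B by (auto simp: parabolic_def c_def inner_prod_def prod_eq_iff)
  moreover have "(\<Prod>j\<in>Basis. \<bar>c j\<bar>) = e ^ 4"
    unfolding B using assms by (simp add: c_def power2_eq_square numeral_eq_Suc)
  ultimately show ?thesis
    using lborel_affine_euclidean[of c 0] assms by (simp add: c_def)
qed

lemma integral_parabolic:
  fixes f :: "spt \<Rightarrow> real"
  assumes [measurable]: "f \<in> borel_measurable borel" and e: "0 < e"
  shows "(\<integral>z. f z \<partial>lborel) = (\<integral>z. e ^ 4 * f (parabolic e z) \<partial>lborel)"
  by (subst lborel_parabolic[OF e])
     (use e in \<open>simp add: integral_density integral_distr\<close>)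

lemma nn_integral_parabolic:
  assumes [measurable]: "f \<in> borel_measurable borel" and e: "0 < e"
  shows "(\<integral>\<^sup>+z. f z \<partial>lborel) = (\<integral>\<^sup>+z. ennreal (e ^ 4) * f (parabolic e z) \<partial>lborel)"
  by (subst lborel_parabolic[OF e]) (simp add: nn_integral_density nn_integral_distr)

text \<open>With \<delta> = e^2 the phase and the time both scale by e^2, so the exponential is
  invariant and r^(-3) contributes e^(-6). This is cancelled by the Jacobian e^4 and the prefactor
  \<delta> = e^2, hence the source has the same mass for every \<delta>.\<close>

lemma flatexp_parabolic:
  assumes "0 < e"
  shows "e ^ 4 * (e\<^sup>2 * flatexp 3 (phase \<nu> (e\<^sup>2) (parabolic e z)) (fst (parabolic e z))) = flatexp 3 (phase \<nu> 1 z) (fst z)"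
proof -
  have "phase \<nu> (e\<^sup>2) (parabolic e z) = e\<^sup>2 * phase \<nu> 1 z"
    by (simp add: phase_def parabolic_def power2_eq_square algebra_simps)
  then show ?thesis
    using assms by (auto simp: flatexp_def parabolic_def zero_less_mult_iff power_mult_distrib simp flip: power_mult power_add)
qed

section \<open>Tonelli and measurability of parameter integrals\<close>

lemma nn_integral_swap:
  fixes f :: "'a::euclidean_space \<Rightarrow> 'b::euclidean_space \<Rightarrow> ennreal"
  assumes "(\<lambda>p. f (fst p) (snd p)) \<in> borel_measurable borel"
  shows "(\<integral>\<^sup>+x. \<integral>\<^sup>+y. f x y \<partial>lborel \<partial>lborel) = (\<integral>\<^sup>+y. \<integral>\<^sup>+x. f x y \<partial>lborel \<partial>lborel)"
proof -
  have "(\<lambda>p. f (fst p) (snd p)) \<in> borel_measurable (lborel \<Otimes>\<^sub>M lborel)"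
    using assms by (simp add: lborel_prod)
  then have "case_prod f \<in> borel_measurable (lborel \<Otimes>\<^sub>M lborel)" by (simp add: case_prod_beta')
  from lborel_pair.Fubini'[OF this] show ?thesis by simp
qed

lemma measurable_nn_integral_param:
  fixes f :: "'a::euclidean_space \<Rightarrow> 'b::euclidean_space \<Rightarrow> ennreal"
  assumes "(\<lambda>p. f (fst p) (snd p)) \<in> borel_measurable borel"
  shows "(\<lambda>x. \<integral>\<^sup>+y. f x y \<partial>lborel) \<in> borel_measurable borel"
proof (rule lborel.borel_measurable_nn_integral)
  have "sets (borel \<Otimes>\<^sub>M lborel :: ('a \<times> 'b) measure) = sets borel"
    unfolding borel_prod[symmetric] by (rule sets_pair_measure_cong) auto
  then show "case_prod f \<in> borel_measurable (borel \<Otimes>\<^sub>M lborel)"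
    using assms by (simp add: case_prod_beta' cong: measurable_cong_sets)
qed

lemma measurable_integral_param:
  fixes f :: "'a::euclidean_space \<Rightarrow> 'b::euclidean_space \<Rightarrow> 'c::{banach, second_countable_topology}"
  assumes "(\<lambda>p. f (fst p) (snd p)) \<in> borel_measurable borel"
  shows "(\<lambda>x. \<integral>y. f x y \<partial>lborel) \<in> borel_measurable borel"
proof (rule lborel.borel_measurable_lebesgue_integral)
  have "sets (borel \<Otimes>\<^sub>M lborel :: ('a \<times> 'b) measure) = sets borel"
    unfolding borel_prod[symmetric] by (rule sets_pair_measure_cong) auto
  then show "case_prod f \<in> borel_measurable (borel \<Otimes>\<^sub>M lborel)"
    using assms by (simp add: case_prod_beta' cong: measurable_cong_sets)
qed

section \<open>Potentials and the Biot--Savart law\<close>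

text \<open>Up to a constant, the Riesz potential of order one of |f|. Division by zero makes the
  integrand 0 at y = x, which is a null set.\<close>

definition pot :: "(real \<times> real \<Rightarrow> real) \<Rightarrow> real \<times> real \<Rightarrow> ennreal" where
  "pot f x = (\<integral>\<^sup>+y. ennreal (\<bar>f y\<bar> / norm (x - y)) \<partial>lborel)"

definition dense_pts :: "(real \<times> real) set" where
  "dense_pts = (SOME D. countable D \<and> closure D = UNIV)"

lemma dense_pts: "countable dense_pts" "closure dense_pts = UNIV"
proof -
  obtain D :: "(real \<times> real) set" where D: "countable D" "\<forall>X. open X \<longrightarrow> X \<noteq> {} \<longrightarrow> (\<exists>d\<in>D. d \<in> X)"
    using countable_dense_exists[where 'a = "real \<times> real"] by (elim exE conjE)
  have "closure D = UNIV"
  proof (rule ccontr)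
    assume "closure D \<noteq> UNIV"
    then have "open (- closure D)" "- closure D \<noteq> {}" by auto
    then obtain d where "d \<in> D" "d \<in> - closure D" using D(2) by meson
    then show False using closure_subset[of D] by auto
  qed
  with D(1) have "\<exists>D :: (real \<times> real) set. countable D \<and> closure D = UNIV" by blast
  from someI_ex[OF this] show "countable dense_pts" "closure dense_pts = UNIV"
    by (auto simp: dense_pts_def)
qed

text \<open>The supremum of the potential, taken over a countable dense set to keep it measurable in parameters.\<close>

definition suppot :: "(real \<times> real \<Rightarrow> real) \<Rightarrow> ennreal" where
  "suppot f = (SUP x\<in>dense_pts. pot f x)"

text \<open>The potential is lower semicontinuous in x: off y = x the kernel is continuous, so Fatou
  along a dense sequence tending to x passes the bound to every point.\<close>

lemma pot_le_suppot:
  assumes [measurable]: "f \<in> borel_measurable borel"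
  shows "pot f x \<le> suppot f"
proof -
  have "x \<in> closure dense_pts" by (simp add: dense_pts)
  then obtain s where s: "\<And>n. s n \<in> dense_pts" "s \<longlonglongrightarrow> x"
    unfolding closure_sequential by blast
  have "pot f x \<le> (\<integral>\<^sup>+y. liminf (\<lambda>n. ennreal (\<bar>f y\<bar> / norm (s n - y))) \<partial>lborel)"
    unfolding pot_def
  proof (rule nn_integral_mono_AE)
    show "AE y in lborel. ennreal (\<bar>f y\<bar> / norm (x - y)) \<le> liminf (\<lambda>n. ennreal (\<bar>f y\<bar> / norm (s n - y)))"
      using AE_lborel_singleton[of x]
    proof eventually_elim
      case (elim y)
      have "(\<lambda>n. ennreal (\<bar>f y\<bar> / norm (s n - y))) \<longlonglongrightarrow> ennreal (\<bar>f y\<bar> / norm (x - y))"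
        using elim by (intro tendsto_ennrealI tendsto_intros s) auto
      from lim_imp_Liminf[OF _ this] show ?case by simp
    qed
  qed
  also have "\<dots> \<le> liminf (\<lambda>n. pot f (s n))"
    unfolding pot_def by (rule nn_integral_liminf) measurable
  also have "\<dots> \<le> liminf (\<lambda>n. suppot f)"
    by (intro Liminf_mono always_eventually allI) (auto simp: suppot_def intro!: SUP_upper s)
  also have "\<dots> = suppot f" by (simp add: Liminf_const)
  finally show ?thesis .
qed

lemma suppot_leI: "(\<And>x. pot f x \<le> c) \<Longrightarrow> suppot f \<le> c"
  unfolding suppot_def by (rule SUP_least) auto

lemma measurable_suppot:
  fixes u :: "real \<Rightarrow> real \<times> real \<Rightarrow> real"
  assumes [measurable]: "(\<lambda>z. u (fst z) (snd z)) \<in> borel_measurable borel"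
  shows "(\<lambda>t. suppot (u t)) \<in> borel_measurable borel"
  unfolding suppot_def pot_def
  by (intro borel_measurable_SUP dense_pts measurable_nn_integral_param) measurable

lemma pot_diff_le:
  assumes [measurable]: "f \<in> borel_measurable borel" "g \<in> borel_measurable borel"
  shows "pot (\<lambda>y. f y - g y) x \<le> pot f x + pot g x"
proof -
  have "pot (\<lambda>y. f y - g y) x \<le> (\<integral>\<^sup>+y. ennreal (\<bar>f y\<bar> / norm (x - y)) + ennreal (\<bar>g y\<bar> / norm (x - y)) \<partial>lborel)"
    unfolding pot_def
    by (intro nn_integral_mono) (auto simp: ennreal_plus[symmetric] add_divide_distrib[symmetric]
      simp del: ennreal_plus intro!: ennreal_leI divide_right_mono)
  also have "\<dots> = pot f x + pot g x"
    unfolding pot_def by (rule nn_integral_add) auto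
  finally show ?thesis .
qed

section \<open>The Biot-Savart velocity\<close>

lemma norm_bs_kernel: "norm (bs_kernel z) = 1 / (2 * pi) * (1 / norm z)"
proof (cases "z = 0")
  case False
  have "norm (- snd z, fst z) = norm z" by (cases z) (simp add: norm_Pair add.commute)
  moreover have "(fst z)\<^sup>2 + (snd z)\<^sup>2 = (norm z)\<^sup>2" by (simp add: norm_R2)
  ultimately have "norm (bs_kernel z) = \<bar>1 / (2 * pi * (norm z)\<^sup>2)\<bar> * norm z"
    by (simp only: bs_kernel_def False if_False norm_scaleR)
  then show ?thesis using False by (simp add: power2_eq_square abs_mult)
qed (simp add: bs_kernel_def)

lemma measurable_bs_kernel [measurable]: "bs_kernel \<in> borel_measurable borel"
proof -
  have "(\<lambda>x. if x = 0 then 0 else (1 / (2 * pi * (fst x ^ 2 + snd x ^ 2))) *\<^sub>R (- snd x, fst x)) \<in> borel_measurable (borel :: (real \<times> real) measure)"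
    by measurable
  then show ?thesis unfolding bs_kernel_def[abs_def] .
qed

lemma BS_integrand_le: "ennreal (norm (f y *\<^sub>R bs_kernel (x - y))) \<le> ennreal (\<bar>f y\<bar> / norm (x - y))"
proof (rule ennreal_leI)
  have "1 / (2 * pi) \<le> 1" using pi_gt3 by simp
  then have "norm (bs_kernel (x - y)) \<le> 1 * (1 / norm (x - y))"
    unfolding norm_bs_kernel by (rule mult_right_mono) simp
  then have "\<bar>f y\<bar> * norm (bs_kernel (x - y)) \<le> \<bar>f y\<bar> * (1 / norm (x - y))"
    by (intro mult_left_mono) auto
  then show "norm (f y *\<^sub>R bs_kernel (x - y)) \<le> \<bar>f y\<bar> / norm (x - y)" by simp
qed

text \<open>No integrability is required, because a Bochner integral that does not converge has the
  value 0.\<close>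

lemma norm_BS_le: "ennreal (norm (BS f x)) \<le> pot f x"
proof (cases "integrable lborel (\<lambda>y. f y *\<^sub>R bs_kernel (x - y))")
  case True
  then have "ennreal (norm (BS f x)) \<le> (\<integral>\<^sup>+y. ennreal (norm (f y *\<^sub>R bs_kernel (x - y))) \<partial>lborel)"
    unfolding BS_def by (rule integral_norm_bound_ennreal)
  also have "\<dots> \<le> pot f x" unfolding pot_def by (intro nn_integral_mono BS_integrand_le)
  finally show ?thesis .
qed (simp add: BS_def not_integrable_integral_eq)

text \<open>Finite potentials make both convolution integrals converge absolutely; with the default
  value 0 linearity could fail.\<close>

lemma BS_diff:
  assumes [measurable]: "f \<in> borel_measurable borel" "g \<in> borel_measurable borel"
    and "pot f x < \<infinity>" "pot g x < \<infinity>"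
  shows "BS (\<lambda>y. f y - g y) x = BS f x - BS g x"
proof -
  have "integrable lborel (\<lambda>y. h y *\<^sub>R bs_kernel (x - y))"
    if [measurable]: "h \<in> borel_measurable borel" and "pot h x < \<infinity>" for h
  proof (rule integrableI_bounded)
    show "(\<lambda>y. h y *\<^sub>R bs_kernel (x - y)) \<in> borel_measurable lborel" by simp
    have "(\<integral>\<^sup>+y. ennreal (norm (h y *\<^sub>R bs_kernel (x - y))) \<partial>lborel) \<le> pot h x"
      unfolding pot_def by (intro nn_integral_mono BS_integrand_le)
    then show "(\<integral>\<^sup>+y. ennreal (norm (h y *\<^sub>R bs_kernel (x - y))) \<partial>lborel) < \<infinity>"
      using that(2) by (rule le_less_trans)
  qed
  with assms show ?thesis unfolding BS_def by (simp add: scaleR_diff_left Bochner_Integration.integral_diff)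
qed

lemma measurable_BS_param:
  fixes u :: "real \<Rightarrow> real \<times> real \<Rightarrow> real"
  assumes [measurable]: "(\<lambda>z. u (fst z) (snd z)) \<in> borel_measurable borel"
  shows "(\<lambda>z. BS (u (fst z)) (snd z)) \<in> borel_measurable borel"
proof -
  have "(\<lambda>p::spt \<times> real \<times> real. u (fst (fst p)) (snd p)) \<in> borel_measurable borel"
    by (rule measurable_compose[of "\<lambda>p. (fst (fst p), snd p)" borel borel, OF _ assms, simplified]) measurable
  then show ?thesis
    unfolding BS_def
    by (intro measurable_integral_param borel_measurable_scaleR measurable_compose[OF _ measurable_bs_kernel]
      borel_measurable_continuous_onI[of "\<lambda>p. snd (fst p) - snd p"] continuous_intros)
qed

section \<open>The potential in terms of Lebesgue norms\<close>

lemma ennreal_add_power4_le: "(a + b :: ennreal) ^ 4 \<le> 16 * (a ^ 4 + b ^ 4)"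
proof -
  have "(a + b) ^ 4 \<le> (2 * max a b) ^ 4" 
    by (intro power_mono) (auto simp: mult_2 intro!: add_mono)
  also have "\<dots> = 16 * (max a b) ^ 4" by (simp add: power_mult_distrib)
  also have "\<dots> \<le> 16 * (a ^ 4 + b ^ 4)" by (intro mult_left_mono) (auto simp: max_def add_increasing add_increasing2)
  finally show ?thesis .
qed

lemma Lp_norm_4: "Lp_norm 4 f ^ 4 = Lp_pow 4 f"
proof (cases "Lp_pow 4 f = \<infinity>")
  case False
  have "(enn2real (Lp_pow 4 f) powr (1 / 4)) ^ 4 = enn2real (Lp_pow 4 f)"
    by (subst powr_power_pos) (auto simp: enn2real_nonneg)
  with False show ?thesis by (simp add: Lp_norm_def ennreal_power top.not_eq_extremum)
qed (simp add: Lp_norm_def)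

lemma Lp_norm_4_3: "Lp_norm (4/3) f ^ 4 = Lp_pow (4/3) f ^ 3"
proof (cases "Lp_pow (4/3) f = \<infinity>")
  case False
  then obtain A where A: "Lp_pow (4/3) f = ennreal A" "0 \<le> A" by (cases "Lp_pow (4/3) f") auto
  have "(A powr (1 / (4/3))) ^ 4 = A powr (real 3)"
    by (subst powr_power_pos) auto
  also have "\<dots> = A ^ 3" using A by (subst powr_realpow') auto
  finally show ?thesis using A by (simp add: Lp_norm_def ennreal_power)
qed (simp add: Lp_norm_def)

text \<open>Split 1/|z| at radius 1. The near part is in L^(4/3), as |z|^(-4/3) is integrable at 0,
  and is paired with f in L^4. The far part is in L^4, as |z|^(-4) is integrable at infinity, and is
  paired with f in L^(4/3). Fourth powers match the time exponent of the solution class.\<close>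

lemma pot_power4_le:
  "\<exists>C::ennreal. C < \<infinity> \<and> (\<forall>f x. f \<in> borel_measurable borel \<longrightarrow> pot f x ^ 4 \<le> C * (Lp_norm 4 f ^ 4 + Lp_norm (4/3) f ^ 4))"
proof -
  define l where "l z = ennreal (norm z powr (- (1/3))) * indicator (ball 0 1) z" for z :: "real \<times> real"
  define g where "g z = ennreal (1 / norm z) * indicator (- ball 0 1) z" for z :: "real \<times> real"
  have [measurable]: "ball (0::real\<times>real) 1 \<in> sets borel" "- ball (0::real\<times>real) 1 \<in> sets borel" by auto
  have [measurable]: "l \<in> borel_measurable borel" "g \<in> borel_measurable borel"
    unfolding l_def[abs_def] g_def[abs_def] by measurable
  define L where "L = (\<integral>\<^sup>+z. l z ^ 4 \<partial>lborel)"
  define G where "G = (\<integral>\<^sup>+z. g z ^ 4 \<partial>lborel)"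
  have "l z ^ 4 = ennreal (norm z powr (- (4/3))) * indicator (ball 0 1) z" for z
    by (cases "z = 0") (auto simp: l_def ennreal_power powr_power_pos power_mult_distrib split: split_indicator)
  then have L: "L < \<infinity>" using nn_integral_norm_powr_near_finite by (simp add: L_def)
  have "G \<le> (\<integral>\<^sup>+z. 3 * ennreal (cauchy2 z) \<partial>lborel)"
    unfolding G_def
  proof (intro nn_integral_mono)
    fix z
    show "g z ^ 4 \<le> 3 * ennreal (cauchy2 z)"
    proof (cases "norm z < 1")
      case False
      then have "ennreal (1 / norm z ^ 4) \<le> ennreal (3 * cauchy2 z)" by (intro ennreal_leI cauchy2_bounds) auto
      then show ?thesis using False by (simp add: g_def ennreal_power power_divide ennreal_mult)
    qed (simp add: g_def)
  qed
  also have "\<dots> < \<infinity>"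
    using nn_integral_cauchy2_finite by (simp add: nn_integral_cmult ennreal_mult_less_top)
  finally have G: "G < \<infinity>" .
  have "pot f x ^ 4 \<le> 16 * (L ^ 3 + G) * (Lp_norm 4 f ^ 4 + Lp_norm (4/3) f ^ 4)"
    if [measurable]: "f \<in> borel_measurable borel" for f x
  proof -
    define F where "F y = ennreal \<bar>f y\<bar>" for y
    define M where "M y = ennreal (\<bar>f y\<bar> powr (1/3))" for y
    have [measurable]: "F \<in> borel_measurable borel" "M \<in> borel_measurable borel"
      unfolding F_def[abs_def] M_def[abs_def] by measurable
    have M3: "M y ^ 3 = F y" for y
      by (auto simp: M_def F_def ennreal_power powr_power_pos)
    \<comment> \<open>In each piece the factor taken in L^(4/3) appears as a cube, the shape of
      \<open>nn_integral_holder4\<close>.\<close>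
    have split: "ennreal (\<bar>f y\<bar> / norm (x - y)) = l (x - y) ^ 3 * F y + M y ^ 3 * g (x - y)" for y
      unfolding M3
      by (cases "x = y") (auto simp: l_def g_def F_def ennreal_power powr_power_pos powr_minus_divide power_divide
         ennreal_mult[symmetric] split: split_indicator)
    have "pot f x = (\<integral>\<^sup>+y. l (x - y) ^ 3 * F y \<partial>lborel) + (\<integral>\<^sup>+y. M y ^ 3 * g (x - y) \<partial>lborel)"
      unfolding pot_def split by (rule nn_integral_add) auto
    then have "pot f x ^ 4 \<le> 16 * ((\<integral>\<^sup>+y. l (x - y) ^ 3 * F y \<partial>lborel) ^ 4 + (\<integral>\<^sup>+y. M y ^ 3 * g (x - y) \<partial>lborel) ^ 4)"
      using ennreal_add_power4_le by simp
    also have "\<dots> \<le> 16 * (L ^ 3 * Lp_pow 4 f + Lp_pow (4/3) f ^ 3 * G)"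
    proof (intro mult_left_mono add_mono)
      have "(\<integral>\<^sup>+y. l (x - y) ^ 4 \<partial>lborel) = L"
        unfolding L_def by (rule nn_integral_lborel_reflect) measurable
      moreover have "(\<integral>\<^sup>+y. F y ^ 4 \<partial>lborel) = Lp_pow 4 f"
        unfolding Lp_pow_def F_def by (intro nn_integral_cong) (auto simp: ennreal_power)
      ultimately show "(\<integral>\<^sup>+y. l (x - y) ^ 3 * F y \<partial>lborel) ^ 4 \<le> L ^ 3 * Lp_pow 4 f"
        using nn_integral_holder4[of "\<lambda>y. l (x - y)" lborel F] by simp
      have "(\<integral>\<^sup>+y. g (x - y) ^ 4 \<partial>lborel) = G"
        unfolding G_def by (rule nn_integral_lborel_reflect) measurable
      moreover have "(\<integral>\<^sup>+y. M y ^ 4 \<partial>lborel) = Lp_pow (4/3) f"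
        unfolding Lp_pow_def M_def by (intro nn_integral_cong) (auto simp: ennreal_power powr_power_pos)
      ultimately show "(\<integral>\<^sup>+y. M y ^ 3 * g (x - y) \<partial>lborel) ^ 4 \<le> Lp_pow (4/3) f ^ 3 * G"
        using nn_integral_holder4[of M lborel "\<lambda>y. g (x - y)"] by simp
    qed auto
    also have "\<dots> \<le> 16 * ((L ^ 3 + G) * (Lp_pow 4 f + Lp_pow (4/3) f ^ 3))"
      by (intro mult_left_mono) (auto simp: distrib_left distrib_right add_increasing2 add_increasing mult_ac
        intro!: add_mono)
    finally show ?thesis unfolding Lp_norm_4 Lp_norm_4_3 mult.assoc .
  qed
  moreover have "16 * (L ^ 3 + G) < \<infinity>"
    using L G by (simp add: ennreal_mult_less_top power_less_top_ennreal)
  ultimately show ?thesis by blast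
qed

section \<open>Mollification by the heat kernel\<close>

text \<open>The heat operator maps \<open>parametrix \<nu> \<delta>\<close> to \<open>mollker \<nu> \<delta> + errker \<nu> \<delta>\<close>, and its spatial gradient is
  \<open>gradker \<nu> \<delta>\<close>; unlike the derivatives, these formulas remain meaningful for \<open>\<delta> = 0\<close>.\<close>

definition errker :: "real \<Rightarrow> real \<Rightarrow> spt \<Rightarrow> real" where
  "errker \<nu> \<delta> z = heatker \<nu> \<delta> z * (dt cut z - \<nu> * lap_x cut z) + (grad_x cut z \<bullet> snd z) * flatexp 2 (phase \<nu> \<delta> z) (fst z)"

definition gradker :: "real \<Rightarrow> real \<Rightarrow> spt \<Rightarrow> real \<times> real" where
  "gradker \<nu> \<delta> z = heatker \<nu> \<delta> z *\<^sub>R grad_x cut z - (cut z * flatexp 2 (phase \<nu> \<delta> z) (fst z) / (2 * \<nu>)) *\<^sub>R snd z"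

definition mollker :: "real \<Rightarrow> real \<Rightarrow> spt \<Rightarrow> real" where
  "mollker \<nu> \<delta> z = cut z * (\<delta> * flatexp 3 (phase \<nu> \<delta> z) (fst z))"

lemma measurable_smooth_fun: "smooth_fun f \<Longrightarrow> f \<in> borel_measurable borel"
  by (intro borel_measurable_continuous_onI smooth_funD)

lemma smooth_cut_derivs:
  "smooth_fun (pd cut (1,0,0))" "smooth_fun (pd cut (0,1,0))" "smooth_fun (pd cut (0,0,1))"
  "smooth_fun (pd (pd cut (0,1,0)) (0,1,0))" "smooth_fun (pd (pd cut (0,0,1)) (0,0,1))"
  by (auto intro!: smooth_funD(2) smooth_cut spt_Basis)

lemma measurable_cut_derivs [measurable]:
  "cut \<in> borel_measurable borel" "dt cut \<in> borel_measurable borel"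
  "grad_x cut \<in> borel_measurable borel" "lap_x cut \<in> borel_measurable borel"
  using smooth_cut_derivs[THEN measurable_smooth_fun] smooth_cut[THEN measurable_smooth_fun]
  unfolding dt_def[abs_def] grad_x_def[abs_def] lap_x_def[abs_def] by auto

lemma measurable_kernels [measurable]:
  "errker \<nu> \<delta> \<in> borel_measurable borel" "gradker \<nu> \<delta> \<in> borel_measurable borel" "mollker \<nu> \<delta> \<in> borel_measurable borel"
  unfolding errker_def[abs_def] gradker_def[abs_def] mollker_def[abs_def] heatker_def by measurable

text \<open>The strict inequality describes an open set, on which f is locally constant.\<close>

lemma pd_eq_0_outside:
  fixes f :: "spt \<Rightarrow> real"
  assumes "\<And>z. 1 < norm z \<Longrightarrow> f z = 0" "1 < norm z"
  shows "pd f b z = 0"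
proof -
  have "(f has_derivative (\<lambda>_. 0)) (at z)"
    by (rule has_derivative_transform_within_open[of "\<lambda>_. 0" _ _ _ "- cball 0 1"])
       (use assms in auto)
  then show ?thesis by (rule pd_eq)
qed

lemma cut_derivs_outside:
  assumes "1 < norm z"
  shows "cut z = 0" "dt cut z = 0" "grad_x cut z = 0" "lap_x cut z = 0"
proof -
  have c: "\<And>z. 1 < norm z \<Longrightarrow> cut z = 0" using cut_eq_0 by auto
  then have p: "\<And>z b. 1 < norm z \<Longrightarrow> pd cut b z = 0" using pd_eq_0_outside by blast
  then have "\<And>z b. 1 < norm z \<Longrightarrow> pd (pd cut b) b z = 0" using pd_eq_0_outside by blast
  with c p assms show "cut z = 0" "dt cut z = 0" "grad_x cut z = 0" "lap_x cut z = 0"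
    by (auto simp: dt_def grad_x_def lap_x_def zero_prod_def)
qed

lemma cut_derivs_bounded:
  "\<exists>C\<ge>0. \<forall>z. \<bar>cut z\<bar> \<le> C \<and> \<bar>dt cut z\<bar> \<le> C \<and> norm (grad_x cut z) \<le> C \<and> \<bar>lap_x cut z\<bar> \<le> C"
proof -
  have b: "\<exists>C. \<forall>z\<in>cball 0 1. \<bar>f z\<bar> \<le> C" if "smooth_fun f" for f :: "spt \<Rightarrow> real"
  proof -
    have "compact (f ` cball 0 1)" by (intro compact_continuous_image smooth_funD that compact_cball)
    then have "bounded (f ` cball 0 1)" by (rule compact_imp_bounded)
    then show ?thesis unfolding bounded_iff by auto
  qed
  define B where "B f = (SOME C. \<forall>z\<in>cball 0 1. \<bar>f z\<bar> \<le> C)" for f :: "spt \<Rightarrow> real"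
  have B: "\<bar>f z\<bar> \<le> B f" if "smooth_fun f" "z \<in> cball 0 1" for f z
    using someI_ex[OF b[OF that(1)]] that(2) unfolding B_def by blast
  define C0 C1 C2 C3 C4 C5 where C_defs: "C0 = B cut" "C1 = B (pd cut (1,0,0))" "C2 = B (pd cut (0,1,0))" "C3 = B (pd cut (0,0,1))"
    "C4 = B (pd (pd cut (0,1,0)) (0,1,0))" "C5 = B (pd (pd cut (0,0,1)) (0,0,1))"
  note C = B[OF smooth_cut, folded C_defs] smooth_cut_derivs[THEN B, folded C_defs]
  define C where "C = C0 + C1 + C2 + C3 + C4 + C5"
  have C_pos: "0 \<le> C0" "0 \<le> C1" "0 \<le> C2" "0 \<le> C3" "0 \<le> C4" "0 \<le> C5"
    using C[of 0] by (auto intro: order_trans[OF abs_ge_zero])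
  then have "0 \<le> C" by (simp add: C_def)
  have "\<bar>cut z\<bar> \<le> C \<and> \<bar>dt cut z\<bar> \<le> C \<and> norm (grad_x cut z) \<le> C \<and> \<bar>lap_x cut z\<bar> \<le> C" for z
  proof (cases "norm z \<le> 1")
    case True
    then have z: "z \<in> cball 0 1" by simp
    note C = C[OF z]
    have "norm (grad_x cut z) \<le> \<bar>pd cut (0,1,0) z\<bar> + \<bar>pd cut (0,0,1) z\<bar>"
      using norm_Pair_le[of "pd cut (0,1,0) z" "pd cut (0,0,1) z"] by (simp add: grad_x_def)
    then have "norm (grad_x cut z) \<le> C2 + C3" using add_mono[OF C(3,4)] by (rule order_trans)
    moreover have "\<bar>lap_x cut z\<bar> \<le> C4 + C5"
      unfolding lap_x_def using abs_triangle_ineq add_mono[OF C(5,6)] by (rule order_trans)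
    moreover have "\<bar>dt cut z\<bar> \<le> C1" using C(2) by (simp add: dt_def)
    moreover have "C2 + C3 \<le> C" "C4 + C5 \<le> C" "C1 \<le> C" "C0 \<le> C" using C_pos by (auto simp: C_def)
    ultimately show ?thesis using C(1) by (blast intro: order_trans)
  next
    case False
    then show ?thesis using cut_derivs_outside[of z] \<open>0 \<le> C\<close> by simp
  qed
  with \<open>0 \<le> C\<close> show ?thesis by blast
qed

lemma flatexp_phase_le:
  assumes "0 < \<nu>" "0 \<le> \<delta>" "0 < fst z"
  shows "flatexp n (phase \<nu> \<delta> z) (fst z) \<le> exp (- (norm (snd z))\<^sup>2 / (4 * \<nu> * fst z)) / fst z ^ n"
proof -
  have "(norm (snd z))\<^sup>2 / (4 * \<nu> * fst z) \<le> phase \<nu> \<delta> z / fst z"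
    using assms by (simp add: phase_norm add_divide_distrib)
  then show ?thesis using assms(3) by (simp add: flatexp_def divide_right_mono)
qed

text \<open>Dropping \<delta> from the phase only increases the exponential, so a single constant
  works for all \<delta> \<ge> 0, including the limit \<delta> = 0. This uniform majorant drives the
  dominated convergence. \<open>heatker\<close> accounts for 1/r, and the terms with
  \<open>flatexp 2\<close> carry a factor x and account for |x|/r^2.\<close>

lemma kernels_le_hkbound:
  assumes \<nu>: "0 < \<nu>"
  shows "\<exists>C\<ge>0. \<forall>\<delta>\<ge>0. \<forall>z. \<bar>errker \<nu> \<delta> z\<bar> \<le> C * hkbound \<nu> (fst z) (snd z) \<and> norm (gradker \<nu> \<delta> z) \<le> C * hkbound \<nu> (fst z) (snd z)"
proof -
  obtain C0 where C0: "0 \<le> C0" "\<And>z. \<bar>cut z\<bar> \<le> C0" "\<And>z. \<bar>dt cut z\<bar> \<le> C0" "\<And>z. norm (grad_x cut z) \<le> C0" "\<And>z. \<bar>lap_x cut z\<bar> \<le> C0"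
    using cut_derivs_bounded by blast
  define C where "C = C0 * (1 + \<nu>) + C0 + C0 / (2 * \<nu>)"
  have Cp: "0 \<le> C0 * \<nu>" "0 \<le> C0 / (2 * \<nu>)" "0 \<le> C" using C0(1) \<nu> by (auto simp: C_def)
  have CC: "C0 * (1 + \<nu>) \<le> C" "C0 \<le> C" "C0 / (2 * \<nu>) \<le> C" using Cp C0(1) by (auto simp: C_def distrib_left)
  have "\<bar>errker \<nu> \<delta> z\<bar> \<le> C * hkbound \<nu> (fst z) (snd z) \<and> norm (gradker \<nu> \<delta> z) \<le> C * hkbound \<nu> (fst z) (snd z)" if \<delta>: "0 \<le> \<delta>" for \<delta> z
  proof (cases "0 < fst z \<and> norm z \<le> 1")
    case True
    define r y E where "r = fst z" "y = norm (snd z)" "E = exp (- (norm (snd z))\<^sup>2 / (4 * \<nu> * fst z))"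
    have r: "0 < r" "r \<le> 1" "y \<le> 1" "0 \<le> y" "0 \<le> E"
      using True norm_fst_le[of "fst z" "snd z"] norm_snd_le[of "snd z" "fst z"] by (auto simp: r_y_E_def)
    have hkbound: "hkbound \<nu> (fst z) (snd z) = E / r + y * (E / r\<^sup>2)"
      using r unfolding hkbound_def r_y_E_def by (auto simp: field_simps)
    define h e where "h = heatker \<nu> \<delta> z" "e = flatexp 2 (phase \<nu> \<delta> z) (fst z)"
    have h: "0 \<le> h" "h \<le> E / r"
      using flatexp_phase_le[OF \<nu> \<delta>, of z 1] True by (auto simp: heatker_def h_e_def r_y_E_def)
    have e: "0 \<le> e" "e \<le> E / r\<^sup>2"
      using flatexp_phase_le[OF \<nu> \<delta>, of z 2] True by (auto simp: h_e_def r_y_E_def)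
    have ye: "y * e \<le> y * (E / r\<^sup>2)" "0 \<le> y * e"
      using mult_left_mono[OF e(2) r(4)] mult_nonneg_nonneg[OF r(4) e(1)] by simp_all
    have "\<bar>errker \<nu> \<delta> z\<bar> \<le> \<bar>h\<bar> * \<bar>dt cut z - \<nu> * lap_x cut z\<bar> + \<bar>grad_x cut z \<bullet> snd z\<bar> * \<bar>e\<bar>"
      unfolding errker_def h_e_def[symmetric] by (rule order_trans[OF abs_triangle_ineq]) (simp add: abs_mult)
    also have "\<dots> \<le> h * (C0 * (1 + \<nu>)) + (C0 * y) * e"
    proof (intro add_mono mult_mono)
      have "\<bar>dt cut z - \<nu> * lap_x cut z\<bar> \<le> \<bar>dt cut z\<bar> + \<nu> * \<bar>lap_x cut z\<bar>"
        using \<nu> abs_triangle_ineq4[of "dt cut z" "\<nu> * lap_x cut z"] by (simp add: abs_mult)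
      also have "\<dots> \<le> C0 + \<nu> * C0" using \<nu> by (intro add_mono mult_left_mono C0) auto
      finally show "\<bar>dt cut z - \<nu> * lap_x cut z\<bar> \<le> C0 * (1 + \<nu>)" by (simp add: algebra_simps)
      have "\<bar>grad_x cut z \<bullet> snd z\<bar> \<le> norm (grad_x cut z) * norm (snd z)" by (rule Cauchy_Schwarz_ineq2)
      also have "\<dots> \<le> C0 * y" unfolding r_y_E_def by (intro mult_right_mono C0) auto
      finally show "\<bar>grad_x cut z \<bullet> snd z\<bar> \<le> C0 * y" .
    qed (use h e C0(1) r in auto)
    also have "\<dots> = (C0 * (1 + \<nu>)) * h + C0 * (y * e)" by (simp add: mult_ac)
    also have "\<dots> \<le> C * (E / r) + C * (y * (E / r\<^sup>2))"
      by (intro add_mono mult_mono CC h ye Cp)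
    finally have 1: "\<bar>errker \<nu> \<delta> z\<bar> \<le> C * hkbound \<nu> (fst z) (snd z)" by (simp add: hkbound distrib_left)
    have "norm (gradker \<nu> \<delta> z) \<le> norm (h *\<^sub>R grad_x cut z) + norm ((cut z * e / (2 * \<nu>)) *\<^sub>R snd z)"
      unfolding gradker_def h_e_def[symmetric] by (rule norm_triangle_ineq4)
    also have "\<dots> = h * norm (grad_x cut z) + (\<bar>cut z\<bar> / (2 * \<nu>)) * (y * e)"
      using h e \<nu> by (simp only: norm_scaleR) (simp add: abs_mult r_y_E_def(2))
    also have "\<dots> \<le> (E / r) * C + C * (y * (E / r\<^sup>2))"
    proof (rule add_mono[OF mult_mono[OF h(2)] mult_mono[OF _ ye(1)]])
      show "norm (grad_x cut z) \<le> C" using C0(4) CC(2) by (rule order_trans)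
      have "\<bar>cut z\<bar> / (2 * \<nu>) \<le> C0 / (2 * \<nu>)" using \<nu> by (intro divide_right_mono C0) auto
      then show "\<bar>cut z\<bar> / (2 * \<nu>) \<le> C" using CC(3) by (rule order_trans)
    qed (use Cp r ye in auto)
    finally have 2: "norm (gradker \<nu> \<delta> z) \<le> C * hkbound \<nu> (fst z) (snd z)" by (simp add: hkbound distrib_left mult.commute)
    from 1 2 show ?thesis ..
  next
    case False
    then consider "fst z \<le> 0" | "1 < norm z" by linarith
    then have "errker \<nu> \<delta> z = 0 \<and> gradker \<nu> \<delta> z = 0"
    proof cases
      case 1 then show ?thesis by (simp add: errker_def gradker_def heatker_def flatexp_def)
    next
      case 2 then show ?thesis using cut_derivs_outside[OF 2] by (simp add: errker_def gradker_def)
    qed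
    then show ?thesis using Cp by simp
  qed
  with Cp show ?thesis by blast
qed

lemma kernels_tendsto:
  assumes "d \<longlonglongrightarrow> 0"
  shows "(\<lambda>n. errker \<nu> (d n) z) \<longlonglongrightarrow> errker \<nu> 0 z" "(\<lambda>n. gradker \<nu> (d n) z) \<longlonglongrightarrow> gradker \<nu> 0 z"
proof -
  have q: "(\<lambda>n. phase \<nu> (d n) z) \<longlonglongrightarrow> phase \<nu> 0 z"
    unfolding phase_def by (intro tendsto_intros assms)
  have e: "(\<lambda>n. flatexp m (phase \<nu> (d n) z) (fst z)) \<longlonglongrightarrow> flatexp m (phase \<nu> 0 z) (fst z)" for m
    by (cases "0 < fst z") (auto simp: flatexp_def intro!: tendsto_intros q)
  show "(\<lambda>n. errker \<nu> (d n) z) \<longlonglongrightarrow> errker \<nu> 0 z" "(\<lambda>n. gradker \<nu> (d n) z) \<longlonglongrightarrow> gradker \<nu> 0 z"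
    unfolding errker_def gradker_def heatker_def divide_inverse by (intro tendsto_intros e)+
qed

section \<open>The approximate identity\<close>

lemma cut_bounds: "0 \<le> cut z" "cut z \<le> 1"
  by (auto simp: cut_def flatexp_def)

lemma mollker_nonneg: "0 \<le> \<delta> \<Longrightarrow> 0 \<le> mollker \<nu> \<delta> z"
  by (simp add: mollker_def cut_bounds)

lemma nn_integral_mollker_le:
  assumes "0 < e"
  shows "(\<integral>\<^sup>+z. ennreal (mollker \<nu> (e\<^sup>2) z) \<partial>lborel) \<le> mass \<nu>"
proof -
  have "(\<integral>\<^sup>+z. ennreal (mollker \<nu> (e\<^sup>2) z) \<partial>lborel) = (\<integral>\<^sup>+z. ennreal (e ^ 4) * ennreal (mollker \<nu> (e\<^sup>2) (parabolic e z)) \<partial>lborel)"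
    by (rule nn_integral_parabolic[OF _ assms]) measurable
  also have "\<dots> \<le> mass \<nu>"
    unfolding mass_def
  proof (intro nn_integral_mono)
    fix z
    have "e ^ 4 * mollker \<nu> (e\<^sup>2) (parabolic e z) = cut (parabolic e z) * flatexp 3 (phase \<nu> 1 z) (fst z)"
      unfolding flatexp_parabolic[OF assms, of \<nu> z, symmetric] mollker_def by (simp only: mult_ac)
    also have "\<dots> \<le> flatexp 3 (phase \<nu> 1 z) (fst z)" by (intro mult_left_le_one_le cut_bounds) simp
    finally show "ennreal (e ^ 4) * ennreal (mollker \<nu> (e\<^sup>2) (parabolic e z)) \<le> ennreal (flatexp 3 (phase \<nu> 1 z) (fst z))"
      by (subst ennreal_mult[symmetric]) (auto simp: mollker_nonneg intro!: ennreal_leI)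
  qed
  finally show ?thesis .
qed

text \<open>After the parabolic substitution the density is fixed and integrable, while the
  arguments of g and of the cutoff tend to z and 0. Dominated convergence then needs continuity of g
  only at z. The factor exp(-1) is the value of the cutoff at 0.\<close>

lemma mollker_approx_identity:
  assumes \<nu>: "0 < \<nu>" and g[measurable]: "g \<in> borel_measurable borel" and gb: "\<And>z. \<bar>g z\<bar> \<le> 1"
    and gc: "isCont g z" and e: "e \<longlonglongrightarrow> 0" "\<And>n. 0 < e n"
  shows "(\<lambda>n. \<integral>\<zeta>. g \<zeta> * mollker \<nu> ((e n)\<^sup>2) (\<zeta> - z) \<partial>lborel) \<longlonglongrightarrow> g z * (exp (- 1) * enn2real (mass \<nu>))"
proof -
  define m where "m \<zeta> = flatexp 3 (phase \<nu> 1 \<zeta>) (fst \<zeta>)" for \<zeta>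
  have [measurable]: "m \<in> borel_measurable borel" unfolding m_def[abs_def] by measurable
  have mi: "integrable lborel m"
    using mass_finite[OF \<nu>] by (intro integrableI_bounded) (auto simp: m_def mass_def)
  have mm: "(\<integral>\<zeta>. m \<zeta> \<partial>lborel) = enn2real (mass \<nu>)"
    unfolding mass_def m_def by (rule integral_eq_nn_integral) auto
  have eq: "(\<integral>\<zeta>. g \<zeta> * mollker \<nu> ((e n)\<^sup>2) (\<zeta> - z) \<partial>lborel) =
     (\<integral>\<zeta>. g (z + parabolic (e n) \<zeta>) * (cut (parabolic (e n) \<zeta>) * m \<zeta>) \<partial>lborel)" for n
  proof -
    have "(\<integral>\<zeta>. g \<zeta> * mollker \<nu> ((e n)\<^sup>2) (\<zeta> - z) \<partial>lborel) = (\<integral>\<zeta>. g (z + \<zeta>) * mollker \<nu> ((e n)\<^sup>2) \<zeta> \<partial>lborel)"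
      by (subst lborel_distr_plus[of z, symmetric], subst integral_distr) auto
    also have "\<dots> = (\<integral>\<zeta>. (e n) ^ 4 * (g (z + parabolic (e n) \<zeta>) * mollker \<nu> ((e n)\<^sup>2) (parabolic (e n) \<zeta>)) \<partial>lborel)"
      by (rule integral_parabolic[OF _ e(2)]) measurable
    also have "\<dots> = (\<integral>\<zeta>. g (z + parabolic (e n) \<zeta>) * (cut (parabolic (e n) \<zeta>) * m \<zeta>) \<partial>lborel)"
      unfolding m_def flatexp_parabolic[OF e(2)[of n], of \<nu>, symmetric] mollker_def by (simp only: mult_ac)
    finally show ?thesis .
  qed
  have lim: "(\<lambda>n. parabolic (e n) \<zeta>) \<longlonglongrightarrow> 0" for \<zeta>
    unfolding parabolic_def zero_prod_def by (auto intro!: tendsto_eq_intros e(1) simp: zero_prod_def)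
  have "(\<lambda>n. \<integral>\<zeta>. g (z + parabolic (e n) \<zeta>) * (cut (parabolic (e n) \<zeta>) * m \<zeta>) \<partial>lborel) \<longlonglongrightarrow> (\<integral>\<zeta>. g z * (cut 0 * m \<zeta>) \<partial>lborel)"
  proof (rule integral_dominated_convergence[where w = m])
    show "AE \<zeta> in lborel. (\<lambda>n. g (z + parabolic (e n) \<zeta>) * (cut (parabolic (e n) \<zeta>) * m \<zeta>)) \<longlonglongrightarrow> g z * (cut 0 * m \<zeta>)"
    proof (rule AE_I2)
      fix \<zeta>
      have "(\<lambda>n. z + parabolic (e n) \<zeta>) \<longlonglongrightarrow> z" using tendsto_add[OF tendsto_const lim[of \<zeta>]] by auto
      from isCont_tendsto_compose[OF gc this] have "(\<lambda>n. g (z + parabolic (e n) \<zeta>)) \<longlonglongrightarrow> g z" .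
      moreover have "isCont cut 0" using smooth_cut smooth_funD(1) differentiable_imp_continuous_within by blast
      from isCont_tendsto_compose[OF this lim] have "(\<lambda>n. cut (parabolic (e n) \<zeta>)) \<longlonglongrightarrow> cut 0" .
      ultimately show "(\<lambda>n. g (z + parabolic (e n) \<zeta>) * (cut (parabolic (e n) \<zeta>) * m \<zeta>)) \<longlonglongrightarrow> g z * (cut 0 * m \<zeta>)"
        by (intro tendsto_mult tendsto_const)
    qed
    show "AE \<zeta> in lborel. norm (g (z + parabolic (e n) \<zeta>) * (cut (parabolic (e n) \<zeta>) * m \<zeta>)) \<le> m \<zeta>" for n
    proof (rule AE_I2)
      fix \<zeta>
      have m0: "0 \<le> m \<zeta>" by (simp add: m_def)
      have "\<bar>g (z + parabolic (e n) \<zeta>)\<bar> * (cut (parabolic (e n) \<zeta>) * m \<zeta>) \<le> 1 * (1 * m \<zeta>)"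
        by (intro mult_mono gb cut_bounds mult_nonneg_nonneg m0) auto
      then show "norm (g (z + parabolic (e n) \<zeta>) * (cut (parabolic (e n) \<zeta>) * m \<zeta>)) \<le> m \<zeta>"
        using m0 cut_bounds by (simp add: abs_mult)
    qed
  qed (use mi in measurable)
  also have "(\<integral>\<zeta>. g z * (cut 0 * m \<zeta>) \<partial>lborel) = g z * (exp (- 1) * enn2real (mass \<nu>))"
    using mm by (simp add: cut_0)
  finally show ?thesis unfolding eq .
qed

section \<open>A singular Volterra inequality\<close>

text \<open>Young's inequality for the convolution with \<open>r\<^bsup>-1/2\<^esup> = (r\<^bsup>-1/6\<^esup>)\<^sup>3\<close> maps L^2 to L^4 with a norm that
  tends to 0 with the length of the time interval; this gives uniqueness step by step.\<close>

lemma nn_integral_young4: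
  fixes l H :: "real \<Rightarrow> ennreal"
  assumes [measurable]: "l \<in> borel_measurable borel" "H \<in> borel_measurable borel"
  shows "(\<integral>\<^sup>+t. (\<integral>\<^sup>+s. l (t - s) ^ 3 * H s \<partial>lborel) ^ 4 \<partial>lborel)
     \<le> (\<integral>\<^sup>+r. l r ^ 4 \<partial>lborel) ^ 3 * (\<integral>\<^sup>+s. H s ^ 2 \<partial>lborel) ^ 2"
proof -
  define L where "L = (\<integral>\<^sup>+r. l r ^ 4 \<partial>lborel)"
  define J where "J = (\<integral>\<^sup>+s. H s ^ 2 \<partial>lborel)"
  define N where "N t = (\<integral>\<^sup>+s. l (t - s) ^ 4 * H s ^ 2 \<partial>lborel)" for t
  have Lt: "(\<integral>\<^sup>+s. l (t - s) ^ 4 \<partial>lborel) = L" for t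
    unfolding L_def by (rule nn_integral_lborel_reflect) simp
  \<comment> \<open>Cauchy-Schwarz twice: l^3 H = l^2 (l H), then l^2 H^2 = (l^2 H) H. A single
    factor, N t, still depends on t.\<close>
  have pt: "(\<integral>\<^sup>+s. l (t - s) ^ 3 * H s \<partial>lborel) ^ 4 \<le> L\<^sup>2 * J * N t" for t
  proof -
    define I where "I = (\<integral>\<^sup>+s. l (t - s) ^ 3 * H s \<partial>lborel)"
    define K where "K = (\<integral>\<^sup>+s. l (t - s) ^ 2 * H s ^ 2 \<partial>lborel)"
    have 1: "I\<^sup>2 \<le> L * K"
      using Cauchy_Schwarz_nn_integral[of "\<lambda>s. l (t - s) ^ 2" lborel "\<lambda>s. l (t - s) * H s"]
      by (simp add: I_def K_def Lt power_mult_distrib mult.assoc[symmetric] flip: power_mult power_Suc2)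
    have 2: "K\<^sup>2 \<le> N t * J"
    proof -
      have "l x ^ 2 * y * y = l x ^ 2 * y ^ 2" "(l x ^ 2 * y) ^ 2 = l x ^ 4 * y ^ 2" for x y
        by (simp_all add: power_mult_distrib power2_eq_square[of y] mult.assoc flip: power_mult)
      then show ?thesis
        using Cauchy_Schwarz_nn_integral[of "\<lambda>s. l (t - s) ^ 2 * H s" lborel H]
        by (simp add: N_def K_def J_def)
    qed
    have "I ^ 4 = (I\<^sup>2)\<^sup>2" by (simp flip: power_mult)
    also have "\<dots> \<le> (L * K)\<^sup>2" by (intro power_mono 1) simp
    also have "\<dots> = L\<^sup>2 * K\<^sup>2" by (simp add: power_mult_distrib)
    also have "\<dots> \<le> L\<^sup>2 * (N t * J)" by (intro mult_left_mono 2) simp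
    finally show ?thesis by (simp add: I_def mult_ac)
  qed
  \<comment> \<open>Tonelli and translation invariance separate the convolution of l^4 with
    H^2.\<close>
  have NL: "(\<integral>\<^sup>+t. N t \<partial>lborel) = L * J"
  proof -
    have "(\<integral>\<^sup>+t. N t \<partial>lborel) = (\<integral>\<^sup>+s. \<integral>\<^sup>+t. l (t - s) ^ 4 * H s ^ 2 \<partial>lborel \<partial>lborel)"
      unfolding N_def by (rule nn_integral_swap) measurable
    also have "\<dots> = (\<integral>\<^sup>+s. L * H s ^ 2 \<partial>lborel)"
      unfolding L_def
      by (intro nn_integral_cong, subst nn_integral_multc) (auto intro!: arg_cong2[where f = "(*)"] nn_integral_lborel_translate)
    also have "\<dots> = L * J" unfolding J_def by (rule nn_integral_cmult) simp
    finally show ?thesis .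
  qed
  have [measurable]: "N \<in> borel_measurable borel"
    unfolding N_def by (rule lborel.borel_measurable_nn_integral) simp
  have "(\<integral>\<^sup>+t. (\<integral>\<^sup>+s. l (t - s) ^ 3 * H s \<partial>lborel) ^ 4 \<partial>lborel) \<le> (\<integral>\<^sup>+t. L\<^sup>2 * J * N t \<partial>lborel)"
    by (intro nn_integral_mono pt)
  also have "\<dots> = L\<^sup>2 * J * (L * J)" by (simp add: nn_integral_cmult NL)
  also have "\<dots> = L ^ 3 * J\<^sup>2" by (simp add: power2_eq_square power3_eq_cube mult_ac)
  finally show ?thesis by (simp add: L_def J_def)
qed

text \<open>If P vanishes before a, only elapsed times below h matter on (a, a + h), and there the
  estimate reads q \<le> K h q with q the integral of P^4. The step h depends on the constants alone
  and not on a, so multiples of h reach every time.\<close>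

lemma volterra_zero:
  fixes P b :: "real \<Rightarrow> ennreal"
  defines "l \<equiv> \<lambda>r. ennreal (r powr (- (1/6))) * indicator {0..1} r"
  assumes [measurable]: "P \<in> borel_measurable borel" "b \<in> borel_measurable borel"
    and P0: "\<And>t. t \<le> 0 \<Longrightarrow> P t = 0"
    and le: "AE t in lborel. P t \<le> C * (\<integral>\<^sup>+s. l (t - s) ^ 3 * (b s * P s) \<partial>lborel)"
    and fin: "C < \<infinity>" "(\<integral>\<^sup>+t. P t ^ 4 \<partial>lborel) < \<infinity>" "(\<integral>\<^sup>+t. b t ^ 4 \<partial>lborel) < \<infinity>"
  shows "AE t in lborel. P t = 0"
proof -
  define B where "B = (\<integral>\<^sup>+t. b t ^ 4 \<partial>lborel)"
  obtain K where K: "C ^ 4 * 27 * B = ennreal K" "0 \<le> K"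
  proof -
    have "C ^ 4 * 27 * B < \<infinity>" using fin by (simp add: B_def ennreal_mult_less_top power_less_top_ennreal)
    then show ?thesis using that by (cases "C ^ 4 * 27 * B") auto
  qed
  \<comment> \<open>This choice gives K h < 1, the contraction constant of one step.\<close>
  define h where "h = 1 / (K + 1)"
  have h: "0 < h" "h \<le> 1" "K * h < 1" using K(2) by (auto simp: h_def field_simps)
  define lh where "lh r = ennreal (r powr (- (1/6))) * indicator {0..h} r" for r
  have [measurable]: "lh \<in> borel_measurable borel" "l \<in> borel_measurable borel"
    unfolding lh_def[abs_def] l_def by measurable
  have "lh r ^ 4 = ennreal (r powr (- (2/3))) * indicator {0..h} r" for r
    by (auto simp: lh_def ennreal_power powr_power_pos split: split_indicator)
  then have Lh: "(\<integral>\<^sup>+r. lh r ^ 4 \<partial>lborel) = ennreal (3 * h powr (1/3))"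
    using nn_integral_powr_near_0[of h] h by simp
  \<comment> \<open>The cube of 3 h^(1/3); hence the 27 in the choice of K.\<close>
  have Lh3: "(\<integral>\<^sup>+r. lh r ^ 4 \<partial>lborel) ^ 3 = ennreal (27 * h)"
    unfolding Lh using h by (simp add: ennreal_power power_mult_distrib powr_power_pos)
  have step: "AE t in lborel. t < a + h \<longrightarrow> P t = 0" if a: "AE t in lborel. t < a \<longrightarrow> P t = 0" for a
  proof -
    define Q where "Q t = P t * indicator {..<a + h} t" for t
    have [measurable]: "Q \<in> borel_measurable borel" unfolding Q_def[abs_def] by measurable
    have "AE t in lborel. Q t \<le> C * (\<integral>\<^sup>+s. lh (t - s) ^ 3 * (b s * Q s) \<partial>lborel)"
      using le
    proof eventually_elim
      case (elim t)
      show ?case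
      proof (cases "t < a + h")
        case True
        have "(\<integral>\<^sup>+s. l (t - s) ^ 3 * (b s * P s) \<partial>lborel) \<le> (\<integral>\<^sup>+s. lh (t - s) ^ 3 * (b s * Q s) \<partial>lborel)"
        proof (rule nn_integral_mono_AE)
          \<comment> \<open>For s < a the factor P vanishes, for s > t the kernel does, and in
            between t - s < h.\<close>
          show "AE s in lborel. l (t - s) ^ 3 * (b s * P s) \<le> lh (t - s) ^ 3 * (b s * Q s)"
            using a
          proof eventually_elim
            case (elim s)
            show ?case using elim True h
              by (cases "s < a"; cases "s \<le> t") (auto simp: l_def lh_def Q_def split: split_indicator)
          qed
        qed
        then have "C * (\<integral>\<^sup>+s. l (t - s) ^ 3 * (b s * P s) \<partial>lborel) \<le> C * (\<integral>\<^sup>+s. lh (t - s) ^ 3 * (b s * Q s) \<partial>lborel)"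
          by (rule mult_left_mono) simp
        with elim True show ?thesis by (simp add: Q_def)
      qed (simp add: Q_def)
    qed
    then have "(\<integral>\<^sup>+t. Q t ^ 4 \<partial>lborel) \<le> (\<integral>\<^sup>+t. (C * (\<integral>\<^sup>+s. lh (t - s) ^ 3 * (b s * Q s) \<partial>lborel)) ^ 4 \<partial>lborel)"
      by (intro nn_integral_mono_AE) (auto elim!: eventually_mono intro!: power_mono)
    also have "\<dots> = C ^ 4 * (\<integral>\<^sup>+t. (\<integral>\<^sup>+s. lh (t - s) ^ 3 * (b s * Q s) \<partial>lborel) ^ 4 \<partial>lborel)"
      unfolding power_mult_distrib by (rule nn_integral_cmult) measurable
    also have "\<dots> \<le> C ^ 4 * (ennreal (27 * h) * (\<integral>\<^sup>+s. (b s * Q s) ^ 2 \<partial>lborel) ^ 2)"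
      unfolding Lh3[symmetric] by (intro mult_left_mono nn_integral_young4) auto
    also have "\<dots> \<le> C ^ 4 * (ennreal (27 * h) * (B * (\<integral>\<^sup>+t. Q t ^ 4 \<partial>lborel)))"
      using Cauchy_Schwarz_nn_integral[of "\<lambda>s. b s ^ 2" lborel "\<lambda>s. Q s ^ 2"]
      by (intro mult_left_mono) (auto simp: B_def power_mult_distrib simp flip: power_mult)
    also have "\<dots> = ennreal (K * h) * (\<integral>\<^sup>+t. Q t ^ 4 \<partial>lborel)"
      using h K by (simp add: ennreal_mult K(1)[symmetric] mult_ac)
    finally have le4: "(\<integral>\<^sup>+t. Q t ^ 4 \<partial>lborel) \<le> ennreal (K * h) * (\<integral>\<^sup>+t. Q t ^ 4 \<partial>lborel)" .
    have "(\<integral>\<^sup>+t. Q t ^ 4 \<partial>lborel) \<le> (\<integral>\<^sup>+t. P t ^ 4 \<partial>lborel)"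
      by (intro nn_integral_mono) (auto simp: Q_def split: split_indicator)
    then have "(\<integral>\<^sup>+t. Q t ^ 4 \<partial>lborel) < \<infinity>" using fin(2) by (rule le_less_trans)
    \<comment> \<open>Finiteness of the fourth-power integral is what permits cancelling q
      below.\<close>
    then obtain q where q: "(\<integral>\<^sup>+t. Q t ^ 4 \<partial>lborel) = ennreal q" "0 \<le> q"
      by (cases "\<integral>\<^sup>+t. Q t ^ 4 \<partial>lborel") auto
    from le4 have "q \<le> K * h * q" using K h q by (simp add: ennreal_mult[symmetric])
    then have "q * (1 - K * h) \<le> 0" by (simp add: algebra_simps)
    with h q have "q = 0" by (simp add: mult_le_0_iff)
    with q have "(\<integral>\<^sup>+t. Q t ^ 4 \<partial>lborel) = 0" by simp
    then have "AE t in lborel. Q t = 0" by (subst (asm) nn_integral_0_iff_AE) auto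
    then show ?thesis by eventually_elim (auto simp: Q_def)
  qed
  have "AE t in lborel. t < real n * h \<longrightarrow> P t = 0" for n :: nat
  proof (induction n)
    case 0
    show ?case using P0 by auto
  next
    case (Suc n)
    from step[OF this] show ?case by (simp add: distrib_right add.commute)
  qed
  then have "AE t in lborel. \<forall>n::nat. t < real n * h \<longrightarrow> P t = 0" unfolding AE_all_countable by blast
  then show ?thesis
  proof eventually_elim
    case (elim t)
    obtain n :: nat where "t / h < real n" using reals_Archimedean2 by blast
    then have "t < real n * h" using h by (simp add: field_simps)
    with elim show ?case by blast
  qed
qed

section \<open>From the weak to the mild formulation\<close>

lemma measurable_pair_compose:
  fixes f :: "'a::euclidean_space \<Rightarrow> 'c::topological_space"
  assumes "f \<in> borel_measurable borel"
  shows "(\<lambda>p::'a \<times> 'b::euclidean_space. f (fst p)) \<in> borel_measurable borel"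
    "(\<lambda>p::'b \<times> 'a. f (snd p)) \<in> borel_measurable borel"
    "(\<lambda>p::'a \<times> 'a. f (fst p - snd p)) \<in> borel_measurable borel"
    "(\<lambda>p::'a \<times> 'a. f (snd p - fst p)) \<in> borel_measurable borel"
  by (intro measurable_compose[OF borel_measurable_continuous_onI assms] continuous_intros)+

text \<open>Boxes generate the Borel sets and are stable under intersection, so a Dynkin argument
  extends the vanishing to all Borel sets. Restricting f first to a large box makes it integrable on
  the whole space, which the complement step needs.\<close>

lemma AE_zero_if_box_integrals_zero:
  fixes f :: "'a::euclidean_space \<Rightarrow> real"
  assumes int: "\<And>a b. integrable lborel (\<lambda>x. indicator (box a b) x * f x)"
    and zero: "\<And>a b. (\<integral>x. indicator (box a b) x * f x \<partial>lborel) = 0"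
  shows "AE x in lborel. f x = 0"
proof -
  have "AE x in lborel. x \<in> box (- (real n *\<^sub>R One)) (real n *\<^sub>R One) \<longrightarrow> f x = 0" for n :: nat
  proof -
    define B :: "'a set" where "B = box (- (real n *\<^sub>R One)) (real n *\<^sub>R One)"
    define g where "g x = indicator B x * f x" for x
    have gi: "integrable lborel g" unfolding g_def B_def by (rule int)
    have gS: "set_integrable lborel A g" if "A \<in> sets borel" for A
      using integrable_mult_indicator[OF _ gi, of A] that by (simp add: set_integrable_def)
    have "(LINT x:A|lborel. g x) = 0" if A: "A \<in> sigma_sets UNIV (range (\<lambda>(a, b). box a b))" for A :: "'a set"
    proof -
      have Int: "Int_stable (range (\<lambda>(a, b :: 'a). box a b))"
        by (auto simp: Int_stable_def box_Int_box)
      have sub: "range (\<lambda>(a, b :: 'a). box a b) \<subseteq> Pow UNIV" by simp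
      show ?thesis using Int sub A
      proof (induction rule: sigma_sets_induct_disjoint)
        case (basic A)
        then obtain a b where A: "A = box a b" by auto
        obtain c d where cd: "A \<inter> B = box c d" unfolding A B_def box_Int_box by blast
        have "(LINT x:A|lborel. g x) = (\<integral>x. indicator (box c d) x * f x \<partial>lborel)"
          unfolding set_lebesgue_integral_def g_def cd[symmetric] by (simp add: indicator_inter_arith mult.assoc)
        then show ?case using zero by simp
      next
        case empty
        show ?case by (simp add: set_lebesgue_integral_def)
      next
        case (compl A)
        have As: "A \<in> sets borel" using compl unfolding borel_eq_box by simp
        have "(\<integral>x. g x \<partial>lborel) = (LINT x:A|lborel. g x) + (LINT x:(UNIV - A)|lborel. g x)"
          using set_integral_Un[of A "UNIV - A" lborel g] gS As
          by (simp add: set_lebesgue_integral_def[of _ UNIV])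
        moreover have "(\<integral>x. g x \<partial>lborel) = 0" unfolding g_def B_def by (rule zero)
        ultimately show ?case using compl by simp
      next
        case (union A)
        have As: "A i \<in> sets borel" for i using union unfolding borel_eq_box by auto
        have "(LINT x:(\<Union>i. A i)|lborel. g x) = (\<Sum>i. LINT x:A i|lborel. g x)"
          using As union(1) by (intro lebesgue_integral_countable_add gS) (auto simp: disjoint_family_on_def)
        then show ?case using union by simp
      qed
    qed
    then have "(LINT x:A|lborel. g x) = 0" if "A \<in> sets lborel" for A
      using that unfolding sets_lborel borel_eq_box by simp
    with gi have "AE x in lborel. g x = 0"
      using density_unique_real[of lborel g "\<lambda>_. 0"] by (simp add: set_lebesgue_integral_def)
    then show ?thesis unfolding B_def[symmetric] by eventually_elim (auto simp: g_def)
  qed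
  then have "AE x in lborel. \<forall>n::nat. x \<in> box (- (real n *\<^sub>R One)) (real n *\<^sub>R One) \<longrightarrow> f x = 0"
    unfolding AE_all_countable by blast
  then show ?thesis
  proof eventually_elim
    case (elim x)
    have "x \<in> (\<Union>n::nat. box (- (real n *\<^sub>R One)) (real n *\<^sub>R One))" by (subst UN_box_eq_UNIV) simp
    with elim show ?case by blast
  qed
qed

lemma isCont_indicator_off_frontier:
  fixes Q :: "'a::euclidean_space set"
  assumes "open Q" "z \<notin> frontier Q"
  shows "isCont (indicator Q :: 'a \<Rightarrow> real) z"
  using assms by (simp add: isCont_indicator)

lemma AE_not_in_frontier_convex:
  fixes Q :: "'a::euclidean_space set"
  assumes "convex Q"
  shows "AE z in lborel. z \<notin> frontier Q"
proof -
  have "frontier Q \<in> null_sets lebesgue"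
    using negligible_convex_frontier[OF assms] by (simp add: negligible_iff_null_sets)
  then have "frontier Q \<in> null_sets lborel"
    by (simp add: null_sets_completion_iff)
  then show ?thesis by (rule AE_not_in)
qed

lemma hkbound_support: "hkbound \<nu> (fst z) (snd z) \<noteq> 0 \<Longrightarrow> norm z \<le> 2"
  using norm_Pair_le[of "fst z" "snd z"] by (auto simp: hkbound_def split: if_splits)

lemma mollker_support: "mollker \<nu> \<delta> z \<noteq> 0 \<Longrightarrow> norm z \<le> 2"
  using cut_eq_0[of z] by (auto simp: mollker_def) (meson cut_eq_0 dual_order.trans linorder_not_le one_le_numeral order_less_imp_le)

text \<open>With z0 confined to Q and the kernel supported within distance 2, only the values of h
  on a slightly larger ball are seen. Local integrability of h thus suffices for Fubini on the
  product space.\<close>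

lemma nn_integral_conv_bounded:
  fixes h k :: "spt \<Rightarrow> ennreal"
  assumes [measurable]: "h \<in> borel_measurable borel" "k \<in> borel_measurable borel"
    and Q: "Q \<in> sets borel" "Q \<subseteq> cball 0 R" and supp: "\<And>z. k z \<noteq> 0 \<Longrightarrow> norm z \<le> 2"
  shows "(\<integral>\<^sup>+p. indicator Q (fst p) * (h (snd p) * k (fst p - snd p)) \<partial>lborel)
    \<le> (\<integral>\<^sup>+z. h z * indicator (cball 0 (R + 2)) z \<partial>lborel) * (\<integral>\<^sup>+z. k z \<partial>lborel)"
proof -
  have [measurable]: "cball (0::spt) (R + 2) \<in> sets borel" by simp
  have m[measurable]: "(\<lambda>p. indicator Q (fst p) * (h (snd p) * k (fst p - snd p))) \<in> borel_measurable borel"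
    using Q(1) by (intro borel_measurable_times_ennreal measurable_pair_compose assms borel_measurable_indicator)
  have "(\<integral>\<^sup>+p. indicator Q (fst p) * (h (snd p) * k (fst p - snd p)) \<partial>lborel)
     = (\<integral>\<^sup>+z0. \<integral>\<^sup>+z. indicator Q z0 * (h z * k (z0 - z)) \<partial>lborel \<partial>lborel)"
    by (subst nn_integral_lborel_pair) (use m in simp_all)
  also have "\<dots> = (\<integral>\<^sup>+z. \<integral>\<^sup>+z0. indicator Q z0 * (h z * k (z0 - z)) \<partial>lborel \<partial>lborel)"
    by (rule nn_integral_swap) (use m in simp)
  also have "\<dots> \<le> (\<integral>\<^sup>+z. \<integral>\<^sup>+z0. (h z * indicator (cball 0 (R + 2)) z) * k (z0 - z) \<partial>lborel \<partial>lborel)"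
  proof (intro nn_integral_mono)
    fix z z0
    show "indicator Q z0 * (h z * k (z0 - z)) \<le> (h z * indicator (cball 0 (R + 2)) z) * k (z0 - z)"
    proof (cases "z0 \<in> Q \<and> k (z0 - z) \<noteq> 0")
      case True
      then have "norm z0 \<le> R" "norm (z0 - z) \<le> 2" using Q supp by auto
      then have "norm z \<le> R + 2" using norm_triangle_ineq4[of z0 "z0 - z"] by simp
      then show ?thesis using True by (simp add: indicator_def)
    qed (auto simp: indicator_def)
  qed
  also have "\<dots> = (\<integral>\<^sup>+z. (h z * indicator (cball 0 (R + 2)) z) * (\<integral>\<^sup>+z. k z \<partial>lborel) \<partial>lborel)"
    by (intro nn_integral_cong, subst nn_integral_cmult) (auto simp: nn_integral_lborel_translate)
  also have "\<dots> = (\<integral>\<^sup>+z. h z * indicator (cball 0 (R + 2)) z \<partial>lborel) * (\<integral>\<^sup>+z. k z \<partial>lborel)"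
    by (rule nn_integral_multc) measurable
  finally show ?thesis .
qed

text \<open>The pointwise limit of the mollified W is never examined. The identity is integrated
  over z0 in a box, Fubini transfers the mollifier to the indicator of the box, and that mollified
  indicator converges off the frontier.\<close>

lemma weak_to_mild:
  assumes \<nu>: "0 < \<nu>"
    and W[measurable]: "W \<in> borel_measurable borel" and F[measurable]: "F \<in> borel_measurable borel"
    and loc: "\<And>R. (\<integral>\<^sup>+z. ennreal (\<bar>W z\<bar> + norm (F z)) * indicator (cball 0 R) z \<partial>lborel) < \<infinity>"
    and weak: "\<And>\<delta> z0. 0 < \<delta> \<Longrightarrow> fst z0 < T \<Longrightarrow>
      (\<integral>z. W z * (mollker \<nu> \<delta> (z0 - z) + errker \<nu> \<delta> (z0 - z)) + F z \<bullet> gradker \<nu> \<delta> (z0 - z) \<partial>lborel) = 0"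
  shows "AE z0 in lborel. fst z0 < T \<longrightarrow>
    W z0 * (exp (- 1) * enn2real (mass \<nu>)) = - (\<integral>z. W z * errker \<nu> 0 (z0 - z) + F z \<bullet> gradker \<nu> 0 (z0 - z) \<partial>lborel)"
proof -
  define c where "c = exp (- 1) * enn2real (mass \<nu>)"
  define h where "h z = \<bar>W z\<bar> + norm (F z)" for z
  have h[measurable]: "h \<in> borel_measurable borel" unfolding h_def[abs_def] by measurable
  have hW: "\<bar>W z\<bar> \<le> h z" "norm (F z) \<le> h z" "0 \<le> h z" for z by (auto simp: h_def)
  obtain C where C: "0 \<le> C" "\<And>\<delta> z. 0 \<le> \<delta> \<Longrightarrow> \<bar>errker \<nu> \<delta> z\<bar> \<le> C * hkbound \<nu> (fst z) (snd z)"
      "\<And>\<delta> z. 0 \<le> \<delta> \<Longrightarrow> norm (gradker \<nu> \<delta> z) \<le> C * hkbound \<nu> (fst z) (snd z)"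
    using kernels_le_hkbound[OF \<nu>] by blast
  define e :: "nat \<Rightarrow> real" where "e n = inverse (real (Suc n))" for n
  have e: "e \<longlonglongrightarrow> 0" "\<And>n. 0 < e n" unfolding e_def using LIMSEQ_inverse_real_of_nat by auto
  \<comment> \<open>Regularisation parameters are squares because the parabolic scaling uses lengths
    e with \<delta> = e^2.\<close>
  define d where "d n = (e n)\<^sup>2" for n
  have d: "d \<longlonglongrightarrow> 0" "\<And>n. 0 < d n"
    using tendsto_power[OF e(1), of 2] zero_less_power[OF e(2), of _ 2] unfolding d_def[abs_def] by (simp, blast)
  define J where "J \<delta> p = W (snd p) * errker \<nu> \<delta> (fst p - snd p) + F (snd p) \<bullet> gradker \<nu> \<delta> (fst p - snd p)" for \<delta> p
  have J[measurable]: "J \<delta> \<in> borel_measurable borel" for \<delta>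
    unfolding J_def[abs_def]
    by (intro borel_measurable_add borel_measurable_times borel_measurable_inner measurable_pair_compose W F measurable_kernels)
  have Jle: "\<bar>J \<delta> p\<bar> \<le> 2 * C * (h (snd p) * hkbound \<nu> (fst (fst p - snd p)) (snd (fst p - snd p)))" if "0 \<le> \<delta>" for \<delta> p
  proof -
    let ?k = "hkbound \<nu> (fst (fst p - snd p)) (snd (fst p - snd p))"
    have "\<bar>W (snd p) * errker \<nu> \<delta> (fst p - snd p)\<bar> \<le> h (snd p) * (C * ?k)"
      unfolding abs_mult by (intro mult_mono hW C that) auto
    moreover have "\<bar>F (snd p) \<bullet> gradker \<nu> \<delta> (fst p - snd p)\<bar> \<le> h (snd p) * (C * ?k)"
      by (rule order_trans[OF Cauchy_Schwarz_ineq2]) (intro mult_mono hW C that, auto)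
    ultimately show ?thesis unfolding J_def by (simp add: mult_ac)
  qed
  define v where "v z0 = (\<integral>z. J 0 (z0, z) \<partial>lborel)" for z0
  \<comment> \<open>The half-space keeps z0 where the weak identity is available. The intersection
    is convex, so its frontier is null.\<close>
  have main: "integrable lborel (\<lambda>z. indicator Q z * (W z * c + v z)) \<and> (\<integral>z. indicator Q z * (W z * c + v z) \<partial>lborel) = 0"
    if Q_def: "Q = box a b \<inter> {z. fst z < T}" for Q a b
  proof -
    have "open Q" unfolding Q_def by (intro open_Int open_box open_Collect_less continuous_intros)
    have Qs[measurable]: "Q \<in> sets borel" using \<open>open Q\<close> by simp
    have "convex {z::spt. fst z < T}"
    proof -
      have "{z::spt. fst z < T} = {z. (1,0,0) \<bullet> z < T}" by (auto simp: inner_prod_def)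
      then show ?thesis by (simp add: convex_halfspace_lt)
    qed
    then have "convex Q" unfolding Q_def by (intro convex_Int convex_box)
    have "bounded Q" unfolding Q_def by (meson bounded_box bounded_Int)
    then obtain R where R: "Q \<subseteq> cball 0 R" unfolding bounded_def by (auto simp: subset_eq bounded_iff dist_norm) (metis \<open>bounded Q\<close> bounded_iff)
    define g where "g = (indicator Q :: spt \<Rightarrow> real)"
    have [measurable]: "cball (0::spt) (R + 2) \<in> sets borel" by simp
    have g[measurable]: "g \<in> borel_measurable borel" unfolding g_def by measurable
    have hfin: "(\<integral>\<^sup>+z. ennreal (h z) * indicator (cball 0 R') z \<partial>lborel) < \<infinity>" for R'
      using loc[of R'] by (simp add: h_def)
    \<comment> \<open>A majorant on the product space, independent of \<delta>, for the error and
      gradient terms.\<close>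
    define D where "D p = g (fst p) * (2 * C * (h (snd p) * hkbound \<nu> (fst (fst p - snd p)) (snd (fst p - snd p))))" for p
    have kbm: "(\<lambda>p::spt\<times>spt. hkbound \<nu> (fst (fst p - snd p)) (snd (fst p - snd p))) \<in> borel_measurable borel"
      using measurable_pair_compose(3)[OF measurable_hkbound] by simp
    have Dm[measurable]: "D \<in> borel_measurable borel"
      unfolding D_def[abs_def] by (intro borel_measurable_times borel_measurable_const measurable_pair_compose g h kbm)
    have Di: "integrable lborel D"
    proof (rule integrableI_bounded)
      have "(\<integral>\<^sup>+p. ennreal (norm (D p)) \<partial>lborel) = (\<integral>\<^sup>+p. ennreal (2 * C) * (indicator Q (fst p) * (ennreal (h (snd p)) * ennreal (hkbound \<nu> (fst (fst p - snd p)) (snd (fst p - snd p))))) \<partial>lborel)"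
        using C(1) hW(3) by (intro nn_integral_cong) (auto simp: D_def g_def ennreal_mult abs_mult split: split_indicator)
      also have "\<dots> = ennreal (2 * C) * (\<integral>\<^sup>+p. indicator Q (fst p) * (ennreal (h (snd p)) * ennreal (hkbound \<nu> (fst (fst p - snd p)) (snd (fst p - snd p)))) \<partial>lborel)"
        by (rule nn_integral_cmult)
           (use measurable_pair_compose(1)[of "indicator Q :: spt \<Rightarrow> ennreal"] measurable_pair_compose(2)[of "\<lambda>z. ennreal (h z)"]
             measurable_compose[OF kbm measurable_ennreal] in \<open>auto intro!: borel_measurable_times_ennreal\<close>)
      also have "\<dots> \<le> ennreal (2 * C) * ((\<integral>\<^sup>+z. ennreal (h z) * indicator (cball 0 (R + 2)) z \<partial>lborel) * (\<integral>\<^sup>+z. ennreal (hkbound \<nu> (fst z) (snd z)) \<partial>lborel))"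
        by (intro mult_left_mono nn_integral_conv_bounded[where k = "\<lambda>z. ennreal (hkbound \<nu> (fst z) (snd z))"] R Qs)
           (use hkbound_support[of \<nu>] in auto)
      also have "\<dots> < \<infinity>" using hfin nn_integral_hkbound_finite[OF \<nu>] by (simp add: ennreal_mult_less_top)
      finally show "(\<integral>\<^sup>+p. ennreal (norm (D p)) \<partial>lborel) < \<infinity>" .
    qed measurable
    have JD: "norm (g (fst p) * J \<delta> p) \<le> D p" if "0 \<le> \<delta>" for \<delta> p
      using Jle[OF that, of p] by (auto simp: g_def D_def abs_mult split: split_indicator)
    have gJm[measurable]: "(\<lambda>p. g (fst p) * J \<delta> p) \<in> borel_measurable borel" for \<delta>
      by (intro borel_measurable_times measurable_pair_compose g J)
    have gJi: "integrable lborel (\<lambda>p. g (fst p) * J \<delta> p)" if "0 \<le> \<delta>" for \<delta>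
    proof (rule Bochner_Integration.integrable_bound[OF Di])
      show "AE p in lborel. norm (g (fst p) * J \<delta> p) \<le> norm (D p)"
        using order_trans[OF JD[OF that] abs_ge_self] by (intro AE_I2) simp
    qed measurable
    have lim2: "(\<lambda>n. \<integral>p. g (fst p) * J (d n) p \<partial>lborel) \<longlonglongrightarrow> (\<integral>p. g (fst p) * J 0 p \<partial>lborel)"
    proof (rule integral_dominated_convergence[where w = D])
      show "AE p in lborel. (\<lambda>n. g (fst p) * J (d n) p) \<longlonglongrightarrow> g (fst p) * J 0 p"
        unfolding J_def by (intro AE_I2 tendsto_intros kernels_tendsto d)
      show "AE p in lborel. norm (g (fst p) * J (d n) p) \<le> D p" for n
        by (intro AE_I2 JD less_imp_le d)
    qed (use Di in auto)
    define X where "X n p = g (fst p) * (W (snd p) * mollker \<nu> (d n) (fst p - snd p))" for n p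
    have Xm[measurable]: "X n \<in> borel_measurable borel" for n
      unfolding X_def[abs_def] by (intro borel_measurable_times measurable_pair_compose g W measurable_kernels)
    have Xi: "integrable lborel (X n)" for n
    proof (rule integrableI_bounded)
      have "(\<integral>\<^sup>+p. ennreal (norm (X n p)) \<partial>lborel) \<le> (\<integral>\<^sup>+p. indicator Q (fst p) * (ennreal (h (snd p)) * ennreal (mollker \<nu> (d n) (fst p - snd p))) \<partial>lborel)"
        using hW(1) mollker_nonneg[OF less_imp_le[OF d(2)], of \<nu>]
        by (intro nn_integral_mono) (auto simp: X_def g_def ennreal_mult[symmetric] hW abs_mult split: split_indicator intro!: ennreal_leI mult_right_mono)
      also have "\<dots> \<le> (\<integral>\<^sup>+z. ennreal (h z) * indicator (cball 0 (R + 2)) z \<partial>lborel) * (\<integral>\<^sup>+z. ennreal (mollker \<nu> (d n) z) \<partial>lborel)"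
      proof (intro nn_integral_conv_bounded[where k = "\<lambda>z. ennreal (mollker \<nu> (d n) z)"] R Qs)
        show "norm z \<le> 2" if "ennreal (mollker \<nu> (d n) z) \<noteq> 0" for z
          using that mollker_support[of \<nu> "d n" z] ennreal_0 by metis
      qed measurable
      also have "\<dots> < \<infinity>"
        using hfin le_less_trans[OF nn_integral_mollker_le[OF e(2)[of n]] mass_finite[OF \<nu>]] by (simp add: ennreal_mult_less_top d_def)
      finally show "(\<integral>\<^sup>+p. ennreal (norm (X n p)) \<partial>lborel) < \<infinity>" .
    qed measurable
    have fub1: "(\<integral>p. f p \<partial>lborel) = (\<integral>z0. \<integral>z. f (z0, z) \<partial>lborel \<partial>lborel)" and fub2: "(\<integral>p. f p \<partial>lborel) = (\<integral>z. \<integral>z0. f (z0, z) \<partial>lborel \<partial>lborel)"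
      and fubi: "integrable lborel (\<lambda>z0. \<integral>z. f (z0, z) \<partial>lborel)"
      if "integrable lborel f" for f :: "spt \<times> spt \<Rightarrow> real"
    proof -
      have i: "integrable (lborel \<Otimes>\<^sub>M lborel) f" using that by (simp add: lborel_prod)
      show "(\<integral>p. f p \<partial>lborel) = (\<integral>z0. \<integral>z. f (z0, z) \<partial>lborel \<partial>lborel)"
        using lborel_pair.integral_fst'[OF i] by (simp add: lborel_prod)
      show "(\<integral>p. f p \<partial>lborel) = (\<integral>z. \<integral>z0. f (z0, z) \<partial>lborel \<partial>lborel)"
        using lborel_pair.integral_snd[of "\<lambda>x y. f (x, y)"] i by (simp add: lborel_prod)
      show "integrable lborel (\<lambda>z0. \<integral>z. f (z0, z) \<partial>lborel)"
        by (rule lborel_pair.integrable_fst'[OF i])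
    qed
    \<comment> \<open>The weak identity, integrated over the centres z0 in Q.\<close>
    have sum0: "(\<integral>p. X n p \<partial>lborel) = - (\<integral>p. g (fst p) * J (d n) p \<partial>lborel)" for n
    proof -
      have i: "integrable lborel (\<lambda>p. X n p + g (fst p) * J (d n) p)"
        by (intro Bochner_Integration.integrable_add Xi gJi less_imp_le d)
      have "(\<integral>p. X n p \<partial>lborel) + (\<integral>p. g (fst p) * J (d n) p \<partial>lborel) = (\<integral>p. X n p + g (fst p) * J (d n) p \<partial>lborel)"
        by (rule Bochner_Integration.integral_add[symmetric]) (intro Xi gJi less_imp_le d)+
      also have "\<dots> = (\<integral>z0. \<integral>z. X n (z0, z) + g z0 * J (d n) (z0, z) \<partial>lborel \<partial>lborel)"
        using fub1[OF i] by simp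
      also have "\<dots> = (\<integral>(z0::spt). 0 \<partial>lborel)"
      proof (intro Bochner_Integration.integral_cong refl)
        fix z0
        have "(\<integral>z. X n (z0, z) + g z0 * J (d n) (z0, z) \<partial>lborel)
          = (\<integral>z. g z0 * (W z * (mollker \<nu> (d n) (z0 - z) + errker \<nu> (d n) (z0 - z)) + F z \<bullet> gradker \<nu> (d n) (z0 - z)) \<partial>lborel)"
          by (intro Bochner_Integration.integral_cong refl) (simp add: X_def J_def algebra_simps)
        also have "\<dots> = g z0 * (\<integral>z. W z * (mollker \<nu> (d n) (z0 - z) + errker \<nu> (d n) (z0 - z)) + F z \<bullet> gradker \<nu> (d n) (z0 - z) \<partial>lborel)"
          by (rule integral_mult_right_zero)
        also have "\<dots> = 0" using weak[OF d(2), of z0 n] by (auto simp: g_def Q_def split: split_indicator)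
        finally show "(\<integral>z. X n (z0, z) + g z0 * J (d n) (z0, z) \<partial>lborel) = 0" .
      qed
      finally show ?thesis by simp
    qed
    \<comment> \<open>The transposed mollification of the indicator: z0 is now the integration
      variable.\<close>
    define Bn where "Bn n z = (\<integral>z0. g z0 * mollker \<nu> (d n) (z0 - z) \<partial>lborel)" for n z
    have XB: "(\<integral>p. X n p \<partial>lborel) = (\<integral>z. W z * Bn n z \<partial>lborel)" for n
    proof -
      have "(\<integral>z0. X n (z0, z) \<partial>lborel) = W z * Bn n z" for z
        unfolding Bn_def integral_mult_right_zero[symmetric] X_def by (simp add: mult_ac)
      then show ?thesis using fub2[OF Xi[of n]] by simp
    qed
    have hRi: "integrable lborel (\<lambda>z. h z * indicator (cball 0 (R + 2)) z)"
    proof (rule integrableI_bounded)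
      have "(\<integral>\<^sup>+z. ennreal (norm (h z * indicator (cball 0 (R + 2)) z)) \<partial>lborel) = (\<integral>\<^sup>+z. ennreal (h z) * indicator (cball 0 (R + 2)) z \<partial>lborel)"
        using hW(3) by (intro nn_integral_cong) (auto split: split_indicator)
      then show "(\<integral>\<^sup>+z. ennreal (norm (h z * indicator (cball 0 (R + 2)) z)) \<partial>lborel) < \<infinity>" using hfin by simp
    qed measurable
    have gWi: "integrable lborel (\<lambda>z. g z * (W z * c))"
    proof (rule Bochner_Integration.integrable_bound[OF integrable_mult_right[OF hRi, of c]])
      show "AE z in lborel. norm (g z * (W z * c)) \<le> norm (c * (h z * indicator (cball 0 (R + 2)) z))"
        using R hW by (intro AE_I2) (auto simp: g_def abs_mult mult.commute split: split_indicator intro!: mult_left_mono)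
    qed measurable
    \<comment> \<open>Dominated convergence with majorant h on a ball: each \<open>Bn n\<close> is
      at most the total mass and vanishes beyond distance 2 from Q.\<close>
    have lim1: "(\<lambda>n. \<integral>z. W z * Bn n z \<partial>lborel) \<longlonglongrightarrow> (\<integral>z. g z * (W z * c) \<partial>lborel)"
    proof (rule integral_dominated_convergence[where w = "\<lambda>z. enn2real (mass \<nu>) * (h z * indicator (cball 0 (R + 2)) z)"])
      show "integrable lborel (\<lambda>z. enn2real (mass \<nu>) * (h z * indicator (cball 0 (R + 2)) z))"
        by (intro integrable_mult_right hRi)
      show "AE z in lborel. (\<lambda>n. W z * Bn n z) \<longlonglongrightarrow> g z * (W z * c)"
        using AE_not_in_frontier_convex[OF \<open>convex Q\<close>]
      proof eventually_elim
        case (elim z)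
        have "isCont g z" unfolding g_def by (rule isCont_indicator_off_frontier[OF \<open>open Q\<close> elim])
        then have "(\<lambda>n. Bn n z) \<longlonglongrightarrow> g z * c"
          unfolding Bn_def d_def c_def
          by (intro mollker_approx_identity[OF \<nu> g] e) (auto simp: g_def split: split_indicator)
        then have "(\<lambda>n. W z * Bn n z) \<longlonglongrightarrow> W z * (g z * c)" by (intro tendsto_intros)
        then show ?case by (simp add: mult_ac)
      qed
      show "AE z in lborel. norm (W z * Bn n z) \<le> enn2real (mass \<nu>) * (h z * indicator (cball 0 (R + 2)) z)" for n
      proof (rule AE_I2)
        fix z
        have "\<bar>Bn n z\<bar> \<le> enn2real (mass \<nu>) * indicator (cball 0 (R + 2)) z"
        proof (cases "norm z \<le> R + 2")
          case True
          have "ennreal \<bar>Bn n z\<bar> \<le> mass \<nu>"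
          proof (cases "integrable lborel (\<lambda>z0. g z0 * mollker \<nu> (d n) (z0 - z))")
            case True
            have "ennreal (norm (Bn n z)) \<le> (\<integral>\<^sup>+z0. ennreal (norm (g z0 * mollker \<nu> (d n) (z0 - z))) \<partial>lborel)"
              unfolding Bn_def by (rule integral_norm_bound_ennreal[OF True])
            also have "\<dots> \<le> (\<integral>\<^sup>+z0. ennreal (mollker \<nu> (d n) (z0 - z)) \<partial>lborel)"
              using mollker_nonneg[OF less_imp_le[OF d(2)], of \<nu>]
              by (intro nn_integral_mono) (auto simp: g_def split: split_indicator)
            also have "\<dots> = (\<integral>\<^sup>+z0. ennreal (mollker \<nu> (d n) z0) \<partial>lborel)"
              by (rule nn_integral_lborel_translate) measurable
            also have "\<dots> \<le> mass \<nu>" unfolding d_def by (rule nn_integral_mollker_le[OF e(2)])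
            finally show ?thesis by simp
          qed (simp add: Bn_def not_integrable_integral_eq)
          then have "\<bar>Bn n z\<bar> \<le> enn2real (mass \<nu>)"
            using mass_finite[OF \<nu>] by (cases "mass \<nu>") auto
          then show ?thesis using True by simp
        next
          case False
          have "g z0 * mollker \<nu> (d n) (z0 - z) = 0" for z0
          proof (rule ccontr)
            assume "g z0 * mollker \<nu> (d n) (z0 - z) \<noteq> 0"
            then have "z0 \<in> Q" "norm (z0 - z) \<le> 2" using mollker_support[of \<nu> "d n" "z0 - z"] by (auto simp: g_def indicator_def split: if_splits)
            then show False using R False norm_triangle_ineq4[of z0 "z0 - z"] by auto
          qed
          then have "Bn n z = 0" unfolding Bn_def by (simp only: Bochner_Integration.integral_zero)
          then show ?thesis by simp
        qed
        then have "\<bar>W z\<bar> * \<bar>Bn n z\<bar> \<le> h z * (enn2real (mass \<nu>) * indicator (cball 0 (R + 2)) z)"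
          by (intro mult_mono hW) auto
        then show "norm (W z * Bn n z) \<le> enn2real (mass \<nu>) * (h z * indicator (cball 0 (R + 2)) z)"
          by (simp add: abs_mult mult_ac)
      qed
      show "(\<lambda>z. W z * Bn n z) \<in> borel_measurable lborel" for n
      proof -
        have "Bn n \<in> borel_measurable borel"
          unfolding Bn_def[abs_def]
          by (intro measurable_integral_param borel_measurable_times measurable_pair_compose g measurable_kernels)
        then show ?thesis by measurable
      qed
    qed measurable
    have "(\<integral>p. g (fst p) * J 0 p \<partial>lborel) = (\<integral>z0. g z0 * v z0 \<partial>lborel)"
      using fub1[OF gJi[of 0]] by (simp add: v_def integral_mult_right_zero)
    moreover have "(\<lambda>n. \<integral>z. W z * Bn n z \<partial>lborel) \<longlonglongrightarrow> - (\<integral>p. g (fst p) * J 0 p \<partial>lborel)"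
      using tendsto_minus[OF lim2] unfolding sum0[symmetric] XB .
    ultimately have "(\<integral>z. g z * (W z * c) \<partial>lborel) = - (\<integral>z. g z * v z \<partial>lborel)"
      using LIMSEQ_unique[OF lim1] by simp
    moreover have gvi: "integrable lborel (\<lambda>z. g z * v z)"
      using fubi[OF gJi[of 0]] by (simp add: v_def integral_mult_right_zero)
    ultimately show ?thesis
      using gWi by (simp add: g_def[symmetric] distrib_left)
  qed
  define f where "f z = indicator {z. fst z < T} z * (W z * c + v z)" for z
  have fQ: "indicator (box a b) z * f z = indicator (box a b \<inter> {z. fst z < T}) z * (W z * c + v z)" for a b z
    by (simp add: f_def indicator_inter_arith)
  have "AE z in lborel. f z = 0"
    using main[OF refl] by (intro AE_zero_if_box_integrals_zero) (simp_all add: fQ)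
  then show ?thesis
    by eventually_elim (auto simp: f_def c_def[symmetric] v_def J_def)
qed

text \<open>The constant is the kernel bound divided by the positive limit mass. It is chosen before
  W, F and T and so depends on \<nu> only.\<close>

lemma mild_bound:
  assumes \<nu>: "0 < \<nu>"
  shows "\<exists>C::ennreal. C < \<infinity> \<and> (\<forall>W F T. W \<in> borel_measurable borel \<longrightarrow> F \<in> borel_measurable borel \<longrightarrow>
    (\<forall>R. (\<integral>\<^sup>+z. ennreal (\<bar>W z\<bar> + norm (F z)) * indicator (cball 0 R) z \<partial>lborel) < \<infinity>) \<longrightarrow>
    (\<forall>\<delta> z0. 0 < \<delta> \<longrightarrow> fst z0 < T \<longrightarrow>
      (\<integral>z. W z * (mollker \<nu> \<delta> (z0 - z) + errker \<nu> \<delta> (z0 - z)) + F z \<bullet> gradker \<nu> \<delta> (z0 - z) \<partial>lborel) = 0) \<longrightarrow>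
    (AE z0 in lborel. fst z0 < T \<longrightarrow> ennreal \<bar>W z0\<bar> \<le>
      C * (\<integral>\<^sup>+z. ennreal (\<bar>W z\<bar> + norm (F z)) * ennreal (hkbound \<nu> (fst z0 - fst z) (snd z0 - snd z)) \<partial>lborel)))"
proof -
  obtain C where C: "0 \<le> C" "\<And>\<delta> z. 0 \<le> \<delta> \<Longrightarrow> \<bar>errker \<nu> \<delta> z\<bar> \<le> C * hkbound \<nu> (fst z) (snd z)"
      "\<And>\<delta> z. 0 \<le> \<delta> \<Longrightarrow> norm (gradker \<nu> \<delta> z) \<le> C * hkbound \<nu> (fst z) (snd z)"
    using kernels_le_hkbound[OF \<nu>] by blast
  define c where "c = exp (- 1) * enn2real (mass \<nu>)"
  have c: "0 < c" using mass_finite[OF \<nu>] mass_pos[of \<nu>] by (cases "mass \<nu>") (auto simp: c_def)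
  have "AE z0 in lborel. fst z0 < T \<longrightarrow> ennreal \<bar>W z0\<bar> \<le>
      ennreal (C / c) * (\<integral>\<^sup>+z. ennreal (\<bar>W z\<bar> + norm (F z)) * ennreal (hkbound \<nu> (fst z0 - fst z) (snd z0 - snd z)) \<partial>lborel)"
    if W[measurable]: "W \<in> borel_measurable borel" and F[measurable]: "F \<in> borel_measurable borel"
    and loc: "\<And>R. (\<integral>\<^sup>+z. ennreal (\<bar>W z\<bar> + norm (F z)) * indicator (cball 0 R) z \<partial>lborel) < \<infinity>"
    and weak: "\<And>\<delta> z0. 0 < \<delta> \<Longrightarrow> fst z0 < T \<Longrightarrow>
      (\<integral>z. W z * (mollker \<nu> \<delta> (z0 - z) + errker \<nu> \<delta> (z0 - z)) + F z \<bullet> gradker \<nu> \<delta> (z0 - z) \<partial>lborel) = 0"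
    for W F T
  proof -
    have "AE z0 in lborel. fst z0 < T \<longrightarrow> W z0 * c = - (\<integral>z. W z * errker \<nu> 0 (z0 - z) + F z \<bullet> gradker \<nu> 0 (z0 - z) \<partial>lborel)"
      unfolding c_def by (rule weak_to_mild[OF \<nu> W F loc weak])
    then show ?thesis
    proof eventually_elim
      case (elim z0)
      let ?k = "\<lambda>z. hkbound \<nu> (fst z0 - fst z) (snd z0 - snd z)"
      let ?J = "\<lambda>z. W z * errker \<nu> 0 (z0 - z) + F z \<bullet> gradker \<nu> 0 (z0 - z)"
      have [measurable]: "?k \<in> borel_measurable borel"
      proof -
        have "(\<lambda>z. z0 - z) \<in> borel_measurable borel" by measurable
        from measurable_compose[OF this measurable_hkbound] show ?thesis by simp
      qed
      show ?case
      proof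
        assume "fst z0 < T"
        with elim have eq: "W z0 * c = - (\<integral>z. ?J z \<partial>lborel)" by simp
        have "ennreal \<bar>\<integral>z. ?J z \<partial>lborel\<bar> \<le> (\<integral>\<^sup>+z. ennreal (norm (?J z)) \<partial>lborel)"
        proof (cases "integrable lborel ?J")
          case True
          from integral_norm_bound_ennreal[OF this] show ?thesis by simp
        qed (simp add: not_integrable_integral_eq)
        also have "\<dots> \<le> (\<integral>\<^sup>+z. ennreal C * (ennreal (\<bar>W z\<bar> + norm (F z)) * ennreal (?k z)) \<partial>lborel)"
        proof (rule nn_integral_mono)
          fix z
          have "\<bar>W z * errker \<nu> 0 (z0 - z)\<bar> \<le> \<bar>W z\<bar> * (C * ?k z)"
            unfolding abs_mult using C(2)[of 0 "z0 - z"] by (intro mult_left_mono) auto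
          moreover have "\<bar>F z \<bullet> gradker \<nu> 0 (z0 - z)\<bar> \<le> norm (F z) * (C * ?k z)"
            using C(3)[of 0 "z0 - z"] by (intro order_trans[OF Cauchy_Schwarz_ineq2] mult_left_mono) auto
          ultimately have "norm (?J z) \<le> C * ((\<bar>W z\<bar> + norm (F z)) * ?k z)"
            by (simp add: algebra_simps)
          then show "ennreal (norm (?J z)) \<le> ennreal C * (ennreal (\<bar>W z\<bar> + norm (F z)) * ennreal (?k z))"
            using C(1) by (simp add: ennreal_mult[symmetric] ennreal_leI del: ennreal_plus)
        qed
        also have "\<dots> = ennreal C * (\<integral>\<^sup>+z. ennreal (\<bar>W z\<bar> + norm (F z)) * ennreal (?k z) \<partial>lborel)"
          by (rule nn_integral_cmult) measurable
        finally have le: "ennreal \<bar>\<integral>z. ?J z \<partial>lborel\<bar> \<le> \<dots>" .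
        have "\<bar>W z0\<bar> = \<bar>\<integral>z. ?J z \<partial>lborel\<bar> / c"
        proof -
          define I where "I = (\<integral>z. ?J z \<partial>lborel)"
          have "\<bar>W z0 * c\<bar> = \<bar>I\<bar>" using eq unfolding I_def[symmetric] by simp
          then show ?thesis unfolding I_def[symmetric] using c by (simp add: abs_mult field_simps)
        qed
        then have "ennreal \<bar>W z0\<bar> = ennreal (1 / c) * ennreal \<bar>\<integral>z. ?J z \<partial>lborel\<bar>"
          using c by (simp add: ennreal_mult[symmetric])
        also have "\<dots> \<le> ennreal (1 / c) * (ennreal C * (\<integral>\<^sup>+z. ennreal (\<bar>W z\<bar> + norm (F z)) * ennreal (?k z) \<partial>lborel))"
          by (intro mult_left_mono le) simp
        also have "\<dots> = ennreal (C / c) * (\<integral>\<^sup>+z. ennreal (\<bar>W z\<bar> + norm (F z)) * ennreal (?k z) \<partial>lborel)"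
          using c C(1) by (simp add: mult.assoc[symmetric] ennreal_mult[symmetric])
        finally show "ennreal \<bar>W z0\<bar> \<le> \<dots>" .
      qed
    qed
  qed
  then show ?thesis by (intro exI[of _ "ennreal (C / c)"]) auto
qed

section \<open>From the mild bound to the potential norm\<close>

lemma AE_lborel_pair:
  fixes P :: "'a::euclidean_space \<times> 'b::euclidean_space \<Rightarrow> bool"
  assumes "AE z in lborel. P z"
  shows "AE x in lborel. AE y in lborel. P (x, y)"
  by (rule lborel_pair.AE_pair[OF assms[folded lborel_prod]])

text \<open>By Tonelli, the potential at x' of a spatial convolution with k is an average, with
  weight k, of the potentials of H(s, .) at the shifted centres x' - e. A bound uniform in the
  centre ignores the shift, so only the mass of k at elapsed time t - s remains.\<close>

lemma suppot_conv_le: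
  fixes W :: "spt \<Rightarrow> real" and H :: "spt \<Rightarrow> ennreal"
  assumes \<nu>: "0 < \<nu>" and W[measurable]: "W \<in> borel_measurable borel" and H[measurable]: "H \<in> borel_measurable borel"
    and [measurable]: "S \<in> borel_measurable borel"
    and le: "AE z0 in lborel. ennreal \<bar>W z0\<bar> \<le>
      C * (\<integral>\<^sup>+z. H z * ennreal (hkbound \<nu> (fst z0 - fst z) (snd z0 - snd z)) \<partial>lborel)"
    and S: "AE s in lborel. \<forall>x. (\<integral>\<^sup>+y. H (s, y) * ennreal (1 / norm (x - y)) \<partial>lborel) \<le> S s"
  shows "AE t in lborel. suppot (\<lambda>x. W (t, x)) \<le>
    C * gauss_mass \<nu> * (\<integral>\<^sup>+s. (ennreal ((t - s) powr (- (1/6))) * indicator {0..1} (t - s)) ^ 3 * S s \<partial>lborel)"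
  using AE_lborel_pair[OF le]
proof eventually_elim
  case (elim t)
  define q where "q z = ennreal (1 / norm z)" for z :: "real \<times> real"
  have q[measurable]: "q \<in> borel_measurable borel" unfolding q_def[abs_def] by measurable
  define k where "k s y = ennreal (hkbound \<nu> (t - s) y)" for s y
  have km: "(\<lambda>z. k (fst z) (snd z)) \<in> borel_measurable borel"
  proof -
    have "(\<lambda>z::spt. (t - fst z, snd z)) \<in> borel_measurable borel"
      by (intro borel_measurable_continuous_onI continuous_intros)
    from measurable_compose[OF this measurable_hkbound] show ?thesis by (simp add: k_def)
  qed
  have km1: "k s \<in> borel_measurable borel" for s
  proof -
    have "(\<lambda>y. (s, y)) \<in> borel_measurable borel" by (intro borel_measurable_continuous_onI continuous_intros)
    from measurable_compose[OF this km] show ?thesis by simp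
  qed
  have Hm1: "(\<lambda>y. H (s, y)) \<in> borel_measurable borel" for s
    by (intro measurable_compose[OF _ H] borel_measurable_continuous_onI continuous_intros)
  let ?l = "\<lambda>s. (ennreal ((t - s) powr (- (1/6))) * indicator {0..1} (t - s)) ^ 3"
  show ?case
  proof (rule suppot_leI)
    fix x' :: "real \<times> real"
    have kxm: "(\<lambda>p::(real\<times>real)\<times>spt. k (fst (snd p)) (fst p - snd (snd p))) \<in> borel_measurable borel"
    proof -
      have "(\<lambda>p::(real\<times>real)\<times>spt. (fst (snd p), fst p - snd (snd p))) \<in> borel_measurable borel"
        by (intro borel_measurable_continuous_onI continuous_intros)
      from measurable_compose[OF this km] show ?thesis by simp
    qed
    have kxm1: "(\<lambda>z. k (fst z) (x - snd z)) \<in> borel_measurable borel" for x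
    proof -
      have "(\<lambda>z::spt. (fst z, x - snd z)) \<in> borel_measurable borel"
        by (intro borel_measurable_continuous_onI continuous_intros)
      from measurable_compose[OF this km] show ?thesis by simp
    qed
    have qm: "(\<lambda>x. q (x' - x)) \<in> borel_measurable borel"
      by (intro measurable_compose[OF _ q] borel_measurable_continuous_onI continuous_intros)
    have "pot (\<lambda>x. W (t, x)) x' = (\<integral>\<^sup>+x. ennreal \<bar>W (t, x)\<bar> * q (x' - x) \<partial>lborel)"
      unfolding pot_def q_def by (intro nn_integral_cong) (simp add: ennreal_mult[symmetric])
    also have "\<dots> \<le> (\<integral>\<^sup>+x. C * (\<integral>\<^sup>+z. H z * k (fst z) (x - snd z) \<partial>lborel) * q (x' - x) \<partial>lborel)"
      using elim by (intro nn_integral_mono_AE) (auto simp: k_def elim!: eventually_mono intro!: mult_right_mono)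
    also have "\<dots> = C * (\<integral>\<^sup>+x. (\<integral>\<^sup>+z. H z * k (fst z) (x - snd z) \<partial>lborel) * q (x' - x) \<partial>lborel)"
      unfolding mult.assoc
      by (rule nn_integral_cmult, unfold measurable_lborel2)
         (intro borel_measurable_times_ennreal measurable_nn_integral_param measurable_pair_compose H kxm qm)
    also have "(\<integral>\<^sup>+x. (\<integral>\<^sup>+z. H z * k (fst z) (x - snd z) \<partial>lborel) * q (x' - x) \<partial>lborel)
       = (\<integral>\<^sup>+x. \<integral>\<^sup>+z. H z * k (fst z) (x - snd z) * q (x' - x) \<partial>lborel \<partial>lborel)"
      by (intro nn_integral_cong nn_integral_multc[symmetric]) (use kxm1 in measurable)
    also have "\<dots> = (\<integral>\<^sup>+z. \<integral>\<^sup>+x. H z * k (fst z) (x - snd z) * q (x' - x) \<partial>lborel \<partial>lborel)"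
      by (rule nn_integral_swap)
         (intro borel_measurable_times_ennreal measurable_pair_compose H kxm qm)
    also have "\<dots> = (\<integral>\<^sup>+s. \<integral>\<^sup>+y. \<integral>\<^sup>+x. H (s, y) * k s (x - y) * q (x' - x) \<partial>lborel \<partial>lborel \<partial>lborel)"
    proof (subst nn_integral_lborel_pair)
      have "(\<lambda>p::spt\<times>real\<times>real. k (fst (fst p)) (snd p - snd (fst p))) \<in> borel_measurable borel"
      proof -
        have "(\<lambda>p::spt\<times>(real\<times>real). (fst (fst p), snd p - snd (fst p))) \<in> borel_measurable borel"
          by (intro borel_measurable_continuous_onI continuous_intros)
        from measurable_compose[OF this km] show ?thesis by simp
      qed
      then show "(\<lambda>z. \<integral>\<^sup>+x. H z * k (fst z) (x - snd z) * q (x' - x) \<partial>lborel) \<in> borel_measurable borel"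
        by (intro measurable_nn_integral_param borel_measurable_times_ennreal measurable_pair_compose H qm)
    qed simp
    also have "\<dots> \<le> (\<integral>\<^sup>+s. gauss_mass \<nu> * (?l s * S s) \<partial>lborel)"
    proof (rule nn_integral_mono_AE)
      show "AE s in lborel. (\<integral>\<^sup>+y. \<integral>\<^sup>+x. H (s, y) * k s (x - y) * q (x' - x) \<partial>lborel \<partial>lborel) \<le> gauss_mass \<nu> * (?l s * S s)"
        using S
      proof eventually_elim
        case (elim s)
        have "(\<integral>\<^sup>+y. \<integral>\<^sup>+x. H (s, y) * k s (x - y) * q (x' - x) \<partial>lborel \<partial>lborel)
          = (\<integral>\<^sup>+y. \<integral>\<^sup>+e. H (s, y) * k s e * q (x' - e - y) \<partial>lborel \<partial>lborel)"
        proof (rule nn_integral_cong)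
          \<comment> \<open>The substitution x = y + e moves the displacement from the kernel into
            the centre of the potential.\<close>
          fix y
          have m: "(\<lambda>e. H (s, y) * k s e * q (x' - e - y)) \<in> borel_measurable borel"
            by (intro borel_measurable_times_ennreal km1 borel_measurable_const measurable_compose[OF _ q]
              borel_measurable_continuous_onI continuous_intros)
          show "(\<integral>\<^sup>+x. H (s, y) * k s (x - y) * q (x' - x) \<partial>lborel) = (\<integral>\<^sup>+e. H (s, y) * k s e * q (x' - e - y) \<partial>lborel)"
            using nn_integral_lborel_translate[OF m, of y] by (simp add: algebra_simps)
        qed
        also have "\<dots> = (\<integral>\<^sup>+e. \<integral>\<^sup>+y. H (s, y) * k s e * q (x' - e - y) \<partial>lborel \<partial>lborel)"
          by (rule nn_integral_swap)
             (intro borel_measurable_times_ennreal measurable_pair_compose km1 Hm1 measurable_compose[OF _ q]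
              borel_measurable_continuous_onI[of "\<lambda>p. x' - snd p - fst p"] continuous_intros)
        also have "\<dots> \<le> (\<integral>\<^sup>+e. k s e * S s \<partial>lborel)"
        proof (rule nn_integral_mono)
          fix e
          have "(\<integral>\<^sup>+y. H (s, y) * k s e * q (x' - e - y) \<partial>lborel) = (\<integral>\<^sup>+y. k s e * (H (s, y) * q (x' - e - y)) \<partial>lborel)"
            by (simp only: mult_ac)
          also have "\<dots> = k s e * (\<integral>\<^sup>+y. H (s, y) * q (x' - e - y) \<partial>lborel)"
            by (rule nn_integral_cmult, unfold measurable_lborel2)
               (intro borel_measurable_times_ennreal Hm1 measurable_compose[OF _ q]
                 borel_measurable_continuous_onI continuous_intros)
          \<comment> \<open>The hypothesis on S is applied at the shifted centre x' - e.\<close>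
          also have "\<dots> \<le> k s e * S s" 
            using spec[OF elim, of "x' - e"] by (intro mult_left_mono) (simp_all add: q_def)
          finally show "(\<integral>\<^sup>+y. H (s, y) * k s e * q (x' - e - y) \<partial>lborel) \<le> k s e * S s" .
        qed
        also have "\<dots> = (\<integral>\<^sup>+e. k s e \<partial>lborel) * S s" by (rule nn_integral_multc) (use km1 in simp)
        also have "\<dots> \<le> gauss_mass \<nu> * ?l s * S s"
          unfolding k_def by (intro mult_right_mono nn_integral_hkbound_le \<nu>) simp
        finally show ?case by (simp add: mult.assoc)
      qed
    qed
    also have "(\<integral>\<^sup>+s. gauss_mass \<nu> * (?l s * S s) \<partial>lborel) = gauss_mass \<nu> * (\<integral>\<^sup>+s. ?l s * S s \<partial>lborel)"
      by (rule nn_integral_cmult) measurable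
    finally show "pot (\<lambda>x. W (t, x)) x' \<le> C * gauss_mass \<nu> * (\<integral>\<^sup>+s. ?l s * S s \<partial>lborel)"
      by (simp add: mult.assoc mult_left_mono)
  qed
qed

text \<open>The bound on the fourth power is uniform in x; a real fourth root carries it through the
  supremum.\<close>

lemma suppot_power4_le:
  "\<exists>C::ennreal. C < \<infinity> \<and> (\<forall>f. f \<in> borel_measurable borel \<longrightarrow> suppot f ^ 4 \<le> C * (Lp_norm 4 f ^ 4 + Lp_norm (4/3) f ^ 4))"
proof -
  obtain C :: ennreal where C: "C < \<infinity>" "\<And>f x. f \<in> borel_measurable borel \<Longrightarrow> pot f x ^ 4 \<le> C * (Lp_norm 4 f ^ 4 + Lp_norm (4/3) f ^ 4)"
    using pot_power4_le by blast
  have "suppot f ^ 4 \<le> c" if le: "\<And>x. pot f x ^ 4 \<le> c" for f c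
  proof (cases c)
    case (real r)
    have "pot f x \<le> ennreal (root 4 r)" for x
    proof (cases "pot f x")
      case p: (real p)
      then have "p ^ 4 \<le> r" using le[of x] real by (simp add: ennreal_power)
      then have "p \<le> root 4 r" using p real by (metis real_root_le_iff real_root_power_cancel zero_less_numeral)
      then show ?thesis using p by (simp add: ennreal_leI)
    qed (use le[of x] real in \<open>simp add: top_unique\<close>)
    then have "suppot f ^ 4 \<le> ennreal (root 4 r) ^ 4" by (intro power_mono suppot_leI) auto
    then show ?thesis using real by (simp add: ennreal_power)
  qed simp
  with C show ?thesis by blast
qed

lemma pot_zero [simp]: "pot (\<lambda>x. 0) x = 0"
  by (simp add: pot_def)

lemma suppot_zero [simp]: "suppot (\<lambda>x. 0) = 0"
  using suppot_leI[of "\<lambda>x. 0" 0] by simp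

lemma pot_eq_0D:
  assumes [measurable]: "f \<in> borel_measurable borel" and "pot f x = 0"
  shows "AE y in lborel. f y = 0"
proof -
  have "AE y in lborel. ennreal (\<bar>f y\<bar> / norm (x - y)) = 0"
    using assms(2) unfolding pot_def by (subst (asm) nn_integral_0_iff_AE) auto
  then show ?thesis using AE_lborel_singleton[of x] by eventually_elim (auto simp: divide_le_0_iff)
qed

lemma smooth_supp_bounded:
  fixes f :: "spt \<Rightarrow> real"
  assumes f: "smooth_fun f" "\<And>z. 1 < norm z \<Longrightarrow> f z = 0"
  shows "\<exists>B\<ge>0. \<forall>z. \<bar>f z\<bar> \<le> B * indicator (cball 0 1) z"
proof -
  have "compact (f ` cball 0 1)" by (intro compact_continuous_image smooth_funD f compact_cball)
  then have "bounded (f ` cball 0 1)" by (rule compact_imp_bounded)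
  then obtain B where B: "\<forall>z\<in>cball 0 1. \<bar>f z\<bar> \<le> B" unfolding bounded_iff by auto
  have "0 \<le> B" using bspec[OF B, of 0] by (auto intro: order_trans[OF abs_ge_zero])
  then show ?thesis using B f(2) by (intro exI[of _ B]) (auto simp: indicator_def)
qed

section \<open>Uniqueness\<close>

text \<open>Extension by zero off (0, T) allows all later integrals to run over the whole
  space-time.\<close>

definition trunc :: "real \<Rightarrow> (real \<Rightarrow> real \<times> real \<Rightarrow> real) \<Rightarrow> spt \<Rightarrow> real" where
  "trunc T u z = indicator {0<..<T} (fst z) * u (fst z) (snd z)"

definition flux :: "real \<Rightarrow> (real \<Rightarrow> real \<times> real \<Rightarrow> real) \<Rightarrow> spt \<Rightarrow> real \<times> real" where
  "flux T u z = trunc T u z *\<^sub>R BS (u (fst z)) (snd z)"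

lemma measurable_trunc_flux:
  assumes u: "(\<lambda>z. u (fst z) (snd z)) \<in> borel_measurable borel"
  shows "trunc T u \<in> borel_measurable borel" "flux T u \<in> borel_measurable borel"
proof -
  have "(\<lambda>z::spt. indicator {0<..<T} (fst z) :: real) \<in> borel_measurable borel"
    by (rule measurable_pair_compose) measurable
  then show "trunc T u \<in> borel_measurable borel"
    unfolding trunc_def[abs_def] using u by (rule borel_measurable_times)
  then show "flux T u \<in> borel_measurable borel"
    unfolding flux_def[abs_def] by (intro borel_measurable_scaleR measurable_BS_param u)
qed

lemma measurable_section:
  fixes f :: "'a::euclidean_space \<times> 'b::euclidean_space \<Rightarrow> 'c::topological_space"
  assumes "f \<in> borel_measurable borel"
  shows "(\<lambda>y. f (s, y)) \<in> borel_measurable borel"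
  by (intro measurable_compose[OF _ assms] borel_measurable_continuous_onI continuous_intros)

text \<open>On the ball of radius R the weight R/|y| is at least 1 away from the origin.\<close>

lemma nn_integral_cball_le_pot:
  assumes [measurable]: "f \<in> borel_measurable borel"
  shows "(\<integral>\<^sup>+y. ennreal \<bar>f y\<bar> * indicator (cball 0 R) y \<partial>lborel) \<le> ennreal R * pot f 0"
proof -
  have "(\<integral>\<^sup>+y. ennreal \<bar>f y\<bar> * indicator (cball 0 R) y \<partial>lborel) \<le> (\<integral>\<^sup>+y. ennreal R * ennreal (\<bar>f y\<bar> / norm (0 - y)) \<partial>lborel)"
  proof (rule nn_integral_mono_AE)
    show "AE y in lborel. ennreal \<bar>f y\<bar> * indicator (cball 0 R) y \<le> ennreal R * ennreal (\<bar>f y\<bar> / norm (0 - y))"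
      using AE_lborel_singleton[of "0 :: real \<times> real"]
    proof eventually_elim
      case (elim y)
      show ?case
      proof (cases "norm y \<le> R")
        case True
        then have "\<bar>f y\<bar> \<le> R * (\<bar>f y\<bar> / norm (0 - y))"
          using elim mult_right_mono[OF True, of "\<bar>f y\<bar>"] by (simp add: field_simps)
        moreover have "0 \<le> R" using True norm_ge_zero[of y] by linarith
        ultimately show ?thesis using True by (simp add: ennreal_mult[symmetric] ennreal_leI)
      qed simp
    qed
  qed
  also have "\<dots> = ennreal R * pot f 0" unfolding pot_def by (rule nn_integral_cmult) measurable
  finally show ?thesis .
qed

lemma ennreal_powers_le: "a \<le> 1 + a ^ 4" "a ^ 2 \<le> 1 + (a::ennreal) ^ 4"
proof -
  have "a \<le> 1 + a ^ 4 \<and> a ^ 2 \<le> 1 + a ^ 4"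
  proof (cases "a \<le> 1")
    case True
    then have "a ^ 2 \<le> 1" by (simp add: power_le_one)
    with True show ?thesis by (auto intro: add_increasing2)
  next
    case False
    then have a: "1 \<le> a" by simp
    have "a \<le> a ^ 4" using power_increasing[OF _ a, of 1 4] by simp
    moreover have "a ^ 2 \<le> a ^ 4" using power_increasing[OF _ a, of 2 4] by simp
    ultimately show ?thesis by (auto intro: add_increasing)
  qed
  then show "a \<le> 1 + a ^ 4" "a ^ 2 \<le> 1 + a ^ 4" by auto
qed

text \<open>Write a for \<open>suppot\<close> of a time slice. Then |K(u)| \<le> a, and over a ball
  of radius R the slice integrates to at most R a, so u and its flux together contribute at most R
  (a + a^2). Both a and a^2 are bounded by 1 + a^4, which is integrable over (0, T).\<close>

lemma trunc_flux_locally_integrable: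
  assumes u: "(\<lambda>z. u (fst z) (snd z)) \<in> borel_measurable borel"
    and a4: "(\<integral>\<^sup>+s. indicator {0<..<T} s * suppot (u s) ^ 4 \<partial>lborel) < \<infinity>"
  shows "(\<integral>\<^sup>+z. ennreal (\<bar>trunc T u z\<bar> + norm (flux T u z)) * indicator (cball 0 R) z \<partial>lborel) < \<infinity>"
proof -
  note m[measurable] = measurable_trunc_flux[OF u, of T] measurable_suppot[OF u]
  have cb[measurable]: "cball (0::spt) R \<in> sets borel" "cball (0::real\<times>real) R \<in> sets borel" by auto
  have us[measurable]: "u s \<in> borel_measurable borel" for s using measurable_section[OF u, of s] by simp
  have "(\<integral>\<^sup>+z. ennreal (\<bar>trunc T u z\<bar> + norm (flux T u z)) * indicator (cball 0 R) z \<partial>lborel)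
     = (\<integral>\<^sup>+s. \<integral>\<^sup>+y. ennreal (\<bar>trunc T u (s, y)\<bar> + norm (flux T u (s, y))) * indicator (cball 0 R) (s, y) \<partial>lborel \<partial>lborel)"
    by (rule nn_integral_lborel_pair) measurable
  also have "\<dots> \<le> (\<integral>\<^sup>+s. ennreal R * (2 * (indicator {0<..<T} s + indicator {0<..<T} s * suppot (u s) ^ 4)) \<partial>lborel)"
  proof (rule nn_integral_mono)
    fix s
    let ?a = "suppot (u s)"
    show "(\<integral>\<^sup>+y. ennreal (\<bar>trunc T u (s, y)\<bar> + norm (flux T u (s, y))) * indicator (cball 0 R) (s, y) \<partial>lborel)
      \<le> ennreal R * (2 * (indicator {0<..<T} s + indicator {0<..<T} s * ?a ^ 4))"
    proof (cases "s \<in> {0<..<T}")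
      case True
      have "(\<integral>\<^sup>+y. ennreal (\<bar>trunc T u (s, y)\<bar> + norm (flux T u (s, y))) * indicator (cball 0 R) (s, y) \<partial>lborel)
         \<le> (\<integral>\<^sup>+y. (1 + ?a) * (ennreal \<bar>u s y\<bar> * indicator (cball 0 R) y) \<partial>lborel)"
      proof (rule nn_integral_mono)
        fix y
        have "ennreal (norm (BS (u s) y)) \<le> ?a"
          using norm_BS_le pot_le_suppot[OF us] by (rule order_trans)
        then have "ennreal \<bar>u s y\<bar> * ennreal (norm (BS (u s) y)) \<le> ennreal \<bar>u s y\<bar> * ?a"
          by (rule mult_left_mono) simp
        then have "ennreal (\<bar>trunc T u (s, y)\<bar> + norm (flux T u (s, y))) \<le> (1 + ?a) * ennreal \<bar>u s y\<bar>"
        proof -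
          assume le: "ennreal \<bar>u s y\<bar> * ennreal (norm (BS (u s) y)) \<le> ennreal \<bar>u s y\<bar> * ?a"
          have "ennreal (\<bar>trunc T u (s, y)\<bar> + norm (flux T u (s, y))) = ennreal \<bar>u s y\<bar> + ennreal \<bar>u s y\<bar> * ennreal (norm (BS (u s) y))"
            using True by (simp add: trunc_def flux_def ennreal_mult)
          also have "\<dots> \<le> ennreal \<bar>u s y\<bar> + ennreal \<bar>u s y\<bar> * ?a" by (intro add_left_mono le)
          also have "\<dots> = (1 + ?a) * ennreal \<bar>u s y\<bar>" by (simp only: distrib_left distrib_right mult_1 mult_1_right mult.commute)
          finally show ?thesis .
        qed
        moreover have "indicator (cball 0 R) (s, y) \<le> (indicator (cball 0 R) y :: ennreal)"
          using norm_snd_le[of y s] by (auto simp: indicator_def)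
        ultimately show "ennreal (\<bar>trunc T u (s, y)\<bar> + norm (flux T u (s, y))) * indicator (cball 0 R) (s, y)
          \<le> (1 + ?a) * (ennreal \<bar>u s y\<bar> * indicator (cball 0 R) y)"
          unfolding mult.assoc[symmetric] by (intro mult_mono) auto
      qed
      also have "\<dots> = (1 + ?a) * (\<integral>\<^sup>+y. ennreal \<bar>u s y\<bar> * indicator (cball 0 R) y \<partial>lborel)"
        by (rule nn_integral_cmult) measurable
      also have "\<dots> \<le> (1 + ?a) * (ennreal R * ?a)"
        by (intro mult_left_mono order_trans[OF nn_integral_cball_le_pot[OF us]] pot_le_suppot us) auto
      also have "\<dots> = ennreal R * (?a + ?a ^ 2)" by (simp add: distrib_left distrib_right power2_eq_square mult_ac)
      also have "\<dots> \<le> ennreal R * ((1 + ?a ^ 4) + (1 + ?a ^ 4))"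
        by (intro mult_left_mono add_mono ennreal_powers_le) simp
      finally have le: "(\<integral>\<^sup>+y. ennreal (\<bar>trunc T u (s, y)\<bar> + norm (flux T u (s, y))) * indicator (cball 0 R) (s, y) \<partial>lborel) \<le> \<dots>" .
      have ind: "indicator {0<..<T} s = (1::ennreal)" using True by simp
      show ?thesis using le unfolding ind mult_1 mult_2 .
    qed (simp add: trunc_def flux_def)
  qed
  also have "\<dots> = ennreal R * (2 * ((\<integral>\<^sup>+s. indicator {0<..<T} s \<partial>lborel) + (\<integral>\<^sup>+s. indicator {0<..<T} s * suppot (u s) ^ 4 \<partial>lborel)))"
    by (simp add: nn_integral_cmult nn_integral_add)
  also have "\<dots> < \<infinity>"
    using a4 emeasure_lborel_box_finite[of 0 T] by (simp add: ennreal_mult_less_top box_real)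
  finally show ?thesis .
qed

text \<open>Causality: a centre z0 with time below T never sees times at or beyond T. This makes the
  truncation at T harmless in the weak formulation.\<close>

lemma kernels_past: "fst z \<le> 0 \<Longrightarrow> mollker \<nu> \<delta> z = 0 \<and> errker \<nu> \<delta> z = 0 \<and> gradker \<nu> \<delta> z = 0"
  by (simp add: mollker_def errker_def gradker_def heatker_def flatexp_def)

lemma parametrix_kernels:
  assumes "0 < \<nu>" "0 < \<delta>"
  shows "dt (parametrix \<nu> \<delta>) z - \<nu> * lap_x (parametrix \<nu> \<delta>) z = mollker \<nu> \<delta> z + errker \<nu> \<delta> z" "grad_x (parametrix \<nu> \<delta>) z = gradker \<nu> \<delta> z"
  unfolding parametrix_derivatives[OF assms] mollker_def errker_def gradker_def by simp_all

text \<open>For fixed \<delta> the kernels are derivatives of a smooth compactly supported function.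
  The bound may blow up as \<delta> tends to 0; it serves to make the tested identity absolutely
  convergent.\<close>

lemma kernels_bounded:
  assumes \<nu>: "0 < \<nu>" and \<delta>: "0 < \<delta>"
  shows "\<exists>B\<ge>0. \<forall>z. \<bar>mollker \<nu> \<delta> z + errker \<nu> \<delta> z\<bar> \<le> B * indicator (cball 0 1) z \<and> norm (gradker \<nu> \<delta> z) \<le> B * indicator (cball 0 1) z"
proof -
  let ?P = "parametrix \<nu> \<delta>"
  note sm = smooth_parametrix[OF \<nu> \<delta>]
  have z: "1 < norm z \<Longrightarrow> ?P z = 0" for z using cut_eq_0[of z] by (simp add: parametrix_def)
  have z1: "1 < norm z \<Longrightarrow> pd ?P b z = 0" for z b using pd_eq_0_outside[of ?P z b] z by blast
  have z2: "1 < norm z \<Longrightarrow> pd (pd ?P b) b z = 0" for z b using pd_eq_0_outside[of "pd ?P b" z b] z1 by blast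
  have s1: "smooth_fun (pd ?P b)" if "b \<in> Basis" for b by (rule smooth_funD(2)[OF sm that])
  have s2: "smooth_fun (pd (pd ?P b) b)" if "b \<in> Basis" for b by (rule smooth_funD(2)[OF s1 that]) fact
  let ?I = "\<lambda>z. indicator (cball (0::spt) 1) z :: real"
  obtain B1 where B1: "0 \<le> B1" "\<And>z. \<bar>pd ?P (1,0,0) z\<bar> \<le> B1 * ?I z" using smooth_supp_bounded[OF s1 z1] spt_Basis by blast
  obtain B2 where B2: "0 \<le> B2" "\<And>z. \<bar>pd ?P (0,1,0) z\<bar> \<le> B2 * ?I z" using smooth_supp_bounded[OF s1 z1] spt_Basis by blast
  obtain B3 where B3: "0 \<le> B3" "\<And>z. \<bar>pd ?P (0,0,1) z\<bar> \<le> B3 * ?I z" using smooth_supp_bounded[OF s1 z1] spt_Basis by blast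
  obtain B4 where B4: "0 \<le> B4" "\<And>z. \<bar>pd (pd ?P (0,1,0)) (0,1,0) z\<bar> \<le> B4 * ?I z" using smooth_supp_bounded[OF s2 z2] spt_Basis by blast
  obtain B5 where B5: "0 \<le> B5" "\<And>z. \<bar>pd (pd ?P (0,0,1)) (0,0,1) z\<bar> \<le> B5 * ?I z" using smooth_supp_bounded[OF s2 z2] spt_Basis by blast
  define B where "B = (B1 + \<nu> * (B4 + B5)) + (B2 + B3)"
  have B: "0 \<le> B1 + \<nu> * (B4 + B5)" "0 \<le> B2 + B3" using B1(1) B2(1) B3(1) B4(1) B5(1) \<nu> by auto
  have "\<bar>mollker \<nu> \<delta> z + errker \<nu> \<delta> z\<bar> \<le> B * ?I z \<and> norm (gradker \<nu> \<delta> z) \<le> B * ?I z" for z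
  proof
    have I: "0 \<le> ?I z" by simp
    have "\<bar>lap_x ?P z\<bar> \<le> B4 * ?I z + B5 * ?I z"
      unfolding lap_x_def by (rule order_trans[OF abs_triangle_ineq add_mono[OF B4(2) B5(2)]])
    then have "\<nu> * \<bar>lap_x ?P z\<bar> \<le> \<nu> * (B4 * ?I z + B5 * ?I z)" using \<nu> by (intro mult_left_mono) auto
    moreover have "\<bar>dt ?P z - \<nu> * lap_x ?P z\<bar> \<le> \<bar>dt ?P z\<bar> + \<nu> * \<bar>lap_x ?P z\<bar>"
      using \<nu> abs_triangle_ineq4[of "dt ?P z" "\<nu> * lap_x ?P z"] by (simp add: abs_mult)
    moreover have "\<bar>dt ?P z\<bar> \<le> B1 * ?I z" unfolding dt_def by (rule B1(2))
    ultimately have "\<bar>dt ?P z - \<nu> * lap_x ?P z\<bar> \<le> B1 * ?I z + \<nu> * (B4 * ?I z + B5 * ?I z)"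
      by (blast intro: order_trans add_mono)
    then have "\<bar>mollker \<nu> \<delta> z + errker \<nu> \<delta> z\<bar> \<le> B1 * ?I z + \<nu> * (B4 * ?I z + B5 * ?I z)"
      unfolding parametrix_kernels(1)[OF \<nu> \<delta>] .
    also have "\<dots> = (B1 + \<nu> * (B4 + B5)) * ?I z" by (simp add: algebra_simps)
    also have "\<dots> \<le> B * ?I z" using B I by (intro mult_right_mono) (auto simp: B_def)
    finally show "\<bar>mollker \<nu> \<delta> z + errker \<nu> \<delta> z\<bar> \<le> B * ?I z" .
    have "norm (gradker \<nu> \<delta> z) \<le> \<bar>pd ?P (0,1,0) z\<bar> + \<bar>pd ?P (0,0,1) z\<bar>"
      unfolding parametrix_kernels(2)[OF \<nu> \<delta>, symmetric] grad_x_def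
      using norm_Pair_le[of "pd ?P (0,1,0) z" "pd ?P (0,0,1) z"] by simp
    also have "\<dots> \<le> B2 * ?I z + B3 * ?I z" by (intro add_mono B2 B3)
    also have "\<dots> = (B2 + B3) * ?I z" by (simp add: algebra_simps)
    also have "\<dots> \<le> B * ?I z" using B I by (intro mult_right_mono) (auto simp: B_def)
    finally show "norm (gradker \<nu> \<delta> z) \<le> B * ?I z" .
  qed
  moreover have "0 \<le> B" using B by (simp add: B_def)
  ultimately show ?thesis by blast
qed

text \<open>The equation tested with the reflected parametrix. Its right-hand side involves the
  initial measures but not u, so it is shared by both solutions. Integrability is recorded because
  the two identities are subtracted under the integral sign.\<close>

lemma solution_kernel_identity:
  assumes \<nu>: "0 < \<nu>" and \<delta>: "0 < \<delta>" and z0: "fst z0 < T"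
    and sol: "dist_solution \<nu> mp mn u"
    and u: "(\<lambda>z. u (fst z) (snd z)) \<in> borel_measurable borel"
    and a4: "(\<integral>\<^sup>+s. indicator {0<..<T} s * suppot (u s) ^ 4 \<partial>lborel) < \<infinity>"
  shows "integrable lborel (\<lambda>z. trunc T u z * (mollker \<nu> \<delta> (z0 - z) + errker \<nu> \<delta> (z0 - z)) + flux T u z \<bullet> gradker \<nu> \<delta> (z0 - z))" (is "integrable _ ?f")
    and "(\<integral>z. trunc T u z * (mollker \<nu> \<delta> (z0 - z) + errker \<nu> \<delta> (z0 - z)) + flux T u z \<bullet> gradker \<nu> \<delta> (z0 - z) \<partial>lborel)
      = (\<integral>x. parametrix \<nu> \<delta> (z0 - (0, x)) \<partial>mp) - (\<integral>x. parametrix \<nu> \<delta> (z0 - (0, x)) \<partial>mn)"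
proof -
  note m[measurable] = measurable_trunc_flux[OF u, of T]
  obtain B where B: "0 \<le> B" "\<And>z. \<bar>mollker \<nu> \<delta> z + errker \<nu> \<delta> z\<bar> \<le> B * indicator (cball 0 1) z" "\<And>z. norm (gradker \<nu> \<delta> z) \<le> B * indicator (cball 0 1) z"
    using kernels_bounded[OF \<nu> \<delta>] by blast
  show "integrable lborel ?f"
  proof (rule integrableI_bounded)
    show "?f \<in> borel_measurable lborel" by measurable
    have "(\<integral>\<^sup>+z. ennreal (norm (?f z)) \<partial>lborel) \<le> (\<integral>\<^sup>+z. ennreal B * (ennreal (\<bar>trunc T u z\<bar> + norm (flux T u z)) * indicator (cball 0 (norm z0 + 1)) z) \<partial>lborel)"
    proof (rule nn_integral_mono)
      fix z
      have I: "indicator (cball 0 1) (z0 - z) \<le> (indicator (cball 0 (norm z0 + 1)) z :: real)"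
        using norm_triangle_ineq4[of z0 "z0 - z"] by (auto simp: indicator_def)
      have BI: "B * indicator (cball 0 1) (z0 - z) \<le> B * (indicator (cball 0 (norm z0 + 1)) z :: real)"
        by (intro mult_left_mono I B)
      have "\<bar>trunc T u z * (mollker \<nu> \<delta> (z0 - z) + errker \<nu> \<delta> (z0 - z))\<bar> \<le> \<bar>trunc T u z\<bar> * (B * indicator (cball 0 (norm z0 + 1)) z)"
        unfolding abs_mult by (intro mult_left_mono order_trans[OF B(2) BI]) auto
      moreover have "\<bar>flux T u z \<bullet> gradker \<nu> \<delta> (z0 - z)\<bar> \<le> norm (flux T u z) * (B * indicator (cball 0 (norm z0 + 1)) z)"
        by (intro order_trans[OF Cauchy_Schwarz_ineq2] mult_left_mono order_trans[OF B(3) BI]) auto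
      ultimately have "norm (?f z) \<le> B * ((\<bar>trunc T u z\<bar> + norm (flux T u z)) * indicator (cball 0 (norm z0 + 1)) z)"
        by (simp add: algebra_simps)
      then have "ennreal (norm (?f z)) \<le> ennreal (B * ((\<bar>trunc T u z\<bar> + norm (flux T u z)) * indicator (cball 0 (norm z0 + 1)) z))"
        by (rule ennreal_leI)
      also have "\<dots> = ennreal B * (ennreal (\<bar>trunc T u z\<bar> + norm (flux T u z)) * indicator (cball 0 (norm z0 + 1)) z)"
        using B(1) by (simp add: ennreal_mult ennreal_indicator del: ennreal_plus)
      finally show "ennreal (norm (?f z)) \<le> \<dots>" .
    qed
    also have "\<dots> = ennreal B * (\<integral>\<^sup>+z. ennreal (\<bar>trunc T u z\<bar> + norm (flux T u z)) * indicator (cball 0 (norm z0 + 1)) z \<partial>lborel)"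
      by (rule nn_integral_cmult) (auto intro!: borel_measurable_times_ennreal borel_measurable_indicator)
    also have "\<dots> < \<infinity>" using trunc_flux_locally_integrable[OF u a4, of "norm z0 + 1"] by (simp add: ennreal_mult_less_top)
    finally show "(\<integral>\<^sup>+z. ennreal (norm (?f z)) \<partial>lborel) < \<infinity>" .
  qed
  define \<phi> where "\<phi> z = parametrix \<nu> \<delta> (z0 - z)" for z
  have "test_fun \<phi>" unfolding \<phi>_def[abs_def] by (rule test_fun_parametrix[OF \<nu> \<delta>])
  then have eq: "(LINT z : {0<..} \<times> UNIV | lborel.
            u (fst z) (snd z) * (dt \<phi> z + \<nu> * lap_x \<phi> z + BS (u (fst z)) (snd z) \<bullet> grad_x \<phi> z))
        + ((\<integral>x. \<phi> (0, x) \<partial>mp) - (\<integral>x. \<phi> (0, x) \<partial>mn)) = 0"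
    using sol unfolding dist_solution_def by blast
  have ptw: "indicator ({0<..} \<times> UNIV) z *\<^sub>R (u (fst z) (snd z) * (dt \<phi> z + \<nu> * lap_x \<phi> z + BS (u (fst z)) (snd z) \<bullet> grad_x \<phi> z)) = - ?f z" for z
  proof -
    have h: "dt \<phi> z + \<nu> * lap_x \<phi> z = - (mollker \<nu> \<delta> (z0 - z) + errker \<nu> \<delta> (z0 - z))" "grad_x \<phi> z = - gradker \<nu> \<delta> (z0 - z)"
      unfolding \<phi>_def[abs_def] spacetime_derivs_reflect[OF smooth_parametrix[OF \<nu> \<delta>]] parametrix_kernels[OF \<nu> \<delta>, symmetric] by simp_all
    \<comment> \<open>Before time 0 both sides are cut off; inside (0, T) reflection supplies the
      minus sign; from T on the kernels vanish because z0 lies earlier.\<close>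
    consider "fst z \<le> 0" | "0 < fst z" "fst z < T" | "T \<le> fst z" by linarith
    then show ?thesis
    proof cases
      case 1
      then have "z \<notin> {0<..} \<times> UNIV" by (cases z) auto
      with 1 show ?thesis by (simp add: trunc_def flux_def)
    next
      case 2
      then have "z \<in> {0<..} \<times> UNIV" by (cases z) auto
      with 2 show ?thesis unfolding h by (simp add: trunc_def flux_def algebra_simps)
    next
      case 3
      then have "mollker \<nu> \<delta> (z0 - z) = 0 \<and> errker \<nu> \<delta> (z0 - z) = 0 \<and> gradker \<nu> \<delta> (z0 - z) = 0"
        using z0 by (intro kernels_past) simp
      then show ?thesis unfolding h by simp
    qed
  qed
  have "(LINT z : {0<..} \<times> UNIV | lborel.
            u (fst z) (snd z) * (dt \<phi> z + \<nu> * lap_x \<phi> z + BS (u (fst z)) (snd z) \<bullet> grad_x \<phi> z)) = (\<integral>z. - ?f z \<partial>lborel)"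
    unfolding set_lebesgue_integral_def ptw ..
  also have "\<dots> = - (\<integral>z. ?f z \<partial>lborel)" by (rule Bochner_Integration.integral_minus)
  finally have "- (\<integral>z. ?f z \<partial>lborel) + ((\<integral>x. \<phi> (0, x) \<partial>mp) - (\<integral>x. \<phi> (0, x) \<partial>mn)) = 0"
    using eq by simp
  then show "(\<integral>z. ?f z \<partial>lborel) = (\<integral>x. parametrix \<nu> \<delta> (z0 - (0, x)) \<partial>mp) - (\<integral>x. parametrix \<nu> \<delta> (z0 - (0, x)) \<partial>mn)"
    unfolding \<phi>_def by linarith
qed

text \<open>With w = u1 - u2 the flux difference is w K(u1) + u2 K(w). Each velocity is bounded by a
  supremum of potentials and taken out, leaving the potentials of w and u2. The summand 1 accounts
  for |w| itself. Finiteness is needed for K(u1) - K(u2) = K(w).\<close>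

lemma diff_potential_bound:
  fixes u1 u2 :: "real \<Rightarrow> real \<times> real \<Rightarrow> real"
  assumes u1: "(\<lambda>z. u1 (fst z) (snd z)) \<in> borel_measurable borel"
    and u2: "(\<lambda>z. u2 (fst z) (snd z)) \<in> borel_measurable borel"
    and fin: "suppot (u1 s) < \<infinity>" "suppot (u2 s) < \<infinity>" and s: "s \<in> {0<..<T}"
  shows "(\<integral>\<^sup>+y. ennreal (\<bar>trunc T u1 (s, y) - trunc T u2 (s, y)\<bar> + norm (flux T u1 (s, y) - flux T u2 (s, y))) * ennreal (1 / norm (x - y)) \<partial>lborel)
    \<le> (1 + (suppot (u1 s) + suppot (u2 s))) * suppot (\<lambda>y. u1 s y - u2 s y)"
proof -
  have m[measurable]: "u1 s \<in> borel_measurable borel" "u2 s \<in> borel_measurable borel"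
    using measurable_section[OF u1, of s] measurable_section[OF u2, of s] by simp_all
  define w where "w y = u1 s y - u2 s y" for y
  have w[measurable]: "w \<in> borel_measurable borel" unfolding w_def[abs_def] by measurable
  let ?p = "suppot w" and ?a1 = "suppot (u1 s)" and ?a2 = "suppot (u2 s)"
  have pf: "pot (u1 s) y < \<infinity>" "pot (u2 s) y < \<infinity>" for y
    using le_less_trans[OF pot_le_suppot[OF m(1)] fin(1)] le_less_trans[OF pot_le_suppot[OF m(2)] fin(2)] by auto
  have "(\<integral>\<^sup>+y. ennreal (\<bar>trunc T u1 (s, y) - trunc T u2 (s, y)\<bar> + norm (flux T u1 (s, y) - flux T u2 (s, y))) * ennreal (1 / norm (x - y)) \<partial>lborel)
    \<le> (\<integral>\<^sup>+y. (1 + ?a1) * ennreal (\<bar>w y\<bar> / norm (x - y)) + ?p * ennreal (\<bar>u2 s y\<bar> / norm (x - y)) \<partial>lborel)"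
  proof (rule nn_integral_mono)
    fix y
    have W: "trunc T u1 (s, y) - trunc T u2 (s, y) = w y" using s by (simp add: trunc_def w_def)
    have BSw: "BS (u1 s) y - BS (u2 s) y = BS w y"
      unfolding w_def[abs_def] by (rule BS_diff[OF m pf, symmetric])
    have "flux T u1 (s, y) - flux T u2 (s, y) = u1 s y *\<^sub>R BS (u1 s) y - u2 s y *\<^sub>R BS (u2 s) y"
      using s by (simp add: flux_def trunc_def)
    also have "\<dots> = w y *\<^sub>R BS (u1 s) y + u2 s y *\<^sub>R BS w y"
      unfolding BSw[symmetric] w_def by (simp add: algebra_simps)
    finally have "norm (flux T u1 (s, y) - flux T u2 (s, y)) \<le> \<bar>w y\<bar> * norm (BS (u1 s) y) + \<bar>u2 s y\<bar> * norm (BS w y)"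
      using norm_triangle_ineq[of "w y *\<^sub>R BS (u1 s) y" "u2 s y *\<^sub>R BS w y"] by simp
    then have "ennreal (norm (flux T u1 (s, y) - flux T u2 (s, y))) \<le> ennreal (\<bar>w y\<bar> * norm (BS (u1 s) y) + \<bar>u2 s y\<bar> * norm (BS w y))"
      by (rule ennreal_leI)
    also have "\<dots> = ennreal \<bar>w y\<bar> * ennreal (norm (BS (u1 s) y)) + ennreal \<bar>u2 s y\<bar> * ennreal (norm (BS w y))"
      by (simp add: ennreal_mult)
    also have "\<dots> \<le> ennreal \<bar>w y\<bar> * ?a1 + ennreal \<bar>u2 s y\<bar> * ?p"
      by (intro add_mono mult_left_mono order_trans[OF norm_BS_le pot_le_suppot] m w) auto
    finally have F: "ennreal (norm (flux T u1 (s, y) - flux T u2 (s, y))) \<le> ennreal \<bar>w y\<bar> * ?a1 + ennreal \<bar>u2 s y\<bar> * ?p" .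
    have "ennreal (\<bar>w y\<bar> + norm (flux T u1 (s, y) - flux T u2 (s, y))) = ennreal \<bar>w y\<bar> + ennreal (norm (flux T u1 (s, y) - flux T u2 (s, y)))"
      by simp
    also have "\<dots> \<le> ennreal \<bar>w y\<bar> + (ennreal \<bar>w y\<bar> * ?a1 + ennreal \<bar>u2 s y\<bar> * ?p)" by (intro add_left_mono F)
    also have "\<dots> = (1 + ?a1) * ennreal \<bar>w y\<bar> + ?p * ennreal \<bar>u2 s y\<bar>"
      by (simp only: distrib_left distrib_right mult_1 mult_1_right mult.commute add.assoc)
    finally have "ennreal (\<bar>w y\<bar> + norm (flux T u1 (s, y) - flux T u2 (s, y))) * ennreal (1 / norm (x - y))
       \<le> ((1 + ?a1) * ennreal \<bar>w y\<bar> + ?p * ennreal \<bar>u2 s y\<bar>) * ennreal (1 / norm (x - y))"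
      by (rule mult_right_mono) simp
    also have "\<dots> = (1 + ?a1) * (ennreal \<bar>w y\<bar> * ennreal (1 / norm (x - y))) + ?p * (ennreal \<bar>u2 s y\<bar> * ennreal (1 / norm (x - y)))"
      by (simp only: distrib_right mult.assoc)
    also have "\<dots> = (1 + ?a1) * ennreal (\<bar>w y\<bar> / norm (x - y)) + ?p * ennreal (\<bar>u2 s y\<bar> / norm (x - y))"
      by (subst (1 2) ennreal_mult[symmetric]) auto
    finally show "ennreal (\<bar>trunc T u1 (s, y) - trunc T u2 (s, y)\<bar> + norm (flux T u1 (s, y) - flux T u2 (s, y))) * ennreal (1 / norm (x - y)) \<le> \<dots>"
      unfolding W .
  qed
  also have "\<dots> = (1 + ?a1) * pot w x + ?p * pot (u2 s) x"
    unfolding pot_def by (subst nn_integral_add) (auto simp: nn_integral_cmult)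
  also have "\<dots> \<le> (1 + ?a1) * ?p + ?p * ?a2"
    by (intro add_mono mult_left_mono pot_le_suppot m w) auto
  also have "\<dots> = (1 + (?a1 + ?a2)) * ?p" by (simp only: distrib_left distrib_right mult_1 mult_1_right mult.commute add.assoc)
  finally show ?thesis by (simp only: w_def[abs_def])
qed

lemma suppot_integrable_from_LqLp:
  assumes "in_LqLp 4 4 T u" "in_LqLp 4 (4/3) T u"
  shows "(\<integral>\<^sup>+s. indicator {0<..<T} s * suppot (u s) ^ 4 \<partial>lborel) < \<infinity>"
    and "(\<lambda>z. u (fst z) (snd z)) \<in> borel_measurable borel"
proof -
  show u[measurable]: "(\<lambda>z. u (fst z) (snd z)) \<in> borel_measurable borel"
    using assms(1) by (simp add: in_LqLp_def st_meas_def)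
  have us[measurable]: "u s \<in> borel_measurable borel" for s using measurable_section[OF u, of s] by simp
  have Lpm: "(\<lambda>s. Lp_norm p (u s)) \<in> borel_measurable borel" for p
  proof -
    have "(\<lambda>s. Lp_pow p (u s)) \<in> borel_measurable borel"
      unfolding Lp_pow_def by (intro measurable_nn_integral_param) measurable
    then show ?thesis unfolding Lp_norm_def by measurable
  qed
  note [measurable] = Lpm
  obtain C :: ennreal where C: "C < \<infinity>" "\<And>f. f \<in> borel_measurable borel \<Longrightarrow> suppot f ^ 4 \<le> C * (Lp_norm 4 f ^ 4 + Lp_norm (4/3) f ^ 4)"
    using suppot_power4_le by blast
  have "(\<integral>\<^sup>+s. indicator {0<..<T} s * suppot (u s) ^ 4 \<partial>lborel)
    \<le> (\<integral>\<^sup>+s. C * (indicator {0<..<T} s * Lp_norm 4 (u s) ^ 4 + indicator {0<..<T} s * Lp_norm (4/3) (u s) ^ 4) \<partial>lborel)"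
    using C(2)[OF us] by (intro nn_integral_mono) (auto split: split_indicator)
  also have "\<dots> = C * ((\<integral>\<^sup>+s. indicator {0<..<T} s * Lp_norm 4 (u s) ^ 4 \<partial>lborel) + (\<integral>\<^sup>+s. indicator {0<..<T} s * Lp_norm (4/3) (u s) ^ 4 \<partial>lborel))"
    by (subst nn_integral_cmult, measurable) (subst nn_integral_add, measurable)
  also have "\<dots> < \<infinity>" using C(1) assms by (simp add: in_LqLp_def ennreal_mult_less_top)
  finally show "(\<integral>\<^sup>+s. indicator {0<..<T} s * suppot (u s) ^ 4 \<partial>lborel) < \<infinity>" .
qed

text \<open>A finite horizon is fixed because the norms are assumed finite only on each (0,
  T).\<close>

lemma unique_until:
  assumes \<nu>: "0 < \<nu>"
    and sol: "dist_solution \<nu> mp mn u1" "dist_solution \<nu> mp mn u2"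
    and L1: "in_LqLp 4 4 T u1" "in_LqLp 4 (4/3) T u1" and L2: "in_LqLp 4 4 T u2" "in_LqLp 4 (4/3) T u2"
  shows "AE z in lborel. 0 < fst z \<and> fst z < T \<longrightarrow> u1 (fst z) (snd z) = u2 (fst z) (snd z)"
proof -
  note a1 = suppot_integrable_from_LqLp[OF L1] and a2 = suppot_integrable_from_LqLp[OF L2]
  note m1[measurable] = measurable_trunc_flux[OF a1(2), of T] and m2[measurable] = measurable_trunc_flux[OF a2(2), of T]
  define I where "I = {0<..<T}"
  have I[measurable]: "I \<in> sets borel" by (simp add: I_def)
  define W where "W z = trunc T u1 z - trunc T u2 z" for z
  define F where "F z = flux T u1 z - flux T u2 z" for z
  have W[measurable]: "W \<in> borel_measurable borel" and F[measurable]: "F \<in> borel_measurable borel"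
    unfolding W_def[abs_def] F_def[abs_def] using m1 m2 by (auto intro!: borel_measurable_diff)
  have loc: "(\<integral>\<^sup>+z. ennreal (\<bar>W z\<bar> + norm (F z)) * indicator (cball 0 R) z \<partial>lborel) < \<infinity>" for R
  proof -
    let ?h = "\<lambda>u z. ennreal (\<bar>trunc T u z\<bar> + norm (flux T u z)) * indicator (cball 0 R) z"
    have cb[measurable]: "cball (0::spt) R \<in> sets borel" by simp
    have "(\<integral>\<^sup>+z. ennreal (\<bar>W z\<bar> + norm (F z)) * indicator (cball 0 R) z \<partial>lborel) \<le> (\<integral>\<^sup>+z. ?h u1 z + ?h u2 z \<partial>lborel)"
    proof (rule nn_integral_mono)
      fix z
      have "\<bar>W z\<bar> + norm (F z) \<le> (\<bar>trunc T u1 z\<bar> + norm (flux T u1 z)) + (\<bar>trunc T u2 z\<bar> + norm (flux T u2 z))"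
        using abs_triangle_ineq4[of "trunc T u1 z" "trunc T u2 z"] norm_triangle_ineq4[of "flux T u1 z" "flux T u2 z"]
        by (simp add: W_def F_def)
      then have "ennreal (\<bar>W z\<bar> + norm (F z)) \<le> ennreal (\<bar>trunc T u1 z\<bar> + norm (flux T u1 z)) + ennreal (\<bar>trunc T u2 z\<bar> + norm (flux T u2 z))"
        by (subst ennreal_plus[symmetric]) (auto intro!: ennreal_leI simp del: ennreal_plus)
      then show "ennreal (\<bar>W z\<bar> + norm (F z)) * indicator (cball 0 R) z \<le> ?h u1 z + ?h u2 z"
        unfolding distrib_right[symmetric] by (rule mult_right_mono) simp
    qed
    also have "\<dots> = (\<integral>\<^sup>+z. ?h u1 z \<partial>lborel) + (\<integral>\<^sup>+z. ?h u2 z \<partial>lborel)"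
      by (intro nn_integral_add) measurable
    also have "\<dots> < \<infinity>"
      using trunc_flux_locally_integrable[OF a1(2,1)] trunc_flux_locally_integrable[OF a2(2,1)] by simp
    finally show ?thesis .
  qed
  \<comment> \<open>The initial-value terms are identical for the two solutions and cancel.\<close>
  have weak: "(\<integral>z. W z * (mollker \<nu> \<delta> (z0 - z) + errker \<nu> \<delta> (z0 - z)) + F z \<bullet> gradker \<nu> \<delta> (z0 - z) \<partial>lborel) = 0"
    if "0 < \<delta>" "fst z0 < T" for \<delta> z0
  proof -
    note k1 = solution_kernel_identity[OF \<nu> that sol(1) a1(2,1)] and k2 = solution_kernel_identity[OF \<nu> that sol(2) a2(2,1)]
    have "(\<integral>z. W z * (mollker \<nu> \<delta> (z0 - z) + errker \<nu> \<delta> (z0 - z)) + F z \<bullet> gradker \<nu> \<delta> (z0 - z) \<partial>lborel)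
      = (\<integral>z. (trunc T u1 z * (mollker \<nu> \<delta> (z0 - z) + errker \<nu> \<delta> (z0 - z)) + flux T u1 z \<bullet> gradker \<nu> \<delta> (z0 - z))
         - (trunc T u2 z * (mollker \<nu> \<delta> (z0 - z) + errker \<nu> \<delta> (z0 - z)) + flux T u2 z \<bullet> gradker \<nu> \<delta> (z0 - z)) \<partial>lborel)"
      by (intro Bochner_Integration.integral_cong refl) (simp add: W_def F_def algebra_simps)
    also have "\<dots> = 0"
      unfolding Bochner_Integration.integral_diff[OF k1(1) k2(1)] k1(2) k2(2) by simp
    finally show ?thesis .
  qed
  define P where "P t = suppot (\<lambda>x. W (t, x))" for t
  define b where "b s = indicator I s * (1 + (suppot (u1 s) + suppot (u2 s)))" for s
  note [measurable] = measurable_suppot[OF a1(2)] measurable_suppot[OF a2(2)]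
  have Pm[measurable]: "P \<in> borel_measurable borel" unfolding P_def[abs_def] by (rule measurable_suppot) simp
  have bm[measurable]: "b \<in> borel_measurable borel" unfolding b_def[abs_def] by measurable
  have WI: "(\<lambda>x. W (s, x)) = (if s \<in> I then (\<lambda>x. u1 s x - u2 s x) else (\<lambda>x. 0))" for s
    by (auto simp: W_def trunc_def I_def)
  have P0: "P t = 0" if "t \<notin> I" for t using that by (simp add: P_def WI)
  have us: "u1 s \<in> borel_measurable borel" "u2 s \<in> borel_measurable borel" for s
    using measurable_section[OF a1(2), of s] measurable_section[OF a2(2), of s] by simp_all
  \<comment> \<open>This comparison puts P in L^4 of time: the fourth-power integrability of b
    carries over.\<close>
  have Pb: "P t \<le> b t" for t
  proof (cases "t \<in> I")
    case True
    have "P t \<le> suppot (u1 t) + suppot (u2 t)"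
      unfolding P_def WI using True
      by (auto intro!: suppot_leI order_trans[OF pot_diff_le] add_mono pot_le_suppot us)
    also have "\<dots> \<le> 1 + (suppot (u1 t) + suppot (u2 t))" by (simp add: add_increasing)
    finally show ?thesis using True by (simp add: b_def)
  qed (simp add: P0)
  have b4: "(\<integral>\<^sup>+s. b s ^ 4 \<partial>lborel) < \<infinity>"
  proof -
    have "(\<integral>\<^sup>+s. b s ^ 4 \<partial>lborel) \<le> (\<integral>\<^sup>+s. 16 * (indicator I s + 16 * (indicator I s * suppot (u1 s) ^ 4 + indicator I s * suppot (u2 s) ^ 4)) \<partial>lborel)"
    proof (rule nn_integral_mono)
      fix s
      have "(1 + (suppot (u1 s) + suppot (u2 s))) ^ 4 \<le> 16 * (1 ^ 4 + (suppot (u1 s) + suppot (u2 s)) ^ 4)" by (rule ennreal_add_power4_le)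
      also have "\<dots> \<le> 16 * (1 + 16 * (suppot (u1 s) ^ 4 + suppot (u2 s) ^ 4))"
        by (intro mult_left_mono add_mono ennreal_add_power4_le) auto
      finally show "b s ^ 4 \<le> 16 * (indicator I s + 16 * (indicator I s * suppot (u1 s) ^ 4 + indicator I s * suppot (u2 s) ^ 4))"
        by (auto simp: b_def split: split_indicator)
    qed
    also have "\<dots> = 16 * ((\<integral>\<^sup>+s. indicator I s \<partial>lborel) + 16 * ((\<integral>\<^sup>+s. indicator I s * suppot (u1 s) ^ 4 \<partial>lborel) + (\<integral>\<^sup>+s. indicator I s * suppot (u2 s) ^ 4 \<partial>lborel)))"
      by (simp add: nn_integral_cmult nn_integral_add)
    also have "\<dots> < \<infinity>"
      using a1(1) a2(1) emeasure_lborel_box_finite[of 0 T] unfolding I_def by (simp add: ennreal_mult_less_top box_real)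
    finally show ?thesis .
  qed
  have "(\<integral>\<^sup>+s. P s ^ 4 \<partial>lborel) \<le> (\<integral>\<^sup>+s. b s ^ 4 \<partial>lborel)"
    by (intro nn_integral_mono power_mono Pb) simp
  then have P4: "(\<integral>\<^sup>+s. P s ^ 4 \<partial>lborel) < \<infinity>" using b4 by (rule le_less_trans)
  define H where "H z = ennreal (\<bar>W z\<bar> + norm (F z))" for z
  have H[measurable]: "H \<in> borel_measurable borel" unfolding H_def[abs_def] by measurable
  obtain C :: ennreal where C: "C < \<infinity>" and mild: "AE z0 in lborel. fst z0 < T \<longrightarrow> ennreal \<bar>W z0\<bar> \<le>
      C * (\<integral>\<^sup>+z. H z * ennreal (hkbound \<nu> (fst z0 - fst z) (snd z0 - snd z)) \<partial>lborel)"
    using mild_bound[OF \<nu>] W F loc weak unfolding H_def by meson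
  have mild': "AE z0 in lborel. ennreal \<bar>W z0\<bar> \<le> C * (\<integral>\<^sup>+z. H z * ennreal (hkbound \<nu> (fst z0 - fst z) (snd z0 - snd z)) \<partial>lborel)"
    using mild by eventually_elim (auto simp: W_def trunc_def split: split_indicator)
  \<comment> \<open>Finite b at a time in (0, T) means that both slices have finite potentials, as
    linearity of the velocity requires.\<close>
  have bS: "AE s in lborel. b s \<noteq> \<infinity>"
  proof -
    have "AE s in lborel. b s ^ 4 \<noteq> \<infinity>" using b4 by (intro nn_integral_PInf_AE) auto
    then show ?thesis by eventually_elim auto
  qed
  have S: "AE s in lborel. \<forall>x. (\<integral>\<^sup>+y. H (s, y) * ennreal (1 / norm (x - y)) \<partial>lborel) \<le> b s * P s"
    using bS
  proof eventually_elim
    case (elim s)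
    show ?case
    proof (cases "s \<in> I")
      case True
      then have fin: "suppot (u1 s) < \<infinity>" "suppot (u2 s) < \<infinity>" using elim by (auto simp: b_def less_top)
      show ?thesis
        using diff_potential_bound[OF a1(2) a2(2) fin True[unfolded I_def]] True
        by (simp add: H_def W_def F_def b_def P_def WI)
           (simp add: trunc_def I_def)
    next
      case False
      then have "H (s, y) = 0" for y by (simp add: H_def W_def F_def flux_def trunc_def I_def)
      then show ?thesis by simp
    qed
  qed
  have "AE t in lborel. P t \<le> C * gauss_mass \<nu> * (\<integral>\<^sup>+s. (ennreal ((t - s) powr (- (1/6))) * indicator {0..1} (t - s)) ^ 3 * (b s * P s) \<partial>lborel)"
    unfolding P_def by (rule suppot_conv_le[OF \<nu> W H _ mild' S[unfolded P_def]]) (use Pm bm in \<open>simp add: P_def[abs_def]\<close>)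
  then have "AE t in lborel. P t = 0"
    by (rule volterra_zero[OF Pm bm, rotated])
       (use P0 C gauss_mass_finite[OF \<nu>] P4 b4 in \<open>auto simp: I_def ennreal_mult_less_top\<close>)
  then have "AE t in lborel. AE x in lborel. W (t, x) = 0"
  proof eventually_elim
    case (elim t)
    have Wt: "(\<lambda>x. W (t, x)) \<in> borel_measurable borel" by (rule measurable_section[OF W])
    \<comment> \<open>One centre is enough: the kernel 1/|y| is strictly positive off the
      origin.\<close>
    have "pot (\<lambda>x. W (t, x)) 0 \<le> 0" using pot_le_suppot[OF Wt, of 0] elim by (simp add: P_def)
    then show ?case using pot_eq_0D[OF Wt] by simp
  qed
  moreover have "{z \<in> space (lborel \<Otimes>\<^sub>M lborel). W z = 0} \<in> sets (lborel \<Otimes>\<^sub>M lborel)"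
    unfolding lborel_prod by measurable
  ultimately have "AE z in lborel \<Otimes>\<^sub>M lborel. W z = 0"
    by (intro lborel_pair.AE_pair_measure)
  then have "AE z in lborel. W z = 0" unfolding lborel_prod .
  then show ?thesis by eventually_elim (auto simp: W_def trunc_def split: split_indicator_asm)
qed

theorem theorem2p4:
  fixes \<nu> :: real and mp mn :: "(real \<times> real) measure"
    and u1 u2 :: "real \<Rightarrow> real \<times> real \<Rightarrow> real"
  assumes "\<nu> > 0"
    and "finite_borel_meas mp" and "finite_borel_meas mn"
    and "dist_solution \<nu> mp mn u1" and "dist_solution \<nu> mp mn u2"
    and "\<And>T. T > 0 \<Longrightarrow> in_LqLp 4 4 T u1 \<and> in_LqLp 4 (4/3) T u1"
    and "\<And>T. T > 0 \<Longrightarrow> in_LqLp 4 4 T u2 \<and> in_LqLp 4 (4/3) T u2"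
    and "\<And>T. T > 0 \<Longrightarrow> in_Linf_Hm1 T (\<lambda>t x. u1 t x - u2 t x)"
    and "\<And>T. T > 0 \<Longrightarrow> AE t in lborel. t \<in> {0<..<T} \<longrightarrow> integrable lborel (\<lambda>x. u1 t x - u2 t x)"
    and "\<And>\<phi>::real \<times> real \<Rightarrow> real. test_fun \<phi> \<Longrightarrow>
          ((\<lambda>t. esssup (restrict_space lborel {0<..<t})
                  (\<lambda>s. ereal (\<integral>x. (u1 s x - u2 s x) * \<phi> x \<partial>lborel))) \<longlongrightarrow> 0) (at_right 0)"
  shows "AE z in lborel. fst z > 0 \<longrightarrow> u1 (fst z) (snd z) = u2 (fst z) (snd z)"
proof -
  \<comment> \<open>Integer horizons make the exceptional null sets countable in number;
    \<open>Suc n\<close> keeps each horizon positive.\<close>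
  have "AE z in lborel. 0 < fst z \<and> fst z < real (Suc n) \<longrightarrow> u1 (fst z) (snd z) = u2 (fst z) (snd z)" for n
    using assms(6,7)[of "real (Suc n)"] by (intro unique_until[OF assms(1,4,5)]) auto
  then have "AE z in lborel. \<forall>n. 0 < fst z \<and> fst z < real (Suc n) \<longrightarrow> u1 (fst z) (snd z) = u2 (fst z) (snd z)"
    unfolding AE_all_countable by blast
  then show ?thesis
  proof eventually_elim
    case (elim z)
    obtain n where "fst z < real n" using reals_Archimedean2 by blast
    then have "fst z < real (Suc n)" by simp
    with elim show ?case by blast
  qed
qed

end
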